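(* Let $F$ be the field with $8$ elements, let $C = F^{\times}$, let $\mathcal{G} = \mathrm{Gal}(F/\mathbb{Z}_2)$, and let $P$ be the $C\mathcal{G}$-invariant $2$-group constructed from $F$ as described in the context. Let $G = P \rtimes (C\mathcal{G})$ be the semidirect product of $C\mathcal{G}$ acting on $P$. Then $G$ has exactly three real irreducible characters.
   Context: A real irreducible character of a finite group is a complex irreducible character all of whose values are real. Construction of $G$. Let $F$ be the field of order $8$ and let $\mathrm{Tr} : F \to \mathbb{Z}_2$ be the trace map $\mathrm{Tr}(\alpha) = \alpha + \alpha^2 + \alpha^4$. Let $F\{X\}$ be the skew polynomial ring over $F$ in the indeterminate $X$, with multiplication determined by $X\alpha = \alpha^2 X$ for all $\alpha \in F$. Let $R = F\{X\}/(X^5)$ and let $x$ be the image of $X$ in $R$. The Jacobson radical of $R$ is $J = \{\alpha_1 x + \alpha_2 x^2 + \alpha_3 x^3 + \alpha_4 x^4 \mid \alpha_i \in F\}$. Let $Q = 1 + J$, a subgroup of the group of units of $R$, of order $2^{12}$. For $i = 1, \dots, 5$ put $Q^i = 1 + J^i$, which is a subgroup of $Q$ (here $Q^i$ is not the set or group of $i$-th powers). Let $C = F^{\times}$ be the multiplicative group of $F$, embedded in the units of $R$ as constant polynomials. $C$ acts on $Q$ by conjugation ($q^c = c^{-1} q c$), so that $$(1 + \alpha_1 x + \alpha_2 x^2 + \alpha_3 x^3 + \alpha_4 x^4)^c = 1 + \alpha_1 c x + \alpha_2 c^3 x^2 + \alpha_3 x^3 + \alpha_4 c x^4 .$$ Let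 $\mathcal{G}$ be the Galois group of $F$ over $\mathbb{Z}_2$ (cyclic of order $3$). It acts on $QC$ by acting on the coefficients of the elements of $Q$ and on $C$ as on $F$. The semidirect product $C\mathcal{G}$ is a Frobenius group of order $21$ acting on $Q$ by automorphisms. For a group $A$ acting on a group $H$, $[H,A]$ denotes the subgroup generated by all $h^{-1}h^{a}$ with $h \in H$, $a \in A$. Define $$X = [Q^3, \mathcal{G}]\,Q^4 = \{1 + \alpha_3 x^3 + \alpha_4 x^4 \mid \alpha_3 \in \ker \mathrm{Tr},\ \alpha_4 \in F\}$$ (reusing the letter $X$ for this subgroup), $$Y = [Q^2, C]\,X = \{1 + \alpha_2 x^2 + \alpha_3 x^3 + \alpha_4 x^4 \mid \alpha_2, \alpha_4 \in F,\ \alpha_3 \in \ker \mathrm{Tr}\},$$ and $P = [Q, C]\,Y$. Then $P$ is a $C\mathcal{G}$-invariant subgroup of index $2$ in $Q$ (so $|P| = 2^{11}$). The group $G$ is the semidirect product of $C\mathcal{G}$ acting on $P$ by the restriction to $P$ of the action of $C\mathcal{G}$ on $Q$ in which $C$ acts by conjugation ($q^c = c^{-1} q c$) and $\mathcal{G}$ acts on the coefficients of the elements of $Q$, so $|G| = 2^{11}\cdot 21$. *)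

theory Defs
  imports
    "HOL-Algebra.UnivPoly"
    "HOL-Algebra.QuotRing"
    "HOL-Algebra.Ideal_Product"
    "HOL-Algebra.Generated_Groups"
    "Jordan_Normal_Form.VS_Connect"
begin

section \<open>Complex characters of a group\<close>

definition mat_trace :: "'a::comm_monoid_add mat \<Rightarrow> 'a" where
  "mat_trace A = (\<Sum>i<dim_row A. A $$ (i, i))"

definition GL :: "nat \<Rightarrow> complex mat monoid" where
  "GL n = units_of (ring_mat TYPE(complex) n ())"

definition irreducible_rep :: "('g, 'm) monoid_scheme \<Rightarrow> nat \<Rightarrow> ('g \<Rightarrow> complex mat) \<Rightarrow> bool" where
  "irreducible_rep G n \<rho> \<longleftrightarrow>
     n > 0 \<and> \<rho> \<in> hom G (GL n) \<and>
     (\<forall>W. VectorSpace.subspace class_ring W (module_vec TYPE(complex) n) \<and>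
          (\<forall>g\<in>carrier G. \<forall>w\<in>W. \<rho> g *\<^sub>v w \<in> W) \<longrightarrow>
          W = {0\<^sub>v n} \<or> W = carrier_vec n)"

text \<open>
  Characters are functions on \<^term>\<open>carrier G\<close>. They are made \<^const>\<open>undefined\<close> outside of it so
  that equality of characters is equality on \<^term>\<open>carrier G\<close>, and counting them is meaningful.
\<close>

definition irreducible_characters :: "('g, 'm) monoid_scheme \<Rightarrow> ('g \<Rightarrow> complex) set" where
  "irreducible_characters G =
     {\<lambda>g\<in>carrier G. mat_trace (\<rho> g) | n \<rho>. irreducible_rep G n \<rho>}"

definition real_irreducible_characters :: "('g, 'm) monoid_scheme \<Rightarrow> ('g \<Rightarrow> complex) set" where
  "real_irreducible_characters G =
     {\<chi> \<in> irreducible_characters G. \<forall>g\<in>carrier G. \<chi> g \<in> \<real>}"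

section \<open>Right actions\<close>

text \<open>
  All actions are right actions: \<open>act k h\<close> stands for \<open>h\<^sup>k\<close>, and \<open>h\<^bsup>kl\<^esup> = (h\<^sup>k)\<^sup>l\<close>.
  In the semidirect product the pair \<open>(h, k)\<close> stands for the product \<open>k h\<close>, whence
  \<open>k\<^sub>1 h\<^sub>1 k\<^sub>2 h\<^sub>2 = k\<^sub>1 k\<^sub>2 h\<^sub>1\<^bsup>k\<^sub>2\<^esup> h\<^sub>2\<close>.
\<close>

definition semidirect ::
  "('h, 'm) monoid_scheme \<Rightarrow> ('k, 'n) monoid_scheme \<Rightarrow> ('k \<Rightarrow> 'h \<Rightarrow> 'h) \<Rightarrow> ('h \<times> 'k) monoid" where
  "semidirect H K act =
     \<lparr>carrier = carrier H \<times> carrier K,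
      mult = (\<lambda>(h1, k1) (h2, k2). (act k2 h1 \<otimes>\<^bsub>H\<^esub> h2, k1 \<otimes>\<^bsub>K\<^esub> k2)),
      one = (\<one>\<^bsub>H\<^esub>, \<one>\<^bsub>K\<^esub>)\<rparr>"

definition action_commutator ::
  "('h, 'm) monoid_scheme \<Rightarrow> ('k \<Rightarrow> 'h \<Rightarrow> 'h) \<Rightarrow> 'h set \<Rightarrow> 'k set \<Rightarrow> 'h set" where
  "action_commutator M act H A = generate M {inv\<^bsub>M\<^esub> h \<otimes>\<^bsub>M\<^esub> act a h | h a. h \<in> H \<and> a \<in> A}"

section \<open>The truncated skew polynomial ring\<close>

text \<open>
  The skew polynomial ring has the same additive structure as \<^term>\<open>UP F\<close>; the rule
  \<open>X \<alpha> = \<theta>(\<alpha>) X\<close> gives \<open>(\<alpha> X\<^sup>i) (\<beta> X\<^sup>j) = \<alpha> \<theta>\<^sup>i(\<beta>) X\<^bsup>i+j\<^esup>\<close>.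
\<close>

definition skew_UP :: "('a, 'm) ring_scheme \<Rightarrow> ('a \<Rightarrow> 'a) \<Rightarrow> ('a, nat \<Rightarrow> 'a) up_ring" where
  "skew_UP F \<theta> =
     (UP F)\<lparr>mult := (\<lambda>p\<in>up F. \<lambda>q\<in>up F. \<lambda>n. \<Oplus>\<^bsub>F\<^esub>i\<in>{..n}. p i \<otimes>\<^bsub>F\<^esub> (\<theta> ^^ i) (q (n - i)))\<rparr>"

context
  fixes F :: "('a, 'm) ring_scheme" (structure)
begin

definition skew_poly_ring :: "('a, nat \<Rightarrow> 'a) up_ring" where
  "skew_poly_ring = skew_UP F (\<lambda>\<alpha>. \<alpha> [^] (2::nat))"

definition X_pow5_ideal :: "(nat \<Rightarrow> 'a) set" where
  "X_pow5_ideal =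
     Idl\<^bsub>skew_poly_ring\<^esub> {up_ring.monom skew_poly_ring \<one> 1 [^]\<^bsub>skew_poly_ring\<^esub> (5::nat)}"

definition R_ring :: "(nat \<Rightarrow> 'a) set ring" where
  "R_ring = skew_poly_ring Quot X_pow5_ideal"

definition const_R :: "'a \<Rightarrow> (nat \<Rightarrow> 'a) set" where
  "const_R \<alpha> = X_pow5_ideal +>\<^bsub>skew_poly_ring\<^esub> up_ring.monom skew_poly_ring \<alpha> 0"

definition x_R :: "(nat \<Rightarrow> 'a) set" where
  "x_R = X_pow5_ideal +>\<^bsub>skew_poly_ring\<^esub> up_ring.monom skew_poly_ring \<one> 1"

definition J_ideal :: "(nat \<Rightarrow> 'a) set set" where
  "J_ideal =
     {const_R \<alpha>1 \<otimes>\<^bsub>R_ring\<^esub> x_R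
      \<oplus>\<^bsub>R_ring\<^esub> const_R \<alpha>2 \<otimes>\<^bsub>R_ring\<^esub> x_R [^]\<^bsub>R_ring\<^esub> (2::nat)
      \<oplus>\<^bsub>R_ring\<^esub> const_R \<alpha>3 \<otimes>\<^bsub>R_ring\<^esub> x_R [^]\<^bsub>R_ring\<^esub> (3::nat)
      \<oplus>\<^bsub>R_ring\<^esub> const_R \<alpha>4 \<otimes>\<^bsub>R_ring\<^esub> x_R [^]\<^bsub>R_ring\<^esub> (4::nat)
      | \<alpha>1 \<alpha>2 \<alpha>3 \<alpha>4. \<alpha>1 \<in> carrier F \<and> \<alpha>2 \<in> carrier F \<and> \<alpha>3 \<in> carrier F \<and> \<alpha>4 \<in> carrier F}"

primrec J_pow :: "nat \<Rightarrow> (nat \<Rightarrow> 'a) set set" where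
  "J_pow 0 = carrier R_ring"
| "J_pow (Suc i) = ideal_prod R_ring (J_pow i) J_ideal"

definition Q_pow :: "nat \<Rightarrow> (nat \<Rightarrow> 'a) set set" where
  "Q_pow i = {\<one>\<^bsub>R_ring\<^esub> \<oplus>\<^bsub>R_ring\<^esub> j | j. j \<in> J_pow i}"

section \<open>The groups \<open>C\<close>, \<open>Gal(F/Z\<^sub>2)\<close>, \<open>C Gal(F/Z\<^sub>2)\<close> and their actions\<close>

definition C_group :: "'a monoid" where
  "C_group = units_of F"

text \<open>
  The Galois group consists of the field automorphisms fixing the prime field \<open>{0, 1}\<close>. Being a
  group of right operators, it has the multiplication \<open>\<sigma> \<tau> = \<tau> \<circ> \<sigma>\<close>.
\<close>

definition Gal_group :: "('a \<Rightarrow> 'a) monoid" where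
  "Gal_group =
     \<lparr>carrier = {\<sigma> \<in> ring_iso F F \<inter> extensional (carrier F). \<forall>z\<in>{\<zero>, \<one>}. \<sigma> z = z},
      mult = (\<lambda>\<sigma> \<tau>. compose (carrier F) \<tau> \<sigma>),
      one = (\<lambda>\<alpha>\<in>carrier F. \<alpha>)\<rparr>"

definition CGal_group :: "('a \<times> ('a \<Rightarrow> 'a)) monoid" where
  "CGal_group = semidirect C_group Gal_group (\<lambda>\<sigma> c. \<sigma> c)"

definition C_act :: "'a \<Rightarrow> (nat \<Rightarrow> 'a) set \<Rightarrow> (nat \<Rightarrow> 'a) set" where
  "C_act c q = inv\<^bsub>R_ring\<^esub> (const_R c) \<otimes>\<^bsub>R_ring\<^esub> q \<otimes>\<^bsub>R_ring\<^esub> const_R c"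

text \<open>
  The elements of \<open>R\<close> are cosets of skew polynomials, so the action on coefficients is the
  image of the coset under the coefficientwise action.
\<close>

definition Gal_act :: "('a \<Rightarrow> 'a) \<Rightarrow> (nat \<Rightarrow> 'a) set \<Rightarrow> (nat \<Rightarrow> 'a) set" where
  "Gal_act \<sigma> q = (\<lambda>p n. \<sigma> (p n)) ` q"

definition CGal_act :: "'a \<times> ('a \<Rightarrow> 'a) \<Rightarrow> (nat \<Rightarrow> 'a) set \<Rightarrow> (nat \<Rightarrow> 'a) set" where
  "CGal_act = (\<lambda>(c, \<sigma>) q. C_act c (Gal_act \<sigma> q))"

section \<open>The groups \<open>P\<close> and \<open>G\<close>\<close>

definition X_subgroup :: "(nat \<Rightarrow> 'a) set set" where
  "X_subgroup =
     action_commutator (units_of R_ring) Gal_act (Q_pow 3) (carrier Gal_group)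
     <#>\<^bsub>units_of R_ring\<^esub> Q_pow 4"

definition Y_subgroup :: "(nat \<Rightarrow> 'a) set set" where
  "Y_subgroup =
     action_commutator (units_of R_ring) C_act (Q_pow 2) (carrier C_group)
     <#>\<^bsub>units_of R_ring\<^esub> X_subgroup"

definition P_subgroup :: "(nat \<Rightarrow> 'a) set set" where
  "P_subgroup =
     action_commutator (units_of R_ring) C_act (Q_pow 1) (carrier C_group)
     <#>\<^bsub>units_of R_ring\<^esub> Y_subgroup"

definition P_group :: "(nat \<Rightarrow> 'a) set monoid" where
  "P_group = (units_of R_ring)\<lparr>carrier := P_subgroup\<rparr>"

definition G_group :: "((nat \<Rightarrow> 'a) set \<times> ('a \<times> ('a \<Rightarrow> 'a))) monoid" where
  "G_group = semidirect P_group CGal_group CGal_act"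

end

end

theory Submission
  imports
    Defs
    "Jordan_Normal_Form.Spectral_Radius"
    "Jordan_Normal_Form.Schur_Decomposition"
    "HOL-Algebra.Multiplicative_Group"
    "HOL-Library.Z2"
    "HOL-Computational_Algebra.Formal_Power_Series"
begin

text \<open>
  The number of real irreducible characters of a finite group is the number of its real classes:
  evaluate the sum of all \<open>\<chi>(g)\<^sup>2\<close> by the orthogonality of \<open>\<chi>\<close> and its conjugate, and by the column
  orthogonality of \<open>g\<close> and \<open>g\<^sup>-\<^sup>1\<close>.

  If \<open>g\<close> is a real element of \<open>G\<close>, then \<open>g \<in> P\<close>, since a group of odd order such as \<open>C Gal(F/Z\<^sub>2)\<close> has no
  nontrivial real elements, and a suitable odd power of an inverting element inverts \<open>g\<close> inside of
  \<open>P\<close>. Comparing coefficients in \<open>p u p = u\<close> for \<open>p, u \<in> Q\<close> gives \<open>p \<in> Q\<^sup>3\<close>: for the coefficient of \<open>x\<close>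
  since \<open>F\<close> has no primitive cube root of unity, and for that of \<open>x\<^sup>2\<close> since \<open>z + z\<^sup>4\<close> has trace 0 while 1
  has trace 1. Thus the real elements are those of \<open>X\<close>. They fall into three classes: the identity,
  the other elements of \<open>Q\<^sup>4\<close>, which \<open>C\<close> permutes transitively, and the rest of \<open>X\<close>, on whose
  coefficients of \<open>x\<^sup>3\<close> the Galois group is transitive, while conjugation by \<open>P\<close> changes the coefficient of
  \<open>x\<^sup>4\<close> arbitrarily.
\<close>

section \<open>Matrix representations\<close>

text \<open>Column orthogonality needs the irreducible characters to span the class functions.
  Complete reducibility is bypassed: a class function orthogonal to all characters acts as 0 on
  every irreducible representation; were it nonzero, its convolution with its adjoint would be
  nonzero at the identity, a value that the trace of the regular representation detects, and would
  act as a nonzero scalar on some irreducible representation.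

  The field is arbitrary and the elements of \<open>R_ring\<close> are cosets. Everything is
  therefore carried over to a concrete model, in which an element of Q is four coordinates and
  identities in the field are finite computations.

  P is given by commutators, and the homomorphism \<open>lam\<close> turns this into a test for
  membership. On \<open>Q^3\<close> it is the trace of the coefficient of x^3, so \<open>Q^3\<close>
  meets P exactly in X; yet P retains elements with every coefficient of x. The elements of X are
  involutions and hence real, so the work lies in excluding all others. The relation
  \<open>g w g = w\<close>, free of inverses, is the form in which reality is compared coefficient
  by coefficient.\<close>

definition matrix_rep :: "('g, 'm) monoid_scheme \<Rightarrow> nat \<Rightarrow> ('g \<Rightarrow> complex mat) \<Rightarrow> bool" where
  "matrix_rep G n \<rho> \<longleftrightarrow>
     (\<forall>g\<in>carrier G. \<rho> g \<in> carrier_mat n n) \<and>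
     (\<forall>g\<in>carrier G. \<forall>h\<in>carrier G. \<rho> (g \<otimes>\<^bsub>G\<^esub> h) = \<rho> g * \<rho> h) \<and> \<rho> \<one>\<^bsub>G\<^esub> = 1\<^sub>m n"

definition vec_subspace :: "nat \<Rightarrow> 'a::field vec set \<Rightarrow> bool" where
  "vec_subspace n W \<longleftrightarrow> W \<subseteq> carrier_vec n \<and> 0\<^sub>v n \<in> W \<and>
     (\<forall>v\<in>W. \<forall>w\<in>W. v + w \<in> W) \<and> (\<forall>c. \<forall>v\<in>W. c \<cdot>\<^sub>v v \<in> W)"

definition invariant_under :: "('g, 'm) monoid_scheme \<Rightarrow> ('g \<Rightarrow> complex mat) \<Rightarrow> complex vec set \<Rightarrow> bool" where
  "invariant_under G \<rho> W \<longleftrightarrow> (\<forall>g\<in>carrier G. \<forall>w\<in>W. \<rho> g *\<^sub>v w \<in> W)"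

lemma subspace_iff_vec_subspace:
  "VectorSpace.subspace class_ring W (module_vec TYPE('a::field) n) \<longleftrightarrow> vec_subspace n W"
  unfolding VectorSpace.subspace_def submodule_def vec_subspace_def
  using vec_vs[where 'a = 'a and n = n] vec_module[where 'a = 'a and n = n]
  by (auto simp: module_vec_simps class_ring_simps)

text \<open>The inverse of \<open>\<rho> g\<close> is \<open>\<rho> (inv g)\<close>, so a
  multiplicative map that sends the identity to the identity matrix lands in
  \<open>GL n\<close>.\<close>

lemma matrix_rep_hom:
  fixes G :: "('g, 'm) monoid_scheme" (structure)
  assumes "Group.group G" "matrix_rep G n \<rho>"
  shows "\<rho> \<in> hom G (GL n)"
proof -
  interpret Group.group G by fact
  have u: "\<rho> g \<in> Units (ring_mat TYPE(complex) n ())" if g: "g \<in> carrier G" for g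
  proof -
    have "\<rho> (inv g) * \<rho> g = 1\<^sub>m n" "\<rho> g * \<rho> (inv g) = 1\<^sub>m n"
      using assms(2) g inv_closed[OF g] l_inv[OF g] r_inv[OF g]
      unfolding matrix_rep_def by metis+
    then show ?thesis
      using assms(2) g inv_closed[OF g] unfolding Units_def matrix_rep_def ring_mat_def by auto
  qed
  show ?thesis
    using assms(2) u by (auto simp: hom_def GL_def units_of_def matrix_rep_def ring_mat_def)
qed

lemma hom_matrix_rep:
  assumes "group G" "\<rho> \<in> hom G (GL n)"
  shows "matrix_rep G n \<rho>"
proof -
  interpret G: group G by fact
  interpret R: ring "ring_mat TYPE(complex) n ()" by (rule ring_mat)
  interpret U: group "GL n" unfolding GL_def by (rule R.units_group)
  have "\<rho> \<one>\<^bsub>G\<^esub> = \<one>\<^bsub>GL n\<^esub>"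
    using assms by (intro hom_one) (auto intro: U.group_axioms)
  then have 1: "\<rho> \<one>\<^bsub>G\<^esub> = 1\<^sub>m n" by (simp add: GL_def units_of_def ring_mat_def)
  have "\<rho> g \<in> carrier_mat n n" if "g \<in> carrier G" for g
  proof -
    have "\<rho> g \<in> carrier (GL n)" using assms(2) that by (auto simp: hom_def)
    then show ?thesis by (auto simp: GL_def units_of_def ring_mat_def Units_def)
  qed
  moreover have "\<rho> (g \<otimes>\<^bsub>G\<^esub> h) = \<rho> g * \<rho> h" if "g \<in> carrier G" "h \<in> carrier G" for g h
  proof -
    have "\<rho> (g \<otimes>\<^bsub>G\<^esub> h) = \<rho> g \<otimes>\<^bsub>GL n\<^esub> \<rho> h" using assms(2) that by (auto simp: hom_def)
    then show ?thesis by (simp add: GL_def units_of_def ring_mat_def)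
  qed
  ultimately show ?thesis using 1 by (simp add: matrix_rep_def)
qed

lemma irreducible_rep_iff:
  assumes "group G"
  shows "irreducible_rep G n \<rho> \<longleftrightarrow> n > 0 \<and> matrix_rep G n \<rho> \<and>
    (\<forall>W. vec_subspace n W \<and> invariant_under G \<rho> W \<longrightarrow> W = {0\<^sub>v n} \<or> W = carrier_vec n)"
proof -
  have "\<rho> \<in> hom G (GL n) \<longleftrightarrow> matrix_rep G n \<rho>"
    using matrix_rep_hom[OF assms] hom_matrix_rep[OF assms] by metis
  then show ?thesis
    by (simp add: irreducible_rep_def subspace_iff_vec_subspace invariant_under_def)
qed

text \<open>The columns of \<open>B\<close> are a maximal independent subset of \<open>W\<close>.
  Encoding a subspace as the image of an injective matrix lets a subrepresentation become a matrix
  representation again, and \<open>m < n\<close> drives the later descent on the dimension.\<close>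

lemma vec_subspace_basis:
  fixes W :: "'a::field vec set"
  assumes W: "vec_subspace n W"
  obtains m B where "B \<in> carrier_mat n m" "W \<noteq> carrier_vec n \<longrightarrow> m < n"
    "(\<lambda>v. B *\<^sub>v v) ` carrier_vec m = W"
    "\<forall>v\<in>carrier_vec m. B *\<^sub>v v = 0\<^sub>v n \<longrightarrow> v = 0\<^sub>v m"
proof -
  interpret V: vec_space "TYPE('a)" n .
  let ?P = "\<lambda>S. S \<subseteq> W \<and> V.lin_indpt S"
  have WC: "W \<subseteq> carrier_vec n" using W by (auto simp: vec_subspace_def)
  have le: "finite S \<and> card S \<le> n" if "?P S" for S
    using V.li_le_dim[OF V.fin_dim, of S] that WC V.dim_is_n by auto
  have "?P {}" by (auto simp: V.lin_dep_def)
  from maximal_exists[of ?P, OF le this] obtain A where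
    finA: "finite A" and max: "maximal A ?P" by blast
  then have AW: "A \<subseteq> W" and li: "V.lin_indpt A" by (auto simp: maximal_def)
  have AC: "A \<subseteq> carrier_vec n" using AW WC by auto
  have span1: "w \<in> V.span A" if w: "w \<in> W" for w
  proof (cases "w \<in> A")
    case True then show ?thesis using V.in_own_span[of A] AC by auto
  next
    case False
    have "\<not> V.lin_indpt (A \<union> {w})"
      using max w AW False unfolding maximal_def by blast
    then show ?thesis using V.lin_dep_iff_in_span[of A w] AC li w WC False by auto
  qed
  have submod: "submodule class_ring W V.V"
    using W unfolding subspace_iff_vec_subspace[symmetric] VectorSpace.subspace_def by blast
  have span2: "V.span A \<subseteq> W" using V.span_is_subset[OF AW submod] .
  obtain ws where ws: "set ws = A" "distinct ws" using finite_distinct_list[OF finA] by blast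
  let ?m = "length ws"
  let ?B = "mat_of_cols n ws"
  \<comment> \<open>Linear combinations are indexed by the vectors themselves, but the coordinates
    of \<open>v\<close> by positions in \<open>ws\<close>; distinctness of \<open>ws\<close> leaves
    a single term of the sum.\<close>
  let ?f = "\<lambda>v l. sum (\<lambda>i. if l = ws ! i then v $ i else 0) {0..<?m}"
  have Bv: "?B *\<^sub>v v = V.lincomb (?f v) A" if "v \<in> carrier_vec ?m" for v
    using V.mat_of_cols_mult_as_finsum[OF that] ws AC by (metis nth_mem subset_iff)
  have fv: "?f v (ws ! i) = v $ i" if "i < ?m" for v i
  proof -
    have "?f v (ws ! i) = (\<Sum>j\<in>{0..<?m}. if j = i then v $ j else 0)"
      using that ws(2) by (intro sum.cong) (auto simp: nth_eq_iff_index_eq)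
    then show ?thesis using that by simp
  qed
  have card: "?m = card A" using ws distinct_card by metis
  show ?thesis
  proof (rule that[of ?B ?m], goal_cases)
    case 1 show ?case by simp
  next
    case 2
    have "?m < n" if "W \<noteq> carrier_vec n"
    proof (rule ccontr)
      assume "\<not> ?m < n"
      then have "V.basis A"
        using V.dim_li_is_basis[OF V.fin_dim finA _ li] AC card V.dim_is_n by auto
      then have "V.span A = carrier_vec n" unfolding V.basis_def by auto
      moreover have "?m \<le> n" using le[of A] AW li card by auto
      ultimately show False using span2 WC that by auto
    qed
    then show ?case by blast
  next
    case 3
    show "(\<lambda>v. ?B *\<^sub>v v) ` carrier_vec ?m = W"
    proof
      have "V.lincomb f A \<in> V.span A" for f
        using finA unfolding V.span_def by auto
      then show "(\<lambda>v. ?B *\<^sub>v v) ` carrier_vec ?m \<subseteq> W"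
        using Bv span2 by fastforce
      show "W \<subseteq> (\<lambda>v. ?B *\<^sub>v v) ` carrier_vec ?m"
      proof
        fix w assume "w \<in> W"
        then have "w \<in> V.span A" by (rule span1)
        from V.finite_in_span[OF finA AC this] obtain a where a: "w = V.lincomb a A"
          by metis
        let ?v = "vec ?m (\<lambda>i. a (ws ! i))"
        have "V.lincomb (?f ?v) A = V.lincomb a A"
        proof (rule V.lincomb_cong)
          fix v assume "v \<in> A"
          then obtain i where i: "i < ?m" "v = ws ! i" using ws by (metis in_set_conv_nth)
          show "?f ?v v = a v" using fv[OF i(1), of ?v] i by simp
        qed (use AC in auto)
        then have "?B *\<^sub>v ?v = w" using Bv[of ?v] a by simp
        then show "w \<in> (\<lambda>v. ?B *\<^sub>v v) ` carrier_vec ?m" by force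
      qed
    qed
  next
    case 4
    have "v = 0\<^sub>v ?m" if v: "v \<in> carrier_vec ?m" and 0: "?B *\<^sub>v v = 0\<^sub>v n" for v
    proof (rule eq_vecI)
      fix i assume "i < dim_vec (0\<^sub>v ?m :: 'a vec)"
      then have i: "i < ?m" by simp
      have "?f v (ws ! i) = 0"
        using V.not_lindepD[OF li finA order_refl, of "?f v"] Bv[OF v] 0 i ws by auto
      then show "v $ i = (0\<^sub>v ?m) $ i" using fv[OF i, of v] i by simp
    qed (use v in auto)
    then show ?case by blast
  qed
qed


section \<open>Traces and eigenvectors of complex matrices\<close>

lemma mat_eq_on_vecI:
  assumes "A \<in> carrier_mat n m" "B \<in> carrier_mat n m"
    and eq: "\<And>v. v \<in> carrier_vec m \<Longrightarrow> A *\<^sub>v v = B *\<^sub>v (v :: 'a::semiring_1 vec)"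
  shows "A = B"
proof (rule mat_col_eqI)
  fix j assume "j < dim_col B"
  then have j: "j < m" using assms by auto
  have "col (A * 1\<^sub>m m) j = col (B * 1\<^sub>m m) j"
    using assms(1,2) j by (simp only: col_mult2[OF _ one_carrier_mat j] eq col_dim one_carrier_mat col_one unit_vec_carrier)
  then show "col A j = col B j" using assms by simp
qed (use assms in auto)

lemma index_mult_mat_sum:
  assumes "A \<in> carrier_mat n m" "B \<in> carrier_mat m k" "i < n" "j < k"
  shows "(A * B) $$ (i, j) = (\<Sum>l<m. A $$ (i, l) * B $$ (l, j))"
  using assms by (simp add: scalar_prod_def atLeast0LessThan)

lemma mat_trace_mult:
  assumes "A \<in> carrier_mat n m" "B \<in> carrier_mat m n"
  shows "mat_trace (A * B) = (\<Sum>i<n. \<Sum>l<m. A $$ (i, l) * B $$ (l, i))"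
  unfolding mat_trace_def using assms
  by (auto intro!: sum.cong simp: index_mult_mat_sum simp del: index_mult_mat(1))

lemma mat_trace_comm:
  assumes "A \<in> carrier_mat n m" "(B :: 'a::comm_semiring_0 mat) \<in> carrier_mat m n"
  shows "mat_trace (A * B) = mat_trace (B * A)"
  unfolding mat_trace_mult[OF assms] mat_trace_mult[OF assms(2,1)]
  by (subst sum.swap) (simp add: mult.commute)

lemma mat_trace_one: "mat_trace (1\<^sub>m n :: 'a::semiring_1 mat) = of_nat n"
  by (simp add: mat_trace_def)

lemma eigenvector_exists:
  assumes A: "A \<in> carrier_mat n n" and n: "n > 0"
  obtains v and c :: complex where "v \<in> carrier_vec n" "v \<noteq> 0\<^sub>v n" "A *\<^sub>v v = c \<cdot>\<^sub>v v"
  using spectrum_non_empty[OF A n] A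
  unfolding spectrum_def eigenvalue_def eigenvector_def by auto

text \<open>By Schur triangularisation the trace is the sum of the diagonal entries of a similar
  triangular matrix; one of them is nonzero, and it is an eigenvalue.\<close>

lemma nonzero_eigenvalue_exists:
  assumes A: "(A :: complex mat) \<in> carrier_mat n n" and tr: "mat_trace A \<noteq> 0"
  obtains v c where "c \<noteq> 0" "v \<in> carrier_vec n" "v \<noteq> 0\<^sub>v n" "A *\<^sub>v v = c \<cdot>\<^sub>v v"
proof -
  obtain es where "char_poly A = (\<Prod>a\<leftarrow>es. [:- a, 1:])"
    using char_poly_factorized[OF A] by blast
  from schur_decomposition_exists[OF A this] obtain B where
    B: "B \<in> carrier_mat n n" "upper_triangular B" "similar_mat A B" by blast
  from B(3) obtain P Q where "similar_mat_wit A B P Q" unfolding similar_mat_def by blast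
  note PQ = similar_mat_witD2(6,7,2,3)[OF A this]
  have "mat_trace A = mat_trace (P * B * Q)" using PQ(4) by (rule arg_cong)
  also have "\<dots> = mat_trace (Q * (P * B))"
    by (rule mat_trace_comm[of _ n n]) (use PQ B in auto)
  also have "Q * (P * B) = (Q * P) * B"
    by (rule assoc_mult_mat[symmetric, of _ n n _ n _ n]) (use PQ B in auto)
  also have "\<dots> = B" unfolding PQ(3) using B(1) by simp
  finally have "mat_trace B \<noteq> 0" using tr by simp
  then obtain i where i: "i < n" "B $$ (i, i) \<noteq> 0"
    using B(1) sum.not_neutral_contains_not_neutral[of "\<lambda>i. B $$ (i, i)" "{..<n}"]
    by (auto simp: mat_trace_def)
  have "B $$ (i, i) \<in> set (diag_mat B)" using i B(1) by (auto simp: diag_mat_def)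
  then have "poly (char_poly B) (B $$ (i, i)) = 0"
    unfolding char_poly_upper_triangular[OF B(1,2)] by (rule linear_poly_root)
  then have "poly (char_poly A) (B $$ (i, i)) = 0" unfolding char_poly_similar[OF B(3)] .
  then have "eigenvalue A (B $$ (i, i))" using eigenvalue_root_char_poly[OF A] by simp
  then show ?thesis using that i(2) A unfolding eigenvalue_def eigenvector_def by auto
qed

section \<open>Schur's lemma\<close>

locale finite_group = Group.group G for G :: "('g, 'm) monoid_scheme" (structure) +
  assumes finite_carrier [simp, intro]: "finite (carrier G)"
begin

lemma matrix_repD:
  assumes "matrix_rep G n \<rho>"
  shows "\<And>g. g \<in> carrier G \<Longrightarrow> \<rho> g \<in> carrier_mat n n"
    "\<And>g h. g \<in> carrier G \<Longrightarrow> h \<in> carrier G \<Longrightarrow> \<rho> (g \<otimes> h) = \<rho> g * \<rho> h"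
    "\<rho> \<one> = 1\<^sub>m n"
  using assms by (auto simp: matrix_rep_def)

lemmas irreducible_iff = irreducible_rep_iff[OF group_axioms]

lemma irreducible_repD:
  assumes "irreducible_rep G n \<rho>"
  shows "n > 0" "matrix_rep G n \<rho>"
    "vec_subspace n W \<Longrightarrow> invariant_under G \<rho> W \<Longrightarrow> W = {0\<^sub>v n} \<or> W = carrier_vec n"
  using assms by (auto simp: irreducible_iff)

definition intertwines :: "nat \<Rightarrow> nat \<Rightarrow> ('g \<Rightarrow> complex mat) \<Rightarrow> ('g \<Rightarrow> complex mat) \<Rightarrow> complex mat \<Rightarrow> bool"
  where "intertwines n m \<rho> \<sigma> A \<longleftrightarrow> A \<in> carrier_mat n m \<and> (\<forall>g\<in>carrier G. \<rho> g * A = A * \<sigma> g)"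

text \<open>The kernel of an intertwiner is invariant under \<open>\<sigma>\<close>. Of
  \<open>\<rho>\<close> only the size of its values is assumed, since the lemma is also applied to a
  family of matrices whose multiplicativity is not established.\<close>

lemma intertwiner_kernel:
  assumes \<rho>: "\<And>g. g \<in> carrier G \<Longrightarrow> \<rho> g \<in> carrier_mat n n" and \<sigma>: "irreducible_rep G m \<sigma>"
    and A: "intertwines n m \<rho> \<sigma> A" and nz: "A \<noteq> 0\<^sub>m n m"
    and v: "v \<in> carrier_vec m" and Av: "A *\<^sub>v v = 0\<^sub>v n"
  shows "v = 0\<^sub>v m"
proof -
  note \<sigma>D = irreducible_repD[OF \<sigma>]
  note \<sigma>c = matrix_repD(1)[OF \<sigma>D(2)]
  have Ac: "A \<in> carrier_mat n m" using A by (simp add: intertwines_def)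
  let ?W = "{v \<in> carrier_vec m. A *\<^sub>v v = 0\<^sub>v n}"
  have "vec_subspace m ?W"
    using Ac by (auto simp: vec_subspace_def mult_add_distrib_mat_vec mult_mat_vec)
  moreover have "invariant_under G \<sigma> ?W"
    unfolding invariant_under_def
  proof (intro ballI)
    fix g w assume g: "g \<in> carrier G" and w: "w \<in> ?W"
    have "A *\<^sub>v (\<sigma> g *\<^sub>v w) = (\<rho> g * A) *\<^sub>v w"
      using A g w \<sigma>c[OF g] assoc_mult_mat_vec[OF Ac \<sigma>c[OF g], of w]
      by (simp add: intertwines_def)
    also have "\<dots> = \<rho> g *\<^sub>v (A *\<^sub>v w)" using Ac \<rho>[OF g] w by simp
    also have "\<dots> = 0\<^sub>v n" using w \<rho>[OF g] by auto
    finally show "\<sigma> g *\<^sub>v w \<in> ?W" using \<sigma>c[OF g] w by simp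
  qed
  ultimately consider "?W = {0\<^sub>v m}" | "?W = carrier_vec m" using \<sigma>D(3) by blast
  then show ?thesis
  proof cases
    case 1 then show ?thesis using v Av by blast
  next
    case 2
    have "A = 0\<^sub>m n m"
    proof (rule mat_eq_on_vecI[OF Ac])
      fix v :: "complex vec" assume "v \<in> carrier_vec m"
      then have "v \<in> ?W" using 2 by simp
      then show "A *\<^sub>v v = 0\<^sub>m n m *\<^sub>v v" by auto
    qed simp
    then show ?thesis using nz by simp
  qed
qed

text \<open>Dual to the kernel: the image is invariant under \<open>\<rho>\<close>, and it is not 0
  because \<open>A\<close> is not.\<close>

lemma intertwiner_surj:
  assumes \<sigma>: "\<And>g. g \<in> carrier G \<Longrightarrow> \<sigma> g \<in> carrier_mat m m" and \<rho>: "irreducible_rep G n \<rho>"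
    and A: "intertwines n m \<rho> \<sigma> A" and nz: "A \<noteq> 0\<^sub>m n m"
  shows "(\<lambda>v. A *\<^sub>v v) ` carrier_vec m = carrier_vec n"
proof -
  note \<rho>D = irreducible_repD[OF \<rho>]
  note \<rho>c = matrix_repD(1)[OF \<rho>D(2)]
  have Ac: "A \<in> carrier_mat n m" using A by (simp add: intertwines_def)
  let ?W = "(\<lambda>v. A *\<^sub>v v) ` carrier_vec m"
  have "vec_subspace n ?W"
    unfolding vec_subspace_def
  proof (intro conjI ballI allI)
    show "0\<^sub>v n \<in> ?W" using Ac by (intro image_eqI[of _ _ "0\<^sub>v m"]) auto
    show "v + w \<in> ?W" if "v \<in> ?W" "w \<in> ?W" for v w
    proof -
      from that obtain v' w' where "v' \<in> carrier_vec m" "v = A *\<^sub>v v'" "w' \<in> carrier_vec m" "w = A *\<^sub>v w'"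
        by blast
      then show ?thesis
        using mult_add_distrib_mat_vec[OF Ac] by (intro image_eqI[of _ _ "v' + w'"]) auto
    qed
    show "c \<cdot>\<^sub>v v \<in> ?W" if "v \<in> ?W" for c v
      using that mult_mat_vec[OF Ac] by (auto intro!: image_eqI[of _ _ "c \<cdot>\<^sub>v _"])
  qed (use Ac in auto)
  moreover have "invariant_under G \<rho> ?W"
    unfolding invariant_under_def
  proof (intro ballI)
    fix g w assume g: "g \<in> carrier G" and "w \<in> ?W"
    then obtain v where v: "v \<in> carrier_vec m" "w = A *\<^sub>v v" by blast
    have "\<rho> g *\<^sub>v (A *\<^sub>v v) = (\<rho> g * A) *\<^sub>v v" using Ac \<rho>c[OF g] v by simp
    also have "\<dots> = A *\<^sub>v (\<sigma> g *\<^sub>v v)"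
      using A g v \<sigma>[OF g] assoc_mult_mat_vec[OF Ac \<sigma>[OF g], of v]
      by (simp add: intertwines_def)
    finally show "\<rho> g *\<^sub>v w \<in> ?W" using v \<sigma>[OF g] by (intro image_eqI[of _ _ "\<sigma> g *\<^sub>v v"]) auto
  qed
  ultimately consider "?W = {0\<^sub>v n}" | "?W = carrier_vec n" using \<rho>D(3) by blast
  then show ?thesis
  proof cases
    case 1
    have "A = 0\<^sub>m n m"
    proof (rule mat_eq_on_vecI[OF Ac])
      fix v :: "complex vec" assume v: "v \<in> carrier_vec m"
      then have "A *\<^sub>v v \<in> ?W" by blast
      with 1 have "A *\<^sub>v v = 0\<^sub>v n" by simp
      then show "A *\<^sub>v v = 0\<^sub>m n m *\<^sub>v v" using v by auto
    qed simp
    then show ?thesis using nz by simp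
  qed
qed

text \<open>A nonzero intertwiner is bijective, hence invertible, and conjugates
  \<open>\<sigma>\<close> into \<open>\<rho>\<close>. The conclusion is about traces because its
  contrapositive is applied to distinct characters.\<close>

lemma schur_equivalence:
  assumes \<rho>: "irreducible_rep G n \<rho>" and \<sigma>: "irreducible_rep G m \<sigma>"
    and A: "intertwines n m \<rho> \<sigma> A" and nz: "A \<noteq> 0\<^sub>m n m" and g: "g \<in> carrier G"
  shows "mat_trace (\<rho> g) = mat_trace (\<sigma> g)"
proof -
  note \<rho>D = irreducible_repD[OF \<rho>]
  note \<rho>c = matrix_repD(1)[OF \<rho>D(2)]
  note \<sigma>D = irreducible_repD[OF \<sigma>]
  note \<sigma>c = matrix_repD(1)[OF \<sigma>D(2)]
  have Ac: "A \<in> carrier_mat n m" using A by (simp add: intertwines_def)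
  have "\<forall>j. \<exists>v. j < n \<longrightarrow> v \<in> carrier_vec m \<and> A *\<^sub>v v = unit_vec n j"
    using intertwiner_surj[OF \<sigma>c \<rho> A nz] by (metis (no_types, lifting) imageE unit_vec_carrier)
  then obtain b where b: "\<And>j. j < n \<Longrightarrow> b j \<in> carrier_vec m \<and> A *\<^sub>v b j = unit_vec n j"
    by metis
  \<comment> \<open>The columns are preimages of the unit vectors, so \<open>B\<close> is a right
    inverse of \<open>A\<close>; injectivity of \<open>A\<close> then makes it a left inverse as
    well.\<close>
  define B where "B = mat_of_cols m (map b [0..<n])"
  have Bc: "B \<in> carrier_mat m n" by (simp add: B_def mat_of_cols_def)
  have AB: "A * B = 1\<^sub>m n"
  proof (rule mat_col_eqI)
    fix j assume "j < dim_col (1\<^sub>m n :: complex mat)"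
    then have j: "j < n" by simp
    have "col (A * B) j = A *\<^sub>v col B j" by (rule col_mult2[OF Ac Bc j])
    also have "col B j = b j" using j b[OF j] by (simp add: B_def)
    finally show "col (A * B) j = col (1\<^sub>m n) j" using b[OF j] j by simp
  qed (use Ac Bc in auto)
  have BA: "B * A = 1\<^sub>m m"
  proof (rule mat_eq_on_vecI)
    fix v :: "complex vec" assume v: "v \<in> carrier_vec m"
    let ?w = "(B * A) *\<^sub>v v - v"
    have "A *\<^sub>v ?w = A *\<^sub>v ((B * A) *\<^sub>v v) - A *\<^sub>v v"
      using Ac Bc v by (intro mult_minus_distrib_mat_vec) auto
    also have "A *\<^sub>v ((B * A) *\<^sub>v v) = (A * B) *\<^sub>v (A *\<^sub>v v)"
      using Ac Bc v by (simp add: assoc_mult_mat_vec[of _ m n])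
    finally have "A *\<^sub>v ?w = 0\<^sub>v n" using AB Ac v by simp
    moreover have "?w \<in> carrier_vec m" using Ac Bc v by simp
    ultimately have "?w = 0\<^sub>v m" using intertwiner_kernel[OF \<rho>c \<sigma> A nz] by blast
    then have w: "?w $ i = 0" if "i < m" for i using that by simp
    have "(B * A) *\<^sub>v v = v"
    proof (rule eq_vecI)
      fix i assume "i < dim_vec v"
      then have i: "i < m" using v by simp
      show "((B * A) *\<^sub>v v) $ i = v $ i" using w[OF i] i v by (simp del: index_mult_mat_vec)
    qed (use v Bc in auto)
    then show "(B * A) *\<^sub>v v = 1\<^sub>m m *\<^sub>v v" using v by simp
  qed (use Ac Bc in auto)
  have "mat_trace (\<rho> g) = mat_trace (\<rho> g * A * B)"
    using \<rho>c[OF g] Ac Bc AB by simp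
  also have "\<dots> = mat_trace (A * \<sigma> g * B)" using A g by (simp add: intertwines_def)
  also have "\<dots> = mat_trace (B * (A * \<sigma> g))"
    using \<sigma>c[OF g] Ac Bc by (intro mat_trace_comm) auto
  also have "B * (A * \<sigma> g) = \<sigma> g"
    using assoc_mult_mat[OF Bc Ac \<sigma>c[OF g]] \<sigma>c[OF g] BA by simp
  finally show ?thesis .
qed

text \<open>For an eigenvalue \<open>c\<close> of \<open>A\<close>, the matrix \<open>A - c\<close>
  is an intertwiner with a nonzero kernel and must vanish.\<close>

lemma schur_scalar:
  assumes \<rho>: "irreducible_rep G n \<rho>" and A: "intertwines n n \<rho> \<rho> A"
  obtains c where "A = c \<cdot>\<^sub>m 1\<^sub>m n"
proof -
  note \<rho>D = irreducible_repD[OF \<rho>]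
  note \<rho>c = matrix_repD(1)[OF \<rho>D(2)]
  have Ac: "A \<in> carrier_mat n n" using A by (simp add: intertwines_def)
  obtain v c where v: "v \<in> carrier_vec n" "v \<noteq> 0\<^sub>v n" "A *\<^sub>v v = c \<cdot>\<^sub>v v"
    using eigenvector_exists[OF Ac \<rho>D(1)] .
  let ?D = "A - c \<cdot>\<^sub>m 1\<^sub>m n"
  have D: "intertwines n n \<rho> \<rho> ?D"
    unfolding intertwines_def
  proof (intro conjI ballI)
    fix g assume g: "g \<in> carrier G"
    have "\<rho> g * ?D = \<rho> g * A - \<rho> g * (c \<cdot>\<^sub>m 1\<^sub>m n)"
      using \<rho>c[OF g] Ac by (intro mult_minus_distrib_mat) auto
    also have "\<rho> g * (c \<cdot>\<^sub>m 1\<^sub>m n) = (c \<cdot>\<^sub>m 1\<^sub>m n) * \<rho> g"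
      using \<rho>c[OF g] mult_smult_distrib[OF \<rho>c[OF g], of "1\<^sub>m n" n c] mult_smult_assoc_mat[of "1\<^sub>m n" n n "\<rho> g" n c]
      by simp
    also have "\<rho> g * A - (c \<cdot>\<^sub>m 1\<^sub>m n) * \<rho> g = ?D * \<rho> g"
      using A g \<rho>c[OF g] Ac minus_mult_distrib_mat[of A n n "c \<cdot>\<^sub>m 1\<^sub>m n" "\<rho> g" n]
      by (simp add: intertwines_def)
    finally show "\<rho> g * ?D = ?D * \<rho> g" .
  qed (use Ac in auto)
  have "?D *\<^sub>v v = A *\<^sub>v v - (c \<cdot>\<^sub>m 1\<^sub>m n) *\<^sub>v v"
    using Ac v by (intro minus_mult_distrib_mat_vec) auto
  also have "(c \<cdot>\<^sub>m 1\<^sub>m n) *\<^sub>v v = c \<cdot>\<^sub>v v" using v by (auto intro!: eq_vecI)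
  finally have "?D *\<^sub>v v = 0\<^sub>v n" using v by simp
  then have 0: "?D = 0\<^sub>m n n" using intertwiner_kernel[OF \<rho>c \<rho> D] v by blast
  have "A = c \<cdot>\<^sub>m 1\<^sub>m n"
  proof (rule eq_matI)
    fix i j assume "i < dim_row (c \<cdot>\<^sub>m 1\<^sub>m n :: complex mat)" "j < dim_col (c \<cdot>\<^sub>m 1\<^sub>m n :: complex mat)"
    then have ij: "i < n" "j < n" by auto
    have "?D $$ (i, j) = 0" using 0 ij by simp
    then show "A $$ (i, j) = (c \<cdot>\<^sub>m 1\<^sub>m n) $$ (i, j)" using ij Ac by simp
  qed (use Ac in auto)
  then show ?thesis by (rule that)
qed

end


section \<open>Orthogonality of characters\<close>

context finite_group
begin

lemma sum_translate_left:
  assumes "h \<in> carrier G"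
  shows "(\<Sum>g\<in>carrier G. f (h \<otimes> g)) = (\<Sum>g\<in>carrier G. f g)"
  by (rule sum.reindex_bij_witness[of _ "\<lambda>g. inv h \<otimes> g" "\<lambda>g. h \<otimes> g"])
    (use assms in \<open>auto simp: m_assoc[symmetric]\<close>)

lemma sum_translate_right:
  assumes "h \<in> carrier G"
  shows "(\<Sum>g\<in>carrier G. f (g \<otimes> h)) = (\<Sum>g\<in>carrier G. f g)"
  by (rule sum.reindex_bij_witness[of _ "\<lambda>g. g \<otimes> inv h" "\<lambda>g. g \<otimes> h"])
    (use assms in \<open>auto simp: m_assoc\<close>)

lemma matrix_rep_mult_index:
  assumes "matrix_rep G n \<rho>" "g \<in> carrier G" "h \<in> carrier G" "i < n" "j < n"
  shows "\<rho> (g \<otimes> h) $$ (i, j) = (\<Sum>l<n. \<rho> g $$ (i, l) * \<rho> h $$ (l, j))"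
  unfolding matrix_repD(2)[OF assms(1-3)]
  by (rule index_mult_mat_sum) (use assms matrix_repD(1)[OF assms(1)] in auto)

text \<open>The sum of \<open>\<rho> g * E * \<sigma> (inv g)\<close> over the group, where
  \<open>E\<close> is the matrix unit with its 1 at \<open>(j, k)\<close>, written out in
  entries.\<close>

definition averaged_unit_mat :: "nat \<Rightarrow> nat \<Rightarrow> ('g \<Rightarrow> complex mat) \<Rightarrow> ('g \<Rightarrow> complex mat) \<Rightarrow> nat \<Rightarrow> nat \<Rightarrow> complex mat"
  where "averaged_unit_mat n m \<rho> \<sigma> j k =
    mat n m (\<lambda>(i, l). \<Sum>g\<in>carrier G. \<rho> g $$ (i, j) * \<sigma> (inv g) $$ (k, l))"

lemma averaged_unit_mat_intertwines:
  assumes \<rho>: "matrix_rep G n \<rho>" and \<sigma>: "matrix_rep G m \<sigma>" and j: "j < n" and k: "k < m"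
  shows "intertwines n m \<rho> \<sigma> (averaged_unit_mat n m \<rho> \<sigma> j k)"
proof -
  let ?A = "averaged_unit_mat n m \<rho> \<sigma> j k"
  have A: "?A \<in> carrier_mat n m" by (simp add: averaged_unit_mat_def)
  have "\<rho> h * ?A = ?A * \<sigma> h" if h: "h \<in> carrier G" for h
  proof (rule eq_matI)
    note c = matrix_repD(1)[OF \<rho> h] matrix_repD(1)[OF \<sigma> h]
    fix i l assume "i < dim_row (?A * \<sigma> h)" "l < dim_col (?A * \<sigma> h)"
    then have i: "i < n" and l: "l < m" using A c by auto
    have "(\<rho> h * ?A) $$ (i, l) =
      (\<Sum>p<n. \<Sum>g\<in>carrier G. \<rho> h $$ (i, p) * (\<rho> g $$ (p, j) * \<sigma> (inv g) $$ (k, l)))"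
      unfolding index_mult_mat_sum[OF c(1) A i l]
      using l by (auto simp: averaged_unit_mat_def sum_distrib_left intro!: sum.cong)
    also have "\<dots> = (\<Sum>g\<in>carrier G. \<rho> (h \<otimes> g) $$ (i, j) * \<sigma> (inv g) $$ (k, l))"
      using h i j by (subst sum.swap) (auto simp: matrix_rep_mult_index[OF \<rho>] sum_distrib_right
          mult.assoc intro!: sum.cong)
    \<comment> \<open>Since \<open>inv g = inv (h \<otimes> g) \<otimes> h\<close>, the summand
      depends on \<open>g\<close> only through \<open>h \<otimes> g\<close>, and the translation by
      \<open>h\<close> can be undone. What remains of it is the factor \<open>\<sigma> h\<close> on
      the right.\<close>
    also have "\<dots> = (\<Sum>g\<in>carrier G. \<rho> (h \<otimes> g) $$ (i, j) * \<sigma> (inv (h \<otimes> g) \<otimes> h) $$ (k, l))"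
      using h by (intro sum.cong) (auto simp: inv_mult_group m_assoc)
    also have "\<dots> = (\<Sum>g\<in>carrier G. \<rho> g $$ (i, j) * \<sigma> (inv g \<otimes> h) $$ (k, l))"
      using sum_translate_left[OF h, of "\<lambda>g. \<rho> g $$ (i, j) * \<sigma> (inv g \<otimes> h) $$ (k, l)"] .
    also have "\<dots> = (\<Sum>p<m. \<Sum>g\<in>carrier G. \<rho> g $$ (i, j) * \<sigma> (inv g) $$ (k, p) * \<sigma> h $$ (p, l))"
      using h k l by (subst sum.swap) (auto simp: matrix_rep_mult_index[OF \<sigma>] sum_distrib_left
          mult.assoc intro!: sum.cong)
    also have "\<dots> = (?A * \<sigma> h) $$ (i, l)"
      unfolding index_mult_mat_sum[OF A c(2) i l]
      using i by (auto simp: averaged_unit_mat_def sum_distrib_right intro!: sum.cong)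
    finally show "(\<rho> h * ?A) $$ (i, l) = (?A * \<sigma> h) $$ (i, l)" .
  qed (use A matrix_repD(1)[OF \<rho> h] matrix_repD(1)[OF \<sigma> h] in auto)
  with A show ?thesis by (simp add: intertwines_def)
qed

lemma sum_trace_prod:
  assumes \<rho>: "matrix_rep G n \<rho>" and \<sigma>: "matrix_rep G m \<sigma>"
  shows "(\<Sum>g\<in>carrier G. mat_trace (\<rho> g) * mat_trace (\<sigma> (inv g))) =
    (\<Sum>i<n. \<Sum>k<m. averaged_unit_mat n m \<rho> \<sigma> i k $$ (i, k))"
proof -
  have "(\<Sum>g\<in>carrier G. mat_trace (\<rho> g) * mat_trace (\<sigma> (inv g))) =
    (\<Sum>g\<in>carrier G. \<Sum>i<n. \<Sum>k<m. \<rho> g $$ (i, i) * \<sigma> (inv g) $$ (k, k))"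
  proof (rule sum.cong)
    fix g assume "g \<in> carrier G"
    then have "dim_row (\<rho> g) = n" "dim_row (\<sigma> (inv g)) = m"
      using matrix_repD(1)[OF \<rho>] matrix_repD(1)[OF \<sigma>] inv_closed[of g]
      by (blast intro: carrier_matD(1))+
    then show "mat_trace (\<rho> g) * mat_trace (\<sigma> (inv g)) =
      (\<Sum>i<n. \<Sum>k<m. \<rho> g $$ (i, i) * \<sigma> (inv g) $$ (k, k))"
      by (simp add: mat_trace_def sum_product)
  qed simp
  also have "\<dots> = (\<Sum>i<n. \<Sum>k<m. \<Sum>g\<in>carrier G. \<rho> g $$ (i, i) * \<sigma> (inv g) $$ (k, k))"
    by (subst sum.swap, rule sum.cong[OF refl], rule sum.swap)
  finally show ?thesis by (simp add: averaged_unit_mat_def)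
qed

text \<open>If one of the averaged matrix units were nonzero, it would be an intertwiner and would
  force equal traces.\<close>

lemma trace_orthogonal:
  assumes \<rho>: "irreducible_rep G n \<rho>" and \<sigma>: "irreducible_rep G m \<sigma>"
    and neq: "g0 \<in> carrier G" "mat_trace (\<rho> g0) \<noteq> mat_trace (\<sigma> g0)"
  shows "(\<Sum>g\<in>carrier G. mat_trace (\<rho> g) * mat_trace (\<sigma> (inv g))) = 0"
proof -
  note r = irreducible_repD(2)[OF \<rho>] irreducible_repD(2)[OF \<sigma>]
  have "averaged_unit_mat n m \<rho> \<sigma> i k = 0\<^sub>m n m" if "i < n" "k < m" for i k
    using schur_equivalence[OF \<rho> \<sigma> averaged_unit_mat_intertwines[OF r that] _ neq(1)] neq(2) by blast
  then show ?thesis unfolding sum_trace_prod[OF r] by simp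
qed

lemma trace_norm:
  assumes \<rho>: "irreducible_rep G n \<rho>"
  shows "(\<Sum>g\<in>carrier G. mat_trace (\<rho> g) * mat_trace (\<rho> (inv g))) = of_nat (card (carrier G))"
proof -
  note D = irreducible_repD[OF \<rho>]
  let ?A = "averaged_unit_mat n n \<rho> \<rho>"
  have n: "(of_nat n :: complex) \<noteq> 0" using D(1) by simp
  have "(\<Sum>k<n. ?A i k $$ (i, k)) = of_nat (card (carrier G)) / of_nat n" if i: "i < n" for i
  proof -
    \<comment> \<open>By Schur's lemma \<open>?A i k\<close> is scalar, and for \<open>k\<close>
      other than \<open>i\<close> its entry at \<open>(i, k)\<close> lies off the diagonal.\<close>
    have off: "?A i k $$ (i, k) = 0" if "k < n" "k \<noteq> i" for k
    proof -
      obtain c where "?A i k = c \<cdot>\<^sub>m 1\<^sub>m n"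
        using schur_scalar[OF \<rho> averaged_unit_mat_intertwines[OF D(2) D(2) i \<open>k < n\<close>]] by blast
      then show ?thesis using i that by simp
    qed
    obtain c where c: "?A i i = c \<cdot>\<^sub>m 1\<^sub>m n"
      using schur_scalar[OF \<rho> averaged_unit_mat_intertwines[OF D(2) D(2) i i]] by blast
    \<comment> \<open>The trace of \<open>?A i i\<close> determines the scalar: each group element
      contributes \<open>\<rho> \<one> $$ (i, i) = 1\<close> to it.\<close>
    have "of_nat n * c = (\<Sum>l<n. ?A i i $$ (l, l))" unfolding c by simp
    also have "\<dots> = (\<Sum>g\<in>carrier G. \<Sum>l<n. \<rho> g $$ (l, i) * \<rho> (inv g) $$ (i, l))"
      by (simp add: averaged_unit_mat_def sum.swap[of _ "{..<n}"])
    also have "\<dots> = (\<Sum>g\<in>carrier G. \<rho> (inv g \<otimes> g) $$ (i, i))"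
    proof (rule sum.cong[OF refl])
      fix g assume "g \<in> carrier G"
      then show "(\<Sum>l<n. \<rho> g $$ (l, i) * \<rho> (inv g) $$ (i, l)) = \<rho> (inv g \<otimes> g) $$ (i, i)"
        using matrix_rep_mult_index[OF D(2), of "inv g" g i i] i by (simp only: inv_closed mult.commute)
    qed
    also have "\<dots> = of_nat (card (carrier G))"
      using i matrix_repD(3)[OF D(2)] by simp
    finally have "c = of_nat (card (carrier G)) / of_nat n" using n by (simp add: field_simps)
    moreover have "(\<Sum>k<n. ?A i k $$ (i, k)) = ?A i i $$ (i, i)"
      using i off by (intro sum.remove[THEN trans]) (auto intro!: sum.neutral)
    ultimately show ?thesis using c i by simp
  qed
  then show ?thesis unfolding sum_trace_prod[OF D(2) D(2)] using n by simp
qed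

text \<open>The matrix \<open>H\<close> below is the Gram matrix of a \<open>G\<close>-invariant Hermitian form.\<close>

lemma trace_inv:
  assumes \<rho>: "irreducible_rep G n \<rho>" and g: "g \<in> carrier G"
  shows "mat_trace (\<rho> (inv g)) = cnj (mat_trace (\<rho> g))"
proof -
  note D = irreducible_repD[OF \<rho>]
  note c = matrix_repD(1)[OF D(2)]
  \<comment> \<open>\<open>\<tau> g\<close> is the conjugate transpose of
    \<open>\<rho> (inv g)\<close>, so that \<open>\<tau> g * H = H * \<rho> g\<close> expresses the
    invariance of the form.\<close>
  define \<tau> where "\<tau> g = mat n n (\<lambda>(i, j). cnj (\<rho> (inv g) $$ (j, i)))" for g
  define H where "H = mat n n (\<lambda>(i, j). \<Sum>h\<in>carrier G. \<Sum>l<n. cnj (\<rho> h $$ (l, i)) * \<rho> h $$ (l, j))"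
  have Hc: "H \<in> carrier_mat n n" by (simp add: H_def)
  have \<tau>c: "\<tau> g \<in> carrier_mat n n" for g by (simp add: \<tau>_def)
  have "\<tau> g * H = H * \<rho> g" if g: "g \<in> carrier G" for g
  proof (rule eq_matI)
    fix i j assume "i < dim_row (H * \<rho> g)" "j < dim_col (H * \<rho> g)"
    then have i: "i < n" and j: "j < n" using Hc c[OF g] by auto
    have "(\<tau> g * H) $$ (i, j) = (\<Sum>p<n. \<Sum>h\<in>carrier G. \<Sum>l<n.
        cnj (\<rho> h $$ (l, p) * \<rho> (inv g) $$ (p, i)) * \<rho> h $$ (l, j))"
      unfolding index_mult_mat_sum[OF \<tau>c Hc i j]
      using i j by (auto simp: \<tau>_def H_def sum_distrib_left mult.assoc mult.left_commute intro!: sum.cong)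
    also have "\<dots> = (\<Sum>h\<in>carrier G. \<Sum>l<n. \<Sum>p<n.
        cnj (\<rho> h $$ (l, p) * \<rho> (inv g) $$ (p, i)) * \<rho> h $$ (l, j))"
      by (subst sum.swap, rule sum.cong[OF refl], rule sum.swap)
    also have "\<dots> = (\<Sum>h\<in>carrier G. \<Sum>l<n. cnj (\<rho> (h \<otimes> inv g) $$ (l, i)) * \<rho> h $$ (l, j))"
      using i g by (auto simp: matrix_rep_mult_index[OF D(2)] sum_distrib_right intro!: sum.cong)
    also have "\<dots> = (\<Sum>h\<in>carrier G. \<Sum>l<n. cnj (\<rho> (h \<otimes> g \<otimes> inv g) $$ (l, i)) * \<rho> (h \<otimes> g) $$ (l, j))"
      using sum_translate_right[OF g, of "\<lambda>h. \<Sum>l<n. cnj (\<rho> (h \<otimes> inv g) $$ (l, i)) * \<rho> h $$ (l, j)"]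
      by simp
    also have "\<dots> = (\<Sum>h\<in>carrier G. \<Sum>l<n. \<Sum>p<n. cnj (\<rho> h $$ (l, i)) * \<rho> h $$ (l, p) * \<rho> g $$ (p, j))"
      using j g by (auto simp: matrix_rep_mult_index[OF D(2)] sum_distrib_left m_assoc mult.assoc
          intro!: sum.cong)
    also have "\<dots> = (\<Sum>p<n. \<Sum>h\<in>carrier G. \<Sum>l<n. cnj (\<rho> h $$ (l, i)) * \<rho> h $$ (l, p) * \<rho> g $$ (p, j))"
      by (subst (2) sum.swap, rule sum.cong[OF refl], rule sum.swap)
    also have "\<dots> = (H * \<rho> g) $$ (i, j)"
      unfolding index_mult_mat_sum[OF Hc c[OF g] i j]
      using i by (auto simp: H_def sum_distrib_right intro!: sum.cong)
    finally show "(\<tau> g * H) $$ (i, j) = (H * \<rho> g) $$ (i, j)" .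
  qed (use Hc c[OF g] \<tau>c in auto)
  then have H: "intertwines n n \<tau> \<rho> H" using Hc by (simp add: intertwines_def)
  \<comment> \<open>Positivity serves only to show that \<open>H\<close> is not 0: the identity of
    the group alone contributes 1 to this entry. Invertibility of \<open>H\<close> then comes from
    irreducibility.\<close>
  have "Re (H $$ (0, 0)) = (\<Sum>h\<in>carrier G. \<Sum>l<n. (cmod (\<rho> h $$ (l, 0)))\<^sup>2)"
    using D(1) unfolding H_def by (simp add: cmod_power2 sum.distrib) (simp add: power2_eq_square)
  also have "\<dots> \<ge> (\<Sum>l<n. (cmod (\<rho> \<one> $$ (l, 0)))\<^sup>2)"
    by (rule member_le_sum) (auto intro: sum_nonneg)
  finally have "Re (H $$ (0, 0)) \<ge> (\<Sum>l<n. (cmod (\<rho> \<one> $$ (l, 0)))\<^sup>2)" .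
  moreover have "(\<Sum>l<n. (cmod (\<rho> \<one> $$ (l, 0)))\<^sup>2) \<ge> (cmod (\<rho> \<one> $$ (0, 0)))\<^sup>2"
    by (rule member_le_sum) (use D(1) in auto)
  ultimately have "Re (H $$ (0, 0)) \<ge> 1"
    using D(1) matrix_repD(3)[OF D(2)] by simp
  then have nz: "H \<noteq> 0\<^sub>m n n" using D(1) by auto
  have "det H \<noteq> 0"
    using intertwiner_kernel[OF \<tau>c \<rho> H nz] det_0_iff_vec_prod_zero[OF Hc] by blast
  from det_non_zero_imp_unit[OF Hc this] obtain B where
    B: "B \<in> carrier_mat n n" "B * H = 1\<^sub>m n" "H * B = 1\<^sub>m n"
    unfolding Units_def ring_mat_def by auto
  have "mat_trace (\<rho> g) = mat_trace (B * H * \<rho> g)" using B c[OF g] by simp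
  also have "B * H * \<rho> g = B * (\<tau> g * H)"
    using H g assoc_mult_mat[OF B(1) Hc c[OF g]] by (simp add: intertwines_def)
  also have "mat_trace \<dots> = mat_trace (\<tau> g * H * B)"
    using B(1) Hc mult_carrier_mat[OF \<tau>c Hc] by (intro mat_trace_comm[of _ n n])
  also have "\<tau> g * H * B = \<tau> g" using assoc_mult_mat[OF \<tau>c Hc B(1), of g] B(3) \<tau>c[of g] by simp
  also have "mat_trace \<dots> = cnj (mat_trace (\<rho> (inv g)))"
    using carrier_matD[OF c[of "inv g"]] g by (simp add: mat_trace_def \<tau>_def)
  finally show ?thesis by simp
qed

lemma map_mat_cnj_mult:
  assumes "A \<in> carrier_mat n m" "B \<in> carrier_mat m k"
  shows "map_mat cnj (A * B) = map_mat cnj A * map_mat cnj B"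
  by (rule eq_matI) (use assms in \<open>auto simp: scalar_prod_def\<close>)

lemma map_mat_cnj_mult_vec:
  assumes "A \<in> carrier_mat n m" "v \<in> carrier_vec m"
  shows "map_mat cnj A *\<^sub>v v = map_vec cnj (A *\<^sub>v map_vec cnj v)"
  by (rule eq_vecI) (use assms in \<open>auto simp: scalar_prod_def\<close>)

lemma map_vec_cnj_cnj [simp]: "map_vec cnj (map_vec cnj v) = v"
  by (rule eq_vecI) auto

text \<open>Entrywise conjugation of vectors turns a subspace invariant under the conjugate matrices
  into one invariant under \<open>\<rho>\<close>. It is semilinear, whence the scalar
  \<open>cnj k\<close> in the proof.\<close>

lemma irreducible_rep_cnj:
  assumes \<rho>: "irreducible_rep G n \<rho>"
  shows "irreducible_rep G n (\<lambda>g. map_mat cnj (\<rho> g))"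
  unfolding irreducible_iff
proof (intro conjI allI impI)
  note D = irreducible_repD[OF \<rho>]
  note c = matrix_repD(1)[OF D(2)]
  show "n > 0" by (rule D)
  show "matrix_rep G n (\<lambda>g. map_mat cnj (\<rho> g))"
    unfolding matrix_rep_def
    using matrix_repD[OF D(2)] map_mat_cnj_mult[OF c c]
    by (auto intro!: eq_matI)
  fix W assume W: "vec_subspace n W \<and> invariant_under G (\<lambda>g. map_mat cnj (\<rho> g)) W"
  let ?W = "map_vec cnj ` W"
  have WC: "W \<subseteq> carrier_vec n" using W by (simp add: vec_subspace_def)
  have "vec_subspace n ?W"
    unfolding vec_subspace_def
  proof (intro conjI ballI allI)
    show "?W \<subseteq> carrier_vec n" using WC by auto
    have "0\<^sub>v n \<in> W" using W by (simp add: vec_subspace_def)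
    then show "0\<^sub>v n \<in> ?W" by (intro image_eqI[of _ _ "0\<^sub>v n"]) auto
    fix v assume "v \<in> ?W"
    then obtain v' where v': "v' \<in> W" "v = map_vec cnj v'" by blast
    show "v + w \<in> ?W" if "w \<in> ?W" for w
    proof -
      from that obtain w' where w': "w' \<in> W" "w = map_vec cnj w'" by blast
      then have "v' + w' \<in> W" using W v' by (simp add: vec_subspace_def)
      moreover have "v' \<in> carrier_vec n" "w' \<in> carrier_vec n" using v' w' WC by blast+
      then have "v + w = map_vec cnj (v' + w')"
        unfolding v'(2) w'(2) by (intro eq_vecI) auto
      ultimately show ?thesis by blast
    qed
    show "k \<cdot>\<^sub>v v \<in> ?W" for k
    proof -
      have "cnj k \<cdot>\<^sub>v v' \<in> W" using W v' by (simp add: vec_subspace_def)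
      moreover have "k \<cdot>\<^sub>v v = map_vec cnj (cnj k \<cdot>\<^sub>v v')" using v' by (intro eq_vecI) auto
      ultimately show ?thesis by blast
    qed
  qed
  moreover have "invariant_under G \<rho> ?W"
    unfolding invariant_under_def
  proof (intro ballI)
    fix g w assume g: "g \<in> carrier G" and "w \<in> ?W"
    then obtain w' where w': "w' \<in> W" "w = map_vec cnj w'" by blast
    have "map_mat cnj (\<rho> g) *\<^sub>v w' \<in> W" using W g w'(1) by (simp add: invariant_under_def)
    then have "map_vec cnj (\<rho> g *\<^sub>v w) \<in> W"
      using map_mat_cnj_mult_vec[OF c[OF g], of w'] w' WC by auto
    then show "\<rho> g *\<^sub>v w \<in> ?W" by (intro image_eqI[of _ _ "map_vec cnj (\<rho> g *\<^sub>v w)"]) auto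
  qed
  ultimately consider "?W = {0\<^sub>v n}" | "?W = carrier_vec n" using D(3) by blast
  then show "W = {0\<^sub>v n} \<or> W = carrier_vec n"
  proof cases
    case 1
    have "W = map_vec cnj ` ?W" by (simp add: image_image)
    also have "\<dots> = {0\<^sub>v n}" unfolding 1 by (auto intro!: eq_vecI)
    finally show ?thesis by simp
  next
    case 2
    have "W = map_vec cnj ` ?W" by (simp add: image_image)
    also have "\<dots> = carrier_vec n"
      unfolding 2 by (auto intro!: image_eqI[of _ "map_vec cnj" "map_vec cnj _"])
    finally show ?thesis by simp
  qed
qed

section \<open>Irreducible characters as functions on the group\<close>

abbreviation Irr :: "('g \<Rightarrow> complex) set" where "Irr \<equiv> irreducible_characters G"

lemma irreducible_character_cases:
  assumes "\<chi> \<in> Irr"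
  obtains n \<rho> where "irreducible_rep G n \<rho>" "\<chi> = (\<lambda>g\<in>carrier G. mat_trace (\<rho> g))"
  using assms by (auto simp: irreducible_characters_def)

lemma irreducible_character_inv:
  assumes "\<chi> \<in> Irr" "g \<in> carrier G"
  shows "\<chi> (inv g) = cnj (\<chi> g)"
  using assms(1) by (rule irreducible_character_cases) (simp add: assms(2) trace_inv)

lemma irreducible_character_conj:
  assumes "\<chi> \<in> Irr" "g \<in> carrier G" "h \<in> carrier G"
  shows "\<chi> (h \<otimes> g \<otimes> inv h) = \<chi> g"
proof -
  obtain n \<rho> where \<rho>: "irreducible_rep G n \<rho>" "\<chi> = (\<lambda>g\<in>carrier G. mat_trace (\<rho> g))"
    using assms(1) by (rule irreducible_character_cases)
  note D = matrix_repD[OF irreducible_repD(2)[OF \<rho>(1)]]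
  have "mat_trace (\<rho> (h \<otimes> g \<otimes> inv h)) = mat_trace (\<rho> (h \<otimes> g) * \<rho> (inv h))"
    using assms(2,3) D(2) by simp
  also have "\<dots> = mat_trace (\<rho> (inv h) * \<rho> (h \<otimes> g))"
    using assms(2,3) by (intro mat_trace_comm[of _ n n] D(1)) auto
  also have "\<rho> (inv h) * \<rho> (h \<otimes> g) = \<rho> (inv h \<otimes> (h \<otimes> g))"
    using assms(2,3) D(2) by simp
  also have "inv h \<otimes> (h \<otimes> g) = g" using assms(2,3) by (simp add: m_assoc[symmetric])
  finally show ?thesis using assms(2,3) \<rho>(2) by simp
qed

lemma irreducible_character_cnj:
  assumes "\<chi> \<in> Irr"
  shows "(\<lambda>g\<in>carrier G. cnj (\<chi> g)) \<in> Irr"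
proof -
  obtain n \<rho> where \<rho>: "irreducible_rep G n \<rho>" "\<chi> = (\<lambda>g\<in>carrier G. mat_trace (\<rho> g))"
    using assms(1) by (rule irreducible_character_cases)
  note D = matrix_repD[OF irreducible_repD(2)[OF \<rho>(1)]]
  have "(\<lambda>g\<in>carrier G. cnj (\<chi> g)) = (\<lambda>g\<in>carrier G. mat_trace (map_mat cnj (\<rho> g)))"
  proof (rule restrict_ext)
    fix g assume g: "g \<in> carrier G"
    have "dim_row (\<rho> g) = n" "dim_col (\<rho> g) = n" using D(1)[OF g] by auto
    then show "cnj (\<chi> g) = mat_trace (map_mat cnj (\<rho> g))" using g \<rho>(2) by (simp add: mat_trace_def)
  qed
  then show ?thesis using irreducible_rep_cnj[OF \<rho>(1)] by (auto simp: irreducible_characters_def)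
qed

lemma irreducible_character_one:
  assumes "\<chi> \<in> Irr"
  obtains n where "n > 0" "\<chi> \<one> = of_nat n"
  using assms by (rule irreducible_character_cases)
    (auto simp: matrix_repD(3)[OF irreducible_repD(2)] mat_trace_one intro: irreducible_repD(1))

lemma irreducible_character_orthogonality:
  assumes "\<chi> \<in> Irr" "\<psi> \<in> Irr"
  shows "(\<Sum>g\<in>carrier G. \<chi> g * cnj (\<psi> g)) = (if \<chi> = \<psi> then of_nat (card (carrier G)) else 0)"
proof -
  obtain n \<rho> where \<rho>: "irreducible_rep G n \<rho>" "\<chi> = (\<lambda>g\<in>carrier G. mat_trace (\<rho> g))"
    using assms(1) by (rule irreducible_character_cases)
  obtain m \<sigma> where \<sigma>: "irreducible_rep G m \<sigma>" "\<psi> = (\<lambda>g\<in>carrier G. mat_trace (\<sigma> g))"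
    using assms(2) by (rule irreducible_character_cases)
  show ?thesis
  proof (cases "\<chi> = \<psi>")
    case True
    have "(\<Sum>g\<in>carrier G. \<chi> g * cnj (\<psi> g)) = (\<Sum>g\<in>carrier G. mat_trace (\<rho> g) * mat_trace (\<rho> (inv g)))"
      by (rule sum.cong) (use \<rho> True in \<open>auto simp: trace_inv\<close>)
    then show ?thesis using True trace_norm[OF \<rho>(1)] by simp
  next
    case False
    then obtain g0 where "g0 \<in> carrier G" "mat_trace (\<rho> g0) \<noteq> mat_trace (\<sigma> g0)"
      using \<rho>(2) \<sigma>(2) by (metis restrict_ext)
    from trace_orthogonal[OF \<rho>(1) \<sigma>(1) this]
    have "(\<Sum>g\<in>carrier G. mat_trace (\<rho> g) * mat_trace (\<sigma> (inv g))) = 0" .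
    moreover have "(\<Sum>g\<in>carrier G. \<chi> g * cnj (\<psi> g)) = (\<Sum>g\<in>carrier G. mat_trace (\<rho> g) * mat_trace (\<sigma> (inv g)))"
      by (rule sum.cong) (use \<rho> \<sigma> in \<open>auto simp: trace_inv\<close>)
    ultimately show ?thesis using False by simp
  qed
qed

text \<open>This is Bessel's inequality for the indicator function of the identity, of which
  \<open>F\<close> is the projection up to the factor |G|. It bounds the sum \<open>K\<close> of the
  squared degrees by |G|, and every degree is at least 1. The uniform bound on finite subsets is
  what makes \<open>Irr\<close> finite.\<close>

lemma card_irreducible_characters_le:
  assumes S: "finite S" "S \<subseteq> Irr"
  shows "card S \<le> card (carrier G)"
proof -
  define F where "F g = (\<Sum>\<chi>\<in>S. cnj (\<chi> \<one>) * \<chi> g)" for g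
  define K where "K = (\<Sum>\<chi>\<in>S. (cmod (\<chi> \<one>))\<^sup>2)"
  have F1: "F \<one> = of_real K"
    unfolding F_def K_def of_real_sum
    by (rule sum.cong) (auto simp only: complex_norm_square mult.commute)
  have "complex_of_real (\<Sum>g\<in>carrier G. (cmod (F g))\<^sup>2) = (\<Sum>g\<in>carrier G. F g * cnj (F g))"
    unfolding of_real_sum by (rule sum.cong) (simp_all only: complex_norm_square)
  also have "\<dots> = (\<Sum>g\<in>carrier G. \<Sum>\<chi>\<in>S. \<Sum>\<psi>\<in>S. cnj (\<chi> \<one>) * \<psi> \<one> * (\<chi> g * cnj (\<psi> g)))"
    by (rule sum.cong) (auto simp: F_def sum_product mult_ac intro!: sum.cong)
  also have "\<dots> = (\<Sum>\<chi>\<in>S. \<Sum>\<psi>\<in>S. cnj (\<chi> \<one>) * \<psi> \<one> * (\<Sum>g\<in>carrier G. \<chi> g * cnj (\<psi> g)))"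
    unfolding sum_distrib_left by (subst sum.swap, rule sum.cong[OF refl], rule sum.swap)
  also have "\<dots> = (\<Sum>\<chi>\<in>S. \<Sum>\<psi>\<in>S. if \<chi> = \<psi> then cnj (\<chi> \<one>) * \<chi> \<one> * of_nat (card (carrier G)) else 0)"
    using S by (intro sum.cong refl) (auto simp: irreducible_character_orthogonality subset_iff)
  also have "\<dots> = of_nat (card (carrier G)) * F \<one>"
    using S(1) by (simp add: F_def sum_distrib_left mult_ac)
  finally have "complex_of_real (\<Sum>g\<in>carrier G. (cmod (F g))\<^sup>2) = of_real (of_nat (card (carrier G)) * K)"
    using F1 by simp
  then have "(\<Sum>g\<in>carrier G. (cmod (F g))\<^sup>2) = of_nat (card (carrier G)) * K" by (simp only: of_real_eq_iff)
  moreover have "(cmod (F \<one>))\<^sup>2 \<le> (\<Sum>g\<in>carrier G. (cmod (F g))\<^sup>2)"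
    by (rule member_le_sum) auto
  ultimately have "K * K \<le> of_nat (card (carrier G)) * K" using F1 by (simp add: power2_eq_square)
  moreover have le: "of_nat (card S) \<le> K"
  proof -
    have "(\<Sum>\<chi>\<in>S. 1) \<le> K"
      unfolding K_def
    proof (rule sum_mono)
      fix \<chi> assume "\<chi> \<in> S"
      with S have "\<chi> \<in> Irr" by blast
      then obtain n where "n > 0" "\<chi> \<one> = of_nat n" by (rule irreducible_character_one)
      then show "1 \<le> (cmod (\<chi> \<one>))\<^sup>2" by simp
    qed
    then show ?thesis by simp
  qed
  ultimately have "real (card S) \<le> real (card (carrier G))"
  proof (cases "K = 0")
    case False
    have "0 \<le> K" by (simp add: K_def sum_nonneg)
    with False have "K > 0" by simp
    from mult_right_le_imp_le[OF \<open>K * K \<le> of_nat (card (carrier G)) * K\<close> this]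
    show ?thesis using le by (rule order_trans[rotated])
  next
    case True
    then show ?thesis using le by simp
  qed
  then show ?thesis by simp
qed

lemma finite_irreducible_characters: "finite Irr"
  using finite_if_finite_subsets_card_bdd[OF card_irreducible_characters_le] by simp

end


section \<open>Irreducible characters and conjugacy classes\<close>

context finite_group
begin

lemma inv_mult_cancel_left: "x \<in> carrier G \<Longrightarrow> y \<in> carrier G \<Longrightarrow> inv x \<otimes> (x \<otimes> y) = y"
  by (simp add: m_assoc[symmetric])

lemma injective_mat_cancel:
  assumes B: "(B :: complex mat) \<in> carrier_mat n m"
    and inj: "\<forall>v\<in>carrier_vec m. B *\<^sub>v v = 0\<^sub>v n \<longrightarrow> v = 0\<^sub>v m"
    and X: "X \<in> carrier_mat m k" and Y: "Y \<in> carrier_mat m k" and eq: "B * X = B * Y"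
  shows "X = Y"
proof (rule mat_col_eqI)
  fix j assume "j < dim_col Y"
  then have j: "j < k" using Y by simp
  have c: "col X j \<in> carrier_vec m" "col Y j \<in> carrier_vec m" using X Y j by auto
  have "B *\<^sub>v col X j = B *\<^sub>v col Y j"
    unfolding col_mult2[OF B X j, symmetric] col_mult2[OF B Y j, symmetric] eq ..
  then have "B *\<^sub>v (col X j - col Y j) = 0\<^sub>v n"
    unfolding mult_minus_distrib_mat_vec[OF B c] using B c by simp
  then have 0: "col X j - col Y j = 0\<^sub>v m" using inj c by simp
  show "col X j = col Y j"
  proof (rule eq_vecI)
    fix i assume "i < dim_vec (col Y j)"
    then have i: "i < m" using carrier_vecD[OF c(2)] by (simp only:)
    have "(col X j - col Y j) $ i = 0" unfolding 0 using i by simp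
    then show "col X j $ i = col Y j $ i"
      using i carrier_vecD[OF c(2)] by (simp only: index_minus_vec right_minus_eq)
  qed (simp only: carrier_vecD[OF c(1)] carrier_vecD[OF c(2)])
qed (use X Y in auto)

text \<open>The matrices \<open>\<sigma> g\<close> describe the action on \<open>W\<close> in the
  basis formed by the columns of \<open>B\<close>; cancelling the injective \<open>B\<close> on the
  left transfers multiplicativity from \<open>\<rho>\<close> to \<open>\<sigma>\<close>.\<close>

lemma invariant_subspace_rep:
  assumes \<rho>: "matrix_rep G n \<rho>" and W: "vec_subspace n W" and inv: "invariant_under G \<rho> W"
    and nz: "W \<noteq> {0\<^sub>v n}"
  obtains m B \<sigma> where "matrix_rep G m \<sigma>" "B \<in> carrier_mat n m" "m > 0" "W \<noteq> carrier_vec n \<longrightarrow> m < n"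
    "\<forall>g\<in>carrier G. \<rho> g * B = B * \<sigma> g"
    "(\<lambda>v. B *\<^sub>v v) ` carrier_vec m = W"
    "\<forall>v\<in>carrier_vec m. B *\<^sub>v v = 0\<^sub>v n \<longrightarrow> v = 0\<^sub>v m"
proof -
  note c = matrix_repD(1)[OF \<rho>]
  obtain m B where B: "B \<in> carrier_mat n m" and less: "W \<noteq> carrier_vec n \<longrightarrow> m < n"
    and img: "(\<lambda>v. B *\<^sub>v v) ` carrier_vec m = W"
    and inj: "\<forall>v\<in>carrier_vec m. B *\<^sub>v v = 0\<^sub>v n \<longrightarrow> v = 0\<^sub>v m"
    by (rule vec_subspace_basis[OF W])
  have "\<exists>v\<in>carrier_vec m. B *\<^sub>v v = \<rho> g *\<^sub>v col B j" if g: "g \<in> carrier G" and j: "j < m" for g j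
  proof -
    have "B *\<^sub>v unit_vec m j \<in> W" unfolding img[symmetric] by (rule imageI) simp
    also have "B *\<^sub>v unit_vec m j = col B j"
      using col_mult2[OF B one_carrier_mat j] B j by simp
    finally have "\<rho> g *\<^sub>v col B j \<in> W" using inv g by (simp add: invariant_under_def)
    then show ?thesis unfolding img[symmetric] by (auto simp: image_iff)
  qed
  then obtain s where s: "\<And>g j. g \<in> carrier G \<Longrightarrow> j < m \<Longrightarrow>
      s g j \<in> carrier_vec m \<and> B *\<^sub>v s g j = \<rho> g *\<^sub>v col B j"
    by metis
  define \<sigma> where "\<sigma> g = mat_of_cols m (map (s g) [0..<m])" for g
  have \<sigma>c: "\<sigma> g \<in> carrier_mat m m" for g by (simp add: \<sigma>_def mat_of_cols_def)
  have eq: "\<rho> g * B = B * \<sigma> g" if g: "g \<in> carrier G" for g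
  proof (rule mat_col_eqI)
    fix j assume "j < dim_col (B * \<sigma> g)"
    then have j: "j < m" using \<sigma>c[of g] by simp
    have "col (\<sigma> g) j = s g j" using s[OF g j] j by (simp add: \<sigma>_def)
    then have "col (B * \<sigma> g) j = B *\<^sub>v s g j" using col_mult2[OF B \<sigma>c j] by simp
    also have "\<dots> = col (\<rho> g * B) j" using s[OF g j] col_mult2[OF c[OF g] B j] by simp
    finally show "col (\<rho> g * B) j = col (B * \<sigma> g) j" by simp
  qed (use c[OF g] B \<sigma>c[of g] in auto)
  have "matrix_rep G m \<sigma>"
    unfolding matrix_rep_def
  proof (intro conjI ballI)
    have "B * \<sigma> \<one> = B * 1\<^sub>m m" using eq[OF one_closed] matrix_repD(3)[OF \<rho>] B by simp
    then show "\<sigma> \<one> = 1\<^sub>m m" by (rule injective_mat_cancel[OF B inj \<sigma>c one_carrier_mat])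
    fix g h assume g: "g \<in> carrier G" and h: "h \<in> carrier G"
    have "B * \<sigma> (g \<otimes> h) = \<rho> g * \<rho> h * B"
      using eq[of "g \<otimes> h"] matrix_repD(2)[OF \<rho> g h] g h by simp
    also have "\<dots> = \<rho> g * B * \<sigma> h"
      unfolding assoc_mult_mat[OF c[OF g] c[OF h] B] eq[OF h] assoc_mult_mat[OF c[OF g] B \<sigma>c] ..
    also have "\<dots> = B * (\<sigma> g * \<sigma> h)"
      by (simp only: eq[OF g] assoc_mult_mat[OF B \<sigma>c[of g] \<sigma>c[of h]])
    finally show "\<sigma> (g \<otimes> h) = \<sigma> g * \<sigma> h"
      by (rule injective_mat_cancel[OF B inj \<sigma>c[of "g \<otimes> h"] mult_carrier_mat[OF \<sigma>c[of g] \<sigma>c[of h]]])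
  qed (rule \<sigma>c)
  note rep = this
  have "m > 0"
  proof (rule ccontr)
    assume "\<not> m > 0"
    then have m: "m = 0" by simp
    have "v = 0\<^sub>v m" if "v \<in> carrier_vec m" for v :: "complex vec"
      using carrier_vecD[OF that] m by (intro eq_vecI) simp_all
    then have "carrier_vec m = {0\<^sub>v m :: complex vec}" using zero_carrier_vec by blast
    then have "W = {B *\<^sub>v 0\<^sub>v m}" unfolding img[symmetric] by simp
    also have "B *\<^sub>v 0\<^sub>v m = 0\<^sub>v n" using B by auto
    finally show False using nz by simp
  qed
  have "\<forall>g\<in>carrier G. \<rho> g * B = B * \<sigma> g" using eq by blast
  from that[OF rep B \<open>m > 0\<close> less this img inj] show ?thesis .
qed

lemma vec_subspace_eigenspace:
  assumes A: "(A :: complex mat) \<in> carrier_mat n n"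
  shows "vec_subspace n {v \<in> carrier_vec n. A *\<^sub>v v = c \<cdot>\<^sub>v v}" (is "vec_subspace n ?W")
  unfolding vec_subspace_def
proof (intro conjI ballI allI)
  have "A *\<^sub>v 0\<^sub>v n = c \<cdot>\<^sub>v 0\<^sub>v n" by (rule eq_vecI) (use A in auto)
  then show "0\<^sub>v n \<in> ?W" by simp
  show "v + w \<in> ?W" if "v \<in> ?W" "w \<in> ?W" for v w
    using that mult_add_distrib_mat_vec[OF A, of v w] smult_add_distrib_vec[of v n w c] by simp
  show "k \<cdot>\<^sub>v v \<in> ?W" if "v \<in> ?W" for k v
    using that mult_mat_vec[OF A, of v k] by (simp add: smult_smult_assoc mult.commute)
qed auto

section \<open>Class functions acting as elements of the group algebra\<close>

definition algebra_op :: "('g \<Rightarrow> complex) \<Rightarrow> nat \<Rightarrow> ('g \<Rightarrow> complex mat) \<Rightarrow> complex mat" where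
  "algebra_op f n \<rho> = mat n n (\<lambda>(i, j). \<Sum>g\<in>carrier G. f g * \<rho> g $$ (i, j))"

lemma algebra_op_carrier: "algebra_op f n \<rho> \<in> carrier_mat n n"
  by (simp add: algebra_op_def)

lemma algebra_op_intertwines:
  assumes \<rho>: "matrix_rep G n \<rho>" and \<sigma>: "matrix_rep G m \<sigma>"
    and B: "B \<in> carrier_mat n m" and eq: "\<forall>g\<in>carrier G. \<rho> g * B = B * \<sigma> g"
  shows "algebra_op f n \<rho> * B = B * algebra_op f m \<sigma>"
proof (rule eq_matI)
  fix i j assume "i < dim_row (B * algebra_op f m \<sigma>)" "j < dim_col (B * algebra_op f m \<sigma>)"
  then have i: "i < n" and j: "j < m" using B by (auto simp: algebra_op_def)
  have "(algebra_op f n \<rho> * B) $$ (i, j) = (\<Sum>l<n. \<Sum>g\<in>carrier G. f g * (\<rho> g $$ (i, l) * B $$ (l, j)))"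
    unfolding index_mult_mat_sum[OF algebra_op_carrier B i j]
    using i by (intro sum.cong refl) (simp add: algebra_op_def sum_distrib_right mult.assoc)
  also have "\<dots> = (\<Sum>g\<in>carrier G. f g * (\<Sum>l<n. \<rho> g $$ (i, l) * B $$ (l, j)))"
    by (subst sum.swap) (simp add: sum_distrib_left)
  also have "\<dots> = (\<Sum>g\<in>carrier G. f g * (\<Sum>l<m. B $$ (i, l) * \<sigma> g $$ (l, j)))"
  proof (rule sum.cong[OF refl])
    fix g assume g: "g \<in> carrier G"
    show "f g * (\<Sum>l<n. \<rho> g $$ (i, l) * B $$ (l, j)) = f g * (\<Sum>l<m. B $$ (i, l) * \<sigma> g $$ (l, j))"
      unfolding index_mult_mat_sum[OF matrix_repD(1)[OF \<rho> g] B i j, symmetric]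
        index_mult_mat_sum[OF B matrix_repD(1)[OF \<sigma> g] i j, symmetric] eq[rule_format, OF g] ..
  qed
  also have "\<dots> = (\<Sum>l<m. \<Sum>g\<in>carrier G. B $$ (i, l) * (f g * \<sigma> g $$ (l, j)))"
    by (subst sum.swap) (simp add: sum_distrib_left mult_ac)
  also have "\<dots> = (B * algebra_op f m \<sigma>) $$ (i, j)"
    unfolding index_mult_mat_sum[OF B algebra_op_carrier i j]
    using j by (intro sum.cong refl) (simp add: algebra_op_def sum_distrib_left)
  finally show "(algebra_op f n \<rho> * B) $$ (i, j) = (B * algebra_op f m \<sigma>) $$ (i, j)" .
qed (use B in \<open>auto simp: algebra_op_def\<close>)

definition class_function :: "('g \<Rightarrow> complex) \<Rightarrow> bool" where
  "class_function f \<longleftrightarrow> (\<forall>g\<in>carrier G. \<forall>h\<in>carrier G. f (h \<otimes> g \<otimes> inv h) = f g)"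

lemma algebra_op_mult_left:
  assumes \<rho>: "matrix_rep G n \<rho>" and h: "h \<in> carrier G" and "i < n" "j < n"
  shows "(\<rho> h * algebra_op f n \<rho>) $$ (i, j) = (\<Sum>g\<in>carrier G. f g * \<rho> (h \<otimes> g) $$ (i, j))"
proof -
  have "(\<rho> h * algebra_op f n \<rho>) $$ (i, j) =
      (\<Sum>l<n. \<Sum>g\<in>carrier G. f g * (\<rho> h $$ (i, l) * \<rho> g $$ (l, j)))"
    unfolding index_mult_mat_sum[OF matrix_repD(1)[OF \<rho> h] algebra_op_carrier assms(3,4)]
    using assms(4) by (intro sum.cong refl) (simp add: algebra_op_def sum_distrib_left mult_ac)
  also have "\<dots> = (\<Sum>g\<in>carrier G. f g * \<rho> (h \<otimes> g) $$ (i, j))"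
    by (subst sum.swap, rule sum.cong)
      (simp_all add: matrix_rep_mult_index[OF \<rho> h _ assms(3,4)] sum_distrib_left)
  finally show ?thesis .
qed

lemma algebra_op_mult_right:
  assumes \<rho>: "matrix_rep G n \<rho>" and h: "h \<in> carrier G" and "i < n" "j < n"
  shows "(algebra_op f n \<rho> * \<rho> h) $$ (i, j) = (\<Sum>g\<in>carrier G. f g * \<rho> (g \<otimes> h) $$ (i, j))"
proof -
  have "(algebra_op f n \<rho> * \<rho> h) $$ (i, j) =
      (\<Sum>l<n. \<Sum>g\<in>carrier G. f g * (\<rho> g $$ (i, l) * \<rho> h $$ (l, j)))"
    unfolding index_mult_mat_sum[OF algebra_op_carrier matrix_repD(1)[OF \<rho> h] assms(3,4)]
    using assms(3) by (intro sum.cong refl) (simp add: algebra_op_def sum_distrib_right mult.assoc)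
  also have "\<dots> = (\<Sum>g\<in>carrier G. f g * \<rho> (g \<otimes> h) $$ (i, j))"
    by (subst sum.swap, rule sum.cong)
      (simp_all add: matrix_rep_mult_index[OF \<rho> _ h assms(3,4)] sum_distrib_left)
  finally show ?thesis .
qed

text \<open>A class function is central in the group algebra: with \<open>g'\<close> the conjugate
  of \<open>g\<close> by \<open>h\<close>, the product \<open>h \<otimes> g\<close> equals
  \<open>g' \<otimes> h\<close>, and \<open>f\<close> does not distinguish \<open>g\<close> from
  \<open>g'\<close>.\<close>

lemma class_function_intertwines:
  assumes \<rho>: "matrix_rep G n \<rho>" and f: "class_function f"
  shows "intertwines n n \<rho> \<rho> (algebra_op f n \<rho>)"
  unfolding intertwines_def
proof (intro conjI ballI eq_matI)
  fix h i j assume h: "h \<in> carrier G" and "i < dim_row (algebra_op f n \<rho> * \<rho> h)" "j < dim_col (algebra_op f n \<rho> * \<rho> h)"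
  then have ij: "i < n" "j < n" using matrix_repD(1)[OF \<rho> h] by (auto simp: algebra_op_def)
  have "(\<rho> h * algebra_op f n \<rho>) $$ (i, j) = (\<Sum>g\<in>carrier G. f g * \<rho> (h \<otimes> g) $$ (i, j))"
    by (rule algebra_op_mult_left[OF \<rho> h ij])
  also have "\<dots> = (\<Sum>g\<in>carrier G. f (h \<otimes> g \<otimes> inv h) * \<rho> (h \<otimes> g \<otimes> inv h \<otimes> h) $$ (i, j))"
    using h f by (intro sum.cong refl) (simp add: class_function_def m_assoc)
  also have "\<dots> = (\<Sum>g\<in>carrier G. f (g \<otimes> inv h) * \<rho> (g \<otimes> inv h \<otimes> h) $$ (i, j))"
    by (rule sum_translate_left[OF h])
  also have "\<dots> = (\<Sum>g\<in>carrier G. f g * \<rho> (g \<otimes> h) $$ (i, j))"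
    by (rule sum_translate_right) (use h in simp)
  also have "\<dots> = (algebra_op f n \<rho> * \<rho> h) $$ (i, j)"
    by (rule algebra_op_mult_right[OF \<rho> h ij, symmetric])
  finally show "(\<rho> h * algebra_op f n \<rho>) $$ (i, j) = (algebra_op f n \<rho> * \<rho> h) $$ (i, j)" .
qed (use matrix_repD(1)[OF \<rho>] in \<open>auto simp: algebra_op_def\<close>)

text \<open>In the left regular representation only the identity has fixed points, so the trace of
  the action of \<open>f\<close> reads off \<open>f \<one>\<close>.\<close>

lemma regular_rep_exists:
  obtains R where "matrix_rep G (card (carrier G)) R"
    "\<And>f. mat_trace (algebra_op f (card (carrier G)) R) = of_nat (card (carrier G)) * f \<one>"
proof -
  let ?N = "card (carrier G)"
  obtain e where "bij_betw e {0..<?N} (carrier G)" using ex_bij_betw_nat_finite[OF finite_carrier] by blast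
  then have bij: "bij_betw e {..<?N} (carrier G)" by (simp add: atLeast0LessThan)
  then have ec: "e i \<in> carrier G" if "i < ?N" for i using that by (auto simp: bij_betw_def)
  define R where "R g = mat ?N ?N (\<lambda>(i, j). if e i = g \<otimes> e j then 1 else 0 :: complex)" for g
  have Rc: "R g \<in> carrier_mat ?N ?N" for g by (simp add: R_def)
  have "matrix_rep G ?N R"
    unfolding matrix_rep_def
  proof (intro conjI ballI)
    show "R \<one> = 1\<^sub>m ?N"
      using bij ec by (intro eq_matI) (auto simp: R_def bij_betw_def inj_on_def)
    fix g h assume g: "g \<in> carrier G" and h: "h \<in> carrier G"
    show "R (g \<otimes> h) = R g * R h"
    proof (rule eq_matI)
      fix i j assume "i < dim_row (R g * R h)" "j < dim_col (R g * R h)"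
      then have ij: "i < ?N" "j < ?N" by (auto simp: R_def)
      have "(R g * R h) $$ (i, j) =
          (\<Sum>l<?N. if e l = h \<otimes> e j then (if e i = g \<otimes> e l then 1 else 0) else 0)"
        unfolding index_mult_mat_sum[OF Rc Rc ij] using ij by (intro sum.cong) (auto simp: R_def)
      also have "\<dots> = (\<Sum>x\<in>carrier G. if x = h \<otimes> e j then (if e i = g \<otimes> x then 1 else 0) else 0)"
        by (rule sum.reindex_bij_betw[OF bij])
      also have "\<dots> = R (g \<otimes> h) $$ (i, j)" using ij g h ec by (simp add: R_def m_assoc)
      finally show "R (g \<otimes> h) $$ (i, j) = (R g * R h) $$ (i, j)" by simp
    qed (auto simp: R_def)
  qed (rule Rc)
  moreover have "mat_trace (algebra_op f ?N R) = of_nat ?N * f \<one>" for f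
  proof -
    have "(\<Sum>g\<in>carrier G. f g * R g $$ (i, i)) = f \<one>" if i: "i < ?N" for i
    proof -
      have "(\<Sum>g\<in>carrier G. f g * R g $$ (i, i)) = (\<Sum>g\<in>carrier G. if g = \<one> then f g else 0)"
      proof (rule sum.cong[OF refl])
        fix g assume g: "g \<in> carrier G"
        have "e i = g \<otimes> e i \<longleftrightarrow> g = \<one>" using g ec[OF i] by simp
        then show "f g * R g $$ (i, i) = (if g = \<one> then f g else 0)" using i by (simp add: R_def)
      qed
      then show ?thesis by simp
    qed
    then show ?thesis by (simp add: mat_trace_def algebra_op_def)
  qed
  ultimately show ?thesis by (rule that)
qed

text \<open>
  An irreducible representation on which \<open>f\<close> acts by a nonzero scalar \<open>c\<close> is found as one of least
  dimension among all representations, reducible or not, on which \<open>f\<close> acts as \<open>c\<close>; an eigenspace of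
  \<open>f\<close> in the regular representation shows that there are any.
\<close>

lemma exists_irreducible_rep_nonzero:
  assumes f: "class_function f" and f1: "f \<one> \<noteq> 0"
  obtains n \<rho> c where "irreducible_rep G n \<rho>" "c \<noteq> 0" "algebra_op f n \<rho> = c \<cdot>\<^sub>m 1\<^sub>m n"
proof -
  let ?N = "card (carrier G)"
  obtain R where R: "matrix_rep G ?N R" "mat_trace (algebra_op f ?N R) = of_nat ?N * f \<one>"
    using regular_rep_exists by metis
  let ?A = "algebra_op f ?N R"
  have Ac: "?A \<in> carrier_mat ?N ?N" by (rule algebra_op_carrier)
  have "mat_trace ?A \<noteq> 0" using R(2) f1 carrier_not_empty by simp
  from nonzero_eigenvalue_exists[OF Ac this] obtain v c where
    c: "c \<noteq> 0" and v: "v \<in> carrier_vec ?N" "v \<noteq> 0\<^sub>v ?N" "?A *\<^sub>v v = c \<cdot>\<^sub>v v" by metis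
  let ?W = "{v \<in> carrier_vec ?N. ?A *\<^sub>v v = c \<cdot>\<^sub>v v}"
  have "vec_subspace ?N ?W" by (rule vec_subspace_eigenspace[OF Ac])
  moreover have "invariant_under G R ?W"
    unfolding invariant_under_def
  proof (intro ballI)
    fix g w assume g: "g \<in> carrier G" and w: "w \<in> ?W"
    note Rg = matrix_repD(1)[OF R(1) g]
    have "?A *\<^sub>v (R g *\<^sub>v w) = (?A * R g) *\<^sub>v w"
      using assoc_mult_mat_vec[OF Ac Rg] w by simp
    also have "?A * R g = R g * ?A"
      using class_function_intertwines[OF R(1) f] g by (simp add: intertwines_def)
    also have "(R g * ?A) *\<^sub>v w = R g *\<^sub>v (c \<cdot>\<^sub>v w)" using assoc_mult_mat_vec[OF Rg Ac] w by simp
    also have "\<dots> = c \<cdot>\<^sub>v (R g *\<^sub>v w)" using mult_mat_vec[OF Rg] w by simp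
    finally show "R g *\<^sub>v w \<in> ?W" using Rg w by simp
  qed
  moreover have "?W \<noteq> {0\<^sub>v ?N}" using v by blast
  ultimately obtain m B \<sigma> where m: "matrix_rep G m \<sigma>" "B \<in> carrier_mat ?N m" "m > 0"
    "?W \<noteq> carrier_vec ?N \<longrightarrow> m < ?N"
    "\<forall>g\<in>carrier G. R g * B = B * \<sigma> g" "(\<lambda>v. B *\<^sub>v v) ` carrier_vec m = ?W"
    "\<forall>v\<in>carrier_vec m. B *\<^sub>v v = 0\<^sub>v ?N \<longrightarrow> v = 0\<^sub>v m"
    by (rule invariant_subspace_rep[OF R(1)])
  have "B * algebra_op f m \<sigma> = ?A * B"
    using algebra_op_intertwines[OF R(1) m(1) m(2,5)] by simp
  also have "\<dots> = c \<cdot>\<^sub>m B"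
  proof (rule mat_eq_on_vecI)
    fix v :: "complex vec" assume v: "v \<in> carrier_vec m"
    then have "B *\<^sub>v v \<in> ?W" unfolding m(6)[symmetric] by (rule imageI)
    moreover have "(c \<cdot>\<^sub>m B) *\<^sub>v v = c \<cdot>\<^sub>v (B *\<^sub>v v)"
      using m(2) v by (intro eq_vecI) auto
    ultimately show "(?A * B) *\<^sub>v v = (c \<cdot>\<^sub>m B) *\<^sub>v v"
      using assoc_mult_mat_vec[OF Ac m(2) v] by simp
  qed (use mult_carrier_mat[OF Ac m(2)] m(2) in auto)
  also have "\<dots> = B * (c \<cdot>\<^sub>m 1\<^sub>m m)" using mult_smult_distrib[OF m(2) one_carrier_mat] m(2) by simp
  finally have "algebra_op f m \<sigma> = c \<cdot>\<^sub>m 1\<^sub>m m"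
    by (rule injective_mat_cancel[OF m(2,7) algebra_op_carrier smult_carrier_mat[OF one_carrier_mat]])
  with m(1,3) have ex: "\<exists>m. m > 0 \<and> (\<exists>\<sigma>. matrix_rep G m \<sigma> \<and> algebra_op f m \<sigma> = c \<cdot>\<^sub>m 1\<^sub>m m)" by blast
  define n where "n = (LEAST m. m > 0 \<and> (\<exists>\<sigma>. matrix_rep G m \<sigma> \<and> algebra_op f m \<sigma> = c \<cdot>\<^sub>m 1\<^sub>m m))"
  from LeastI_ex[OF ex] obtain \<rho> where \<rho>: "n > 0" "matrix_rep G n \<rho>" "algebra_op f n \<rho> = c \<cdot>\<^sub>m 1\<^sub>m n"
    unfolding n_def by blast
  have "W = {0\<^sub>v n} \<or> W = carrier_vec n" if W: "vec_subspace n W" "invariant_under G \<rho> W" for W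
  proof (rule ccontr)
    assume a: "\<not> (W = {0\<^sub>v n} \<or> W = carrier_vec n)"
    then have nz: "W \<noteq> {0\<^sub>v n}" and nt: "W \<noteq> carrier_vec n" by blast+
    obtain m B \<sigma> where m: "matrix_rep G m \<sigma>" "B \<in> carrier_mat n m" "m > 0"
      "W \<noteq> carrier_vec n \<longrightarrow> m < n"
      "\<forall>g\<in>carrier G. \<rho> g * B = B * \<sigma> g"
      "(\<lambda>v. B *\<^sub>v v) ` carrier_vec m = W"
      "\<forall>v\<in>carrier_vec m. B *\<^sub>v v = 0\<^sub>v n \<longrightarrow> v = 0\<^sub>v m"
      by (rule invariant_subspace_rep[OF \<rho>(2) W nz])
    have "B * algebra_op f m \<sigma> = (c \<cdot>\<^sub>m 1\<^sub>m n) * B"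
      unfolding \<rho>(3)[symmetric] by (rule algebra_op_intertwines[OF \<rho>(2) m(1) m(2,5), symmetric])
    also have "\<dots> = c \<cdot>\<^sub>m B" using mult_smult_assoc_mat[OF one_carrier_mat m(2)] m(2) by simp
    also have "\<dots> = B * (c \<cdot>\<^sub>m 1\<^sub>m m)" using mult_smult_distrib[OF m(2) one_carrier_mat] m(2) by simp
    finally have "algebra_op f m \<sigma> = c \<cdot>\<^sub>m 1\<^sub>m m"
      by (rule injective_mat_cancel[OF m(2,7) algebra_op_carrier smult_carrier_mat[OF one_carrier_mat]])
    with m(1,3) have "n \<le> m" unfolding n_def by (intro Least_le) blast
    then show False using m(4) nt by simp
  qed
  then have "irreducible_rep G n \<rho>" using \<rho> by (simp add: irreducible_iff)
  from that[OF this c \<rho>(3)] show ?thesis .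
qed

text \<open>On an irreducible representation \<open>f\<close> acts as a scalar determined by its
  pairing with the character, hence as 0. The convolution \<open>a\<close> of the adjoint of
  \<open>f\<close> with \<open>f\<close> acts as a multiple of the action of \<open>f\<close>, so it
  acts as 0 as well; but for nonzero \<open>f\<close> it would act as a nonzero scalar on some
  irreducible representation.\<close>

lemma class_function_eq_0:
  assumes f: "class_function f" and 0: "\<And>\<chi>. \<chi> \<in> Irr \<Longrightarrow> (\<Sum>g\<in>carrier G. f g * \<chi> g) = 0"
    and g0: "g0 \<in> carrier G"
  shows "f g0 = 0"
proof (rule ccontr)
  assume nz: "f g0 \<noteq> 0"
  have op0: "algebra_op f n \<rho> = 0\<^sub>m n n" if \<rho>: "irreducible_rep G n \<rho>" for n \<rho>
  proof -
    note D = irreducible_repD[OF \<rho>]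
    obtain c where c: "algebra_op f n \<rho> = c \<cdot>\<^sub>m 1\<^sub>m n"
      using schur_scalar[OF \<rho> class_function_intertwines[OF D(2) f]] by blast
    have "of_nat n * c = mat_trace (algebra_op f n \<rho>)" unfolding c by (simp add: mat_trace_def)
    also have "\<dots> = (\<Sum>g\<in>carrier G. f g * (\<Sum>i<n. \<rho> g $$ (i, i)))"
      by (simp add: mat_trace_def algebra_op_def sum_distrib_left sum.swap[of _ "{..<n}"])
    also have "\<dots> = (\<Sum>g\<in>carrier G. f g * (\<lambda>g\<in>carrier G. mat_trace (\<rho> g)) g)"
    proof (rule sum.cong[OF refl])
      fix g assume g: "g \<in> carrier G"
      have "dim_row (\<rho> g) = n" using matrix_repD(1)[OF D(2) g] by simp
      then show "f g * (\<Sum>i<n. \<rho> g $$ (i, i)) = f g * (\<lambda>g\<in>carrier G. mat_trace (\<rho> g)) g"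
        using g by (simp add: mat_trace_def)
    qed
    also have "\<dots> = 0"
    proof (rule 0)
      show "(\<lambda>g\<in>carrier G. mat_trace (\<rho> g)) \<in> Irr"
        unfolding irreducible_characters_def using \<rho> by blast
    qed
    finally have "c = 0" using D(1) by simp
    then show ?thesis unfolding c by (intro eq_matI) auto
  qed
  \<comment> \<open>The value \<open>a \<one>\<close> is the sum of the squared absolute values of
    \<open>f\<close>, so it is nonzero even if \<open>f \<one>\<close> happens to be 0.\<close>
  define a where "a g = (\<Sum>h\<in>carrier G. cnj (f h) * f (h \<otimes> g))" for g
  have "class_function a"
    unfolding class_function_def
  proof (intro ballI)
    fix g x assume g: "g \<in> carrier G" and x: "x \<in> carrier G"
    have "a (x \<otimes> g \<otimes> inv x) = (\<Sum>h\<in>carrier G. cnj (f h) * f (h \<otimes> (x \<otimes> g \<otimes> inv x)))"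
      by (simp add: a_def)
    \<comment> \<open>Two translations together replace \<open>h\<close> by
      \<open>x \<otimes> h \<otimes> inv x\<close>; both arguments of \<open>f\<close> then become
      conjugates by \<open>x\<close>.\<close>
    also have "\<dots> = (\<Sum>h\<in>carrier G. cnj (f (h \<otimes> inv x)) * f (h \<otimes> inv x \<otimes> (x \<otimes> g \<otimes> inv x)))"
      by (rule sum_translate_right[symmetric]) (use x in simp)
    also have "\<dots> = (\<Sum>h\<in>carrier G. cnj (f (x \<otimes> h \<otimes> inv x)) * f (x \<otimes> h \<otimes> inv x \<otimes> (x \<otimes> g \<otimes> inv x)))"
      by (rule sum_translate_left[OF x, symmetric])
    also have "\<dots> = a g"
      unfolding a_def
    proof (rule sum.cong[OF refl])
      fix h assume h: "h \<in> carrier G"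
      have "x \<otimes> h \<otimes> inv x \<otimes> (x \<otimes> g \<otimes> inv x) = x \<otimes> (h \<otimes> g) \<otimes> inv x"
        using x h g by (simp add: m_assoc inv_mult_cancel_left)
      then show "cnj (f (x \<otimes> h \<otimes> inv x)) * f (x \<otimes> h \<otimes> inv x \<otimes> (x \<otimes> g \<otimes> inv x)) = cnj (f h) * f (h \<otimes> g)"
        using f x h g by (simp add: class_function_def)
    qed
    finally show "a (x \<otimes> g \<otimes> inv x) = a g" .
  qed
  moreover have "a \<one> \<noteq> 0"
  proof
    assume "a \<one> = 0"
    have "complex_of_real (\<Sum>h\<in>carrier G. (cmod (f h))\<^sup>2) = (\<Sum>h\<in>carrier G. cnj (f h) * f h)"
      unfolding of_real_sum by (intro sum.cong refl) (simp only: complex_norm_square mult.commute)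
    also have "\<dots> = a \<one>" unfolding a_def by (intro sum.cong refl) simp
    finally have "complex_of_real (\<Sum>h\<in>carrier G. (cmod (f h))\<^sup>2) = 0" using \<open>a \<one> = 0\<close> by simp
    then have "(\<Sum>h\<in>carrier G. (cmod (f h))\<^sup>2) = 0" by (simp only: of_real_eq_0_iff)
    then show False using nz g0 by (simp add: sum_nonneg_eq_0_iff)
  qed
  ultimately obtain n \<rho> c where \<rho>: "irreducible_rep G n \<rho>" "c \<noteq> 0" "algebra_op a n \<rho> = c \<cdot>\<^sub>m 1\<^sub>m n"
    by (rule exists_irreducible_rep_nonzero)
  note D = irreducible_repD[OF \<rho>(1)]
  have n0: "0 < n" by (rule D(1))
  \<comment> \<open>The single entry \<open>(0, 0)\<close> suffices because it equals
    \<open>c\<close>.\<close>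
  have "algebra_op a n \<rho> $$ (0, 0) =
      (\<Sum>g\<in>carrier G. \<Sum>h\<in>carrier G. cnj (f h) * (f (h \<otimes> g) * \<rho> g $$ (0, 0)))"
    using n0 by (simp add: algebra_op_def a_def sum_distrib_right mult.assoc)
  also have "\<dots> = (\<Sum>h\<in>carrier G. cnj (f h) * (\<Sum>g\<in>carrier G. f (h \<otimes> g) * \<rho> g $$ (0, 0)))"
    by (subst sum.swap) (simp add: sum_distrib_left)
  also have "\<dots> = (\<Sum>h\<in>carrier G. cnj (f h) * (\<rho> (inv h) * algebra_op f n \<rho>) $$ (0, 0))"
  proof (rule sum.cong[OF refl])
    fix h assume h: "h \<in> carrier G"
    have "(\<Sum>g\<in>carrier G. f (h \<otimes> g) * \<rho> g $$ (0, 0)) =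
        (\<Sum>g\<in>carrier G. f (h \<otimes> g) * \<rho> (inv h \<otimes> (h \<otimes> g)) $$ (0, 0))"
      using h by (intro sum.cong refl) (simp add: m_assoc[symmetric])
    also have "\<dots> = (\<Sum>g\<in>carrier G. f g * \<rho> (inv h \<otimes> g) $$ (0, 0))"
      by (rule sum_translate_left[OF h])
    also have "\<dots> = (\<rho> (inv h) * algebra_op f n \<rho>) $$ (0, 0)"
      using algebra_op_mult_left[OF D(2) inv_closed[OF h] n0 n0] by simp
    finally show "cnj (f h) * (\<Sum>g\<in>carrier G. f (h \<otimes> g) * \<rho> g $$ (0, 0)) =
        cnj (f h) * (\<rho> (inv h) * algebra_op f n \<rho>) $$ (0, 0)" by simp
  qed
  also have "\<dots> = 0"
  proof (rule sum.neutral, intro ballI)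
    fix h assume "h \<in> carrier G"
    then have "\<rho> (inv h) * algebra_op f n \<rho> = 0\<^sub>m n n"
      unfolding op0[OF \<rho>(1)] using matrix_repD(1)[OF D(2), of "inv h"] by simp
    then show "cnj (f h) * (\<rho> (inv h) * algebra_op f n \<rho>) $$ (0, 0) = 0" using n0 by simp
  qed
  finally show False using \<rho>(2,3) n0 by simp
qed

section \<open>Conjugacy classes and column orthogonality\<close>

definition conj_class :: "'g \<Rightarrow> 'g set" where
  "conj_class g = (\<lambda>h. h \<otimes> g \<otimes> inv h) ` carrier G"

lemma conj_class_self: "g \<in> carrier G \<Longrightarrow> g \<in> conj_class g"
  by (auto simp: conj_class_def intro!: image_eqI[of _ _ \<one>])

lemma conj_class_subset: "g \<in> carrier G \<Longrightarrow> conj_class g \<subseteq> carrier G"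
  by (auto simp: conj_class_def)

lemma conj_class_eq:
  assumes g: "g \<in> carrier G" and k: "k \<in> conj_class g"
  shows "conj_class k = conj_class g"
proof -
  obtain x where x: "x \<in> carrier G" "k = x \<otimes> g \<otimes> inv x" using k by (auto simp: conj_class_def)
  have "h \<otimes> k \<otimes> inv h = (h \<otimes> x) \<otimes> g \<otimes> inv (h \<otimes> x)" if "h \<in> carrier G" for h
    using x g that by (simp add: m_assoc inv_mult_group)
  moreover have "h \<otimes> g \<otimes> inv h = (h \<otimes> inv x) \<otimes> k \<otimes> inv (h \<otimes> inv x)" if "h \<in> carrier G" for h
    using x g that by (simp add: m_assoc inv_mult_group inv_mult_cancel_left)
  ultimately have "h \<otimes> k \<otimes> inv h \<in> conj_class g" "h \<otimes> g \<otimes> inv h \<in> conj_class k"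
    if "h \<in> carrier G" for h
    using that x(1) unfolding conj_class_def by blast+
  then show ?thesis by (auto simp: conj_class_def[of k] conj_class_def[of g])
qed

lemma conj_class_eq_iff:
  "g \<in> carrier G \<Longrightarrow> k \<in> carrier G \<Longrightarrow> conj_class k = conj_class g \<longleftrightarrow> k \<in> conj_class g"
  using conj_class_eq conj_class_self by metis

lemma finite_conj_class: "finite (conj_class g)"
  by (simp add: conj_class_def)

lemma card_conj_class_pos: "g \<in> carrier G \<Longrightarrow> card (conj_class g) > 0"
  using finite_conj_class conj_class_self by (auto simp: card_gt_0_iff)

lemma irreducible_character_conj_class:
  assumes "\<chi> \<in> Irr" "g \<in> carrier G" "k \<in> conj_class g"
  shows "\<chi> k = \<chi> g"
  using assms irreducible_character_conj by (auto simp: conj_class_def)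

text \<open>The function \<open>f\<close> is the difference, cleared of denominators, between the
  indicator function of the class of \<open>k\<close> and its expected expansion in characters. It
  is orthogonal to all characters and therefore vanishes at \<open>g\<close>.\<close>

lemma column_orthogonality:
  assumes g: "g \<in> carrier G" and k: "k \<in> carrier G"
  shows "(\<Sum>\<chi>\<in>Irr. \<chi> g * cnj (\<chi> k)) =
    (if g \<in> conj_class k then of_nat (card (carrier G)) / of_nat (card (conj_class k)) else 0)"
proof -
  let ?N = "of_nat (card (carrier G)) :: complex" and ?c = "of_nat (card (conj_class k)) :: complex"
  define f where "f x = ?N * (if x \<in> conj_class k then 1 else 0) - ?c * (\<Sum>\<chi>\<in>Irr. cnj (\<chi> k) * \<chi> x)" for x
  have "class_function f"
    unfolding class_function_def
  proof (intro ballI)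
    fix x h assume x: "x \<in> carrier G" and h: "h \<in> carrier G"
    have y: "h \<otimes> x \<otimes> inv h \<in> carrier G" using x h by simp
    have "conj_class (h \<otimes> x \<otimes> inv h) = conj_class x"
      using conj_class_eq[OF x, of "h \<otimes> x \<otimes> inv h"] h by (auto simp: conj_class_def)
    then have "h \<otimes> x \<otimes> inv h \<in> conj_class k \<longleftrightarrow> x \<in> conj_class k"
      using conj_class_eq_iff[OF k] x y by metis
    moreover have "(\<Sum>\<chi>\<in>Irr. cnj (\<chi> k) * \<chi> (h \<otimes> x \<otimes> inv h)) = (\<Sum>\<chi>\<in>Irr. cnj (\<chi> k) * \<chi> x)"
      using x h by (intro sum.cong refl) (simp add: irreducible_character_conj)
    ultimately show "f (h \<otimes> x \<otimes> inv h) = f x" by (simp add: f_def)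
  qed
  moreover have "(\<Sum>x\<in>carrier G. f x * \<psi> x) = 0" if \<psi>: "\<psi> \<in> Irr" for \<psi>
  proof -
    \<comment> \<open>The pairing in \<open>class_function_eq_0\<close> contains no conjugation, so
      in the expansion it is the conjugate of \<open>\<psi>\<close> that survives.\<close>
    let ?\<phi> = "\<lambda>g\<in>carrier G. cnj (\<psi> g)"
    have \<phi>: "?\<phi> \<in> Irr" by (rule irreducible_character_cnj[OF \<psi>])
    have 1: "(\<Sum>x\<in>carrier G. (if x \<in> conj_class k then 1 else 0) * \<psi> x) = ?c * \<psi> k"
    proof -
      have "(\<Sum>x\<in>carrier G. (if x \<in> conj_class k then 1 else 0) * \<psi> x) =
          (\<Sum>x\<in>carrier G. if x \<in> conj_class k then \<psi> x else 0)"
        by (intro sum.cong refl) simp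
      also have "\<dots> = (\<Sum>x\<in>carrier G \<inter> conj_class k. \<psi> x)" by (rule sum.inter_restrict[symmetric]) simp
      also have "carrier G \<inter> conj_class k = conj_class k" using conj_class_subset[OF k] by blast
      also have "(\<Sum>x\<in>conj_class k. \<psi> x) = (\<Sum>x\<in>conj_class k. \<psi> k)"
        by (intro sum.cong refl irreducible_character_conj_class[OF \<psi> k])
      finally show ?thesis by simp
    qed
    have "(\<Sum>x\<in>carrier G. (\<Sum>\<chi>\<in>Irr. cnj (\<chi> k) * \<chi> x) * \<psi> x) =
        (\<Sum>\<chi>\<in>Irr. cnj (\<chi> k) * (\<Sum>x\<in>carrier G. \<chi> x * \<psi> x))"
      by (simp add: sum_distrib_left sum_distrib_right sum.swap[of _ Irr] mult.assoc)
    also have "\<dots> = (\<Sum>\<chi>\<in>Irr. cnj (\<chi> k) * (\<Sum>x\<in>carrier G. \<chi> x * cnj (?\<phi> x)))"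
      by (intro sum.cong refl arg_cong2[of _ _ _ _ "(*)"]) simp
    also have "\<dots> = (\<Sum>\<chi>\<in>Irr. if \<chi> = ?\<phi> then cnj (\<chi> k) * ?N else 0)"
    proof (rule sum.cong[OF refl])
      fix \<chi> assume "\<chi> \<in> Irr"
      from irreducible_character_orthogonality[OF this \<phi>]
      show "cnj (\<chi> k) * (\<Sum>x\<in>carrier G. \<chi> x * cnj (?\<phi> x)) = (if \<chi> = ?\<phi> then cnj (\<chi> k) * ?N else 0)"
        by (simp only: if_distrib[of "(*) _"] mult_zero_right)
    qed
    also have "\<dots> = \<psi> k * ?N" using finite_irreducible_characters \<phi> k by simp
    finally show ?thesis
      using 1 by (simp add: f_def left_diff_distrib sum_subtractf mult.assoc sum_distrib_left[symmetric])
  qed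
  ultimately have "f g = 0" using class_function_eq_0 g by blast
  moreover have "?c \<noteq> 0" using card_conj_class_pos[OF k] by simp
  moreover have "(\<Sum>\<chi>\<in>Irr. cnj (\<chi> k) * \<chi> g) = (\<Sum>\<chi>\<in>Irr. \<chi> g * cnj (\<chi> k))"
    by (intro sum.cong refl mult.commute)
  ultimately show ?thesis unfolding f_def by (auto simp: field_simps)
qed

text \<open>Each class inside \<open>R\<close> contributes 1 in total, so weighting elements by the
  reciprocal size of their class counts classes.\<close>

lemma sum_inverse_card_conj_class:
  assumes R: "R \<subseteq> carrier G" "\<And>g. g \<in> R \<Longrightarrow> conj_class g \<subseteq> R"
  shows "(\<Sum>g\<in>R. 1 / of_nat (card (conj_class g)) :: complex) = of_nat (card (conj_class ` R))"
proof -
  have fin: "finite R" using R(1) finite_carrier finite_subset by blast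
  have "(\<Sum>g\<in>R. 1 / of_nat (card (conj_class g)) :: complex) =
      (\<Sum>K\<in>conj_class ` R. \<Sum>g\<in>{g\<in>R. conj_class g = K}. 1 / of_nat (card (conj_class g)))"
    by (rule sum.image_gen[OF fin])
  also have "\<dots> = (\<Sum>K\<in>conj_class ` R. 1)"
  proof (rule sum.cong[OF refl])
    fix K assume "K \<in> conj_class ` R"
    then obtain k where k: "k \<in> R" "K = conj_class k" by blast
    have kc: "k \<in> carrier G" using k R by blast
    have "{g\<in>R. conj_class g = K} = K"
      using k R conj_class_eq_iff[OF kc] by blast
    moreover have "(\<Sum>g\<in>{g\<in>R. conj_class g = K}. 1 / of_nat (card (conj_class g))) =
        (\<Sum>g\<in>{g\<in>R. conj_class g = K}. 1 / of_nat (card K) :: complex)"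
      by (rule sum.cong) auto
    ultimately show "(\<Sum>g\<in>{g\<in>R. conj_class g = K}. 1 / of_nat (card (conj_class g)) :: complex) = 1"
      using card_conj_class_pos[OF kc] k by simp
  qed
  finally show ?thesis by simp
qed

theorem card_real_irreducible_characters:
  "card (real_irreducible_characters G) = card (conj_class ` {g \<in> carrier G. inv g \<in> conj_class g})"
proof -
  let ?N = "of_nat (card (carrier G)) :: complex"
  let ?R = "{g \<in> carrier G. inv g \<in> conj_class g}"
  have "(\<Sum>g\<in>carrier G. \<chi> g * \<chi> g) = (if \<chi> \<in> real_irreducible_characters G then ?N else 0)"
    if \<chi>: "\<chi> \<in> Irr" for \<chi>
  proof -
    let ?\<phi> = "\<lambda>g\<in>carrier G. cnj (\<chi> g)"
    \<comment> \<open>Both functions are \<open>undefined\<close> outside of the group, so agreement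
      on it already gives \<open>?\<phi> = \<chi>\<close>.\<close>
    have "\<chi> \<in> extensional (carrier G)"
      using \<chi> by (rule irreducible_character_cases) simp
    then have "?\<phi> = \<chi>" if "\<forall>g\<in>carrier G. cnj (\<chi> g) = \<chi> g"
      using that by (intro extensionalityI[of _ "carrier G"]) simp_all
    moreover have "\<forall>g\<in>carrier G. cnj (\<chi> g) = \<chi> g" if "?\<phi> = \<chi>"
    proof
      fix g assume "g \<in> carrier G"
      then show "cnj (\<chi> g) = \<chi> g" using fun_cong[OF that, of g] by simp
    qed
    ultimately have real: "\<chi> = ?\<phi> \<longleftrightarrow> \<chi> \<in> real_irreducible_characters G"
      unfolding real_irreducible_characters_def Reals_cnj_iff mem_Collect_eq using \<chi> by metis
    have "(\<Sum>g\<in>carrier G. \<chi> g * \<chi> g) = (\<Sum>g\<in>carrier G. \<chi> g * cnj (?\<phi> g))"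
      by (intro sum.cong refl) simp
    then show ?thesis
      by (simp only: irreducible_character_orthogonality[OF \<chi> irreducible_character_cnj[OF \<chi>]] real)
  qed
  then have "(\<Sum>\<chi>\<in>Irr. \<Sum>g\<in>carrier G. \<chi> g * \<chi> g) =
      (\<Sum>\<chi>\<in>Irr. if \<chi> \<in> real_irreducible_characters G then ?N else 0)"
    by (intro sum.cong refl)
  also have "\<dots> = (\<Sum>\<chi>\<in>Irr \<inter> real_irreducible_characters G. ?N)"
    by (rule sum.inter_restrict[symmetric, OF finite_irreducible_characters])
  also have "Irr \<inter> real_irreducible_characters G = real_irreducible_characters G"
    by (auto simp: real_irreducible_characters_def)
  finally have "of_nat (card (real_irreducible_characters G)) * ?N =
      (\<Sum>\<chi>\<in>Irr. \<Sum>g\<in>carrier G. \<chi> g * \<chi> g)" by simp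
  also have "\<dots> = (\<Sum>g\<in>carrier G. \<Sum>\<chi>\<in>Irr. \<chi> g * cnj (\<chi> (inv g)))"
    by (subst sum.swap) (simp add: irreducible_character_inv)
  also have "\<dots> = (\<Sum>g\<in>carrier G. if g \<in> ?R then ?N / of_nat (card (conj_class g)) else 0)"
  proof (rule sum.cong[OF refl])
    fix g assume g: "g \<in> carrier G"
    then have "g \<in> conj_class (inv g) \<longleftrightarrow> inv g \<in> conj_class g"
      "inv g \<in> conj_class g \<Longrightarrow> conj_class (inv g) = conj_class g"
      using conj_class_eq_iff[of g "inv g"] conj_class_eq_iff[of "inv g" g] by auto
    then show "(\<Sum>\<chi>\<in>Irr. \<chi> g * cnj (\<chi> (inv g))) =
        (if g \<in> ?R then ?N / of_nat (card (conj_class g)) else 0)"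
      using g column_orthogonality[OF g inv_closed[OF g]] by simp
  qed
  also have "\<dots> = (\<Sum>g\<in>carrier G \<inter> ?R. ?N / of_nat (card (conj_class g)))"
    by (rule sum.inter_restrict[symmetric]) simp
  also have "\<dots> = ?N * (\<Sum>g\<in>?R. 1 / of_nat (card (conj_class g)))"
    by (simp add: sum_distrib_left Int_absorb1 Collect_conj_eq)
  also have "(\<Sum>g\<in>?R. 1 / of_nat (card (conj_class g)) :: complex) = of_nat (card (conj_class ` ?R))"
  proof (rule sum_inverse_card_conj_class)
    fix g assume g: "g \<in> ?R"
    show "conj_class g \<subseteq> ?R"
    proof
      fix k assume k: "k \<in> conj_class g"
      then obtain x where x: "x \<in> carrier G" "k = x \<otimes> g \<otimes> inv x" by (auto simp: conj_class_def)
      have "inv k = x \<otimes> inv g \<otimes> inv x" using x g by (simp add: inv_mult_group m_assoc)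
      then have "inv k \<in> conj_class (inv g)" using x by (auto simp: conj_class_def)
      then have "inv k \<in> conj_class k"
        using g k conj_class_eq[of g k] conj_class_eq[of g "inv g"] by auto
      then show "k \<in> ?R" using g k conj_class_subset by auto
    qed
  qed auto
  finally have "of_nat (card (real_irreducible_characters G)) = (of_nat (card (conj_class ` ?R)) :: complex)"
    using carrier_not_empty by simp
  then show ?thesis by (simp only: of_nat_eq_iff)
qed

end


section \<open>The field with eight elements\<close>

text \<open>\<open>F8 x y z\<close> stands for \<open>x + y \<tau> + z \<tau>\<^sup>2\<close>, where \<open>\<tau>\<^sup>3 = \<tau> + 1\<close>.\<close>

datatype f8 = F8 bit bit bit
instantiation f8 :: comm_ring_1
begin

definition zero_f8 :: f8 where "0 = F8 0 0 0"
definition one_f8 :: f8 where "1 = F8 1 0 0"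
fun plus_f8 :: "f8 \<Rightarrow> f8 \<Rightarrow> f8" where
  "F8 x y z + F8 x' y' z' = F8 (x + x') (y + y') (z + z')"
fun uminus_f8 :: "f8 \<Rightarrow> f8" where "- F8 x y z = F8 (- x) (- y) (- z)"
fun minus_f8 :: "f8 \<Rightarrow> f8 \<Rightarrow> f8" where
  "F8 x y z - F8 x' y' z' = F8 (x - x') (y - y') (z - z')"
fun times_f8 :: "f8 \<Rightarrow> f8 \<Rightarrow> f8" where
  "F8 x y z * F8 x' y' z' =
    F8 (x * x' + y * z' + z * y')
       (x * y' + y * x' + y * z' + z * y' + z * z')
       (x * z' + y * y' + z * x' + z * z')"

instance
proof
  fix a b c :: f8
  show "a + b + c = a + (b + c)" by (cases a; cases b; cases c) (simp only: plus_f8.simps add.assoc)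
  show "a + b = b + a" by (cases a; cases b) (simp only: plus_f8.simps add.commute)
  show "0 + a = a" by (cases a) (simp only: plus_f8.simps zero_f8_def add_0_left)
  show "- a + a = 0" by (cases a) (simp only: plus_f8.simps uminus_f8.simps zero_f8_def left_minus)
  show "a - b = a + - b"
    by (cases a; cases b) (simp only: plus_f8.simps minus_f8.simps uminus_f8.simps diff_conv_add_uminus)
  show "a * b = b * a" by (cases a; cases b) (simp only: times_f8.simps ac_simps)
  show "1 * a = a"
    by (cases a) (simp only: times_f8.simps one_f8_def mult_1_left mult_zero_left add_0_right)
  show "(0 :: f8) \<noteq> 1" by (simp add: zero_f8_def one_f8_def)
  show "(a + b) * c = a * c + b * c"
    by (cases a; cases b; cases c) (simp only: plus_f8.simps times_f8.simps distrib_left distrib_right ac_simps)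
  show "a * b * c = a * (b * c)"
    by (cases a; cases b; cases c) (simp only: times_f8.simps distrib_left distrib_right ac_simps)
qed

end

lemma bit_all: "(\<forall>x. P x) \<longleftrightarrow> P (0 :: bit) \<and> P 1"
  using bit_not_zero_iff by metis

lemma f8_all: "(\<forall>a. P a) \<longleftrightarrow>
    P (F8 0 0 0) \<and> P (F8 0 0 1) \<and> P (F8 0 1 0) \<and> P (F8 0 1 1) \<and>
    P (F8 1 0 0) \<and> P (F8 1 0 1) \<and> P (F8 1 1 0) \<and> P (F8 1 1 1)"
proof -
  have "(\<forall>a. P a) \<longleftrightarrow> (\<forall>x y z. P (F8 x y z))" by (metis f8.exhaust)
  then show ?thesis by (simp add: bit_all conj_assoc)
qed

lemma UNIV_f8:
  "(UNIV :: f8 set) = {F8 0 0 0, F8 0 0 1, F8 0 1 0, F8 0 1 1, F8 1 0 0, F8 1 0 1, F8 1 1 0, F8 1 1 1}"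
  using f8_all[of "\<lambda>a. a \<in> {F8 0 0 0, F8 0 0 1, F8 0 1 0, F8 0 1 1, F8 1 0 0, F8 1 0 1, F8 1 1 0, F8 1 1 1}"]
  by blast

instance f8 :: finite
  by standard (simp add: UNIV_f8)

lemma card_f8: "card (UNIV :: f8 set) = 8"
  by (simp add: UNIV_f8)

lemma f8_add_self [simp]: "a + a = (0 :: f8)"
  by (cases a) (simp add: zero_f8_def)

lemma f8_add_self_left [simp]: "a + (a + b) = (b :: f8)"
  by (simp add: add.assoc[symmetric])

lemma f8_minus [simp]: "- a = a" "a - b = a + (b :: f8)"
proof -
  show "- a = a" for a :: f8 by (rule minus_unique) simp
  then show "a - b = a + b" by (simp only: diff_conv_add_uminus)
qed

lemma f8_add_eq_0_iff: "a + b = 0 \<longleftrightarrow> a = (b :: f8)"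
  by (metis f8_add_self f8_add_self_left add_0_right)

text \<open>Squaring is linear over the prime field and sends \<tau>^2 to \<tau>^4 = \<tau> +
  \<tau>^2. In this form powers are evaluated by adding bits.\<close>

lemma f8_power2_eq: "F8 x y z ^ 2 = F8 x z (y + z)"
  by (cases x; cases y; cases z) (simp_all add: power2_eq_square)

lemma f8_power4_eq: "F8 x y z ^ 4 = F8 x (y + z) y"
proof -
  have "F8 x y z ^ 4 = (F8 x y z ^ 2) ^ 2" by (simp flip: power_mult)
  also have "\<dots> = F8 x (y + z) y" unfolding f8_power2_eq by (cases y; cases z) simp_all
  finally show ?thesis .
qed

lemma f8_power8 [simp]: "a ^ 8 = (a :: f8)"
proof (cases a)
  case (F8 x y z)
  have "F8 x y z ^ 8 = (F8 x y z ^ 4) ^ 2" by (simp flip: power_mult)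
  also have "\<dots> = F8 x y z" unfolding f8_power2_eq f8_power4_eq by (cases y; cases z) simp_all
  finally show ?thesis unfolding F8 .
qed

lemma f8_power7: "a \<noteq> 0 \<Longrightarrow> a ^ 7 = (1 :: f8)"
proof (cases a)
  case (F8 x y z)
  have "F8 x y z ^ 7 = F8 x y z ^ 4 * (F8 x y z ^ 2 * F8 x y z)"
    by (simp flip: power_add power_Suc2)
  also have "\<dots> = F8 x (y + z) y * (F8 x z (y + z) * F8 x y z)"
    unfolding f8_power2_eq f8_power4_eq ..
  finally show "a \<noteq> 0 \<Longrightarrow> a ^ 7 = 1"
    unfolding F8 by (cases x; cases y; cases z) (simp_all add: zero_f8_def one_f8_def)
qed

instance f8 :: idom
proof
  fix a b :: f8
  assume "a \<noteq> 0" "b \<noteq> 0"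
  then have "(a * b) ^ 7 = 1" by (subst power_mult_distrib) (simp add: f8_power7)
  then show "a * b \<noteq> 0" by auto
qed

lemma f8_add_power2: "(a + b) ^ 2 = a ^ 2 + (b :: f8) ^ 2"
  by (simp add: power2_eq_square algebra_simps)

lemma f8_add_power4: "(a + b) ^ 4 = a ^ 4 + (b :: f8) ^ 4"
proof -
  have "((a + b) ^ 2) ^ 2 = (a ^ 2) ^ 2 + (b ^ 2) ^ 2" by (simp add: f8_add_power2)
  then show ?thesis by (simp flip: power_mult)
qed

section \<open>The trace to the prime field\<close>

definition f8_trace :: "f8 \<Rightarrow> f8" where
  "f8_trace a = a + a ^ 2 + a ^ 4"

lemma f8_trace_eq: "f8_trace (F8 x y z) = F8 x 0 0"
  unfolding f8_trace_def f8_power2_eq f8_power4_eq by (cases y; cases z) simp_all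

lemma f8_trace_add: "f8_trace (a + b) = f8_trace a + f8_trace b"
  by (simp add: f8_trace_def f8_add_power2 f8_add_power4 algebra_simps)

lemma f8_trace_0 [simp]: "f8_trace 0 = 0" and f8_trace_1 [simp]: "f8_trace 1 = 1"
  by (simp_all add: f8_trace_def)

lemma f8_trace_power2 [simp]: "f8_trace (a ^ 2) = f8_trace a"
  by (cases a) (simp add: f8_trace_eq f8_power2_eq)

lemma f8_trace_power4 [simp]: "f8_trace (a ^ 4) = f8_trace a"
  by (cases a) (simp add: f8_trace_eq f8_power4_eq)

text \<open>An explicit instance of additive Hilbert 90: it exhibits each element of trace 0 as a
  difference between an element and its image under the Frobenius map, which is what fills X with
  commutators.\<close>

lemma f8_half_trace:
  assumes "f8_trace a = 0"
  shows "(a + a ^ 4) + (a + a ^ 4) ^ 2 = a"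
proof -
  have "(a + a ^ 4) ^ 2 = a ^ 2 + a ^ 8" by (simp add: f8_add_power2 flip: power_mult)
  then have "(a + a ^ 4) + (a + a ^ 4) ^ 2 = a ^ 4 + a ^ 2" by (simp add: algebra_simps)
  also have "\<dots> = a" using assms by (simp add: f8_trace_def f8_add_eq_0_iff add_ac)
  finally show ?thesis .
qed

text \<open>The kernel of the trace has three nonzero elements, none of them fixed by the Frobenius
  map, so they form one orbit of a group of order 3.\<close>

lemma f8_trace_0_orbit:
  assumes "f8_trace a = 0" "a \<noteq> 0" "f8_trace b = 0" "b \<noteq> 0"
  shows "b = a \<or> b = a ^ 2 \<or> b = a ^ 4"
  using assms
  by (cases a; cases b) (auto simp: f8_trace_eq f8_power2_eq f8_power4_eq zero_f8_def)

text \<open>For nonzero \<open>a\<close> the quotient of \<open>e\<close> by \<open>a\<close> would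
  have order 3 in a group of order 7. The proof simply inspects all 64 pairs.\<close>

lemma f8_no_cube_root_of_unity:
  assumes "e ^ 2 + e * a + a ^ 2 = (0 :: f8)"
  shows "a = 0"
proof -
  have "\<forall>a e :: f8. e ^ 2 + e * a + a ^ 2 = 0 \<longrightarrow> a = 0"
    by (simp add: f8_all f8_power2_eq zero_f8_def)
  then show ?thesis using assms by blast
qed

section \<open>Comparison of an arbitrary field of order 8 with the model \<open>f8\<close>\<close>

locale f8_iso = field F for F :: "('a, 'm) ring_scheme" (structure) +
  fixes \<iota> :: "f8 \<Rightarrow> 'a"
  assumes bij_iota: "bij_betw \<iota> UNIV (carrier F)"
    and iota_add: "\<iota> (a + b) = \<iota> a \<oplus> \<iota> b"
    and iota_mult: "\<iota> (a * b) = \<iota> a \<otimes> \<iota> b"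
    and iota_1: "\<iota> 1 = \<one>"
begin

lemma iota_closed [simp, intro]: "\<iota> a \<in> carrier F"
  using bij_iota by (auto simp: bij_betw_def)

lemma iota_eq_iff [simp]: "\<iota> a = \<iota> b \<longleftrightarrow> a = b"
  using bij_iota by (auto simp: bij_betw_def inj_def)

lemma carrier_eq_range: "carrier F = range \<iota>"
  using bij_iota by (auto simp: bij_betw_def)

lemma iota_0: "\<iota> 0 = \<zero>"
proof -
  have "\<iota> 0 \<oplus> \<iota> 0 = \<iota> 0" by (simp flip: iota_add)
  then show ?thesis by (simp add: add.l_cancel_one)
qed

lemma iota_pow: "\<iota> (a ^ n) = \<iota> a [^] n"
  by (induction n) (simp_all add: iota_1 iota_mult m_comm)

lemma iota_sum: "finite A \<Longrightarrow> \<iota> (sum f A) = (\<Oplus>i\<in>A. \<iota> (f i))"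
  by (induction A rule: finite_induct) (simp_all add: iota_0 iota_add Pi_def)

end

context field
begin

text \<open>The additive group has order 8, and 8 times the unit is the cube of
  \<open>\<one> \<oplus> \<one>\<close>, which therefore vanishes in a field.\<close>

lemma add_self_0:
  assumes "card (carrier R) = 8" and a: "a \<in> carrier R"
  shows "a \<oplus> a = \<zero>"
proof -
  have "add_pow R (8 :: nat) \<one> = \<zero>"
    using add.pow_order_eq_1[OF one_closed] assms(1) by (simp add: add_pow_def Coset.order_def)
  moreover have "add_pow R (8 :: nat) \<one> = (\<one> \<oplus> \<one>) \<otimes> ((\<one> \<oplus> \<one>) \<otimes> (\<one> \<oplus> \<one>))"
    by (simp add: numeral_eq_Suc l_distr r_distr a_assoc)
  ultimately have "\<one> \<oplus> \<one> = \<zero>"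
    using integral[of "\<one> \<oplus> \<one>" "(\<one> \<oplus> \<one>) \<otimes> (\<one> \<oplus> \<one>)"] integral[of "\<one> \<oplus> \<one>" "\<one> \<oplus> \<one>"] by auto
  then have "(\<one> \<oplus> \<one>) \<otimes> a = \<zero>" using a by simp
  then show ?thesis using a by (simp add: l_distr)
qed

text \<open>
  The trace of an element \<open>a\<close> outside of the prime field is 0 or 1, whence that of \<open>a\<close> or of \<open>a + 1\<close>
  is 0; and \<open>b + b\<^sup>2 + b\<^sup>4 = b (b\<^sup>3 + b + 1)\<close>.
\<close>

lemma exists_primitive_root:
  assumes card: "card (carrier R) = 8"
  obtains b where "b \<in> carrier R" "b \<otimes> b \<otimes> b = b \<oplus> \<one>"
proof -
  note char2 = add_self_0[OF card]
  have add0: "x = y" if "x \<oplus> y = \<zero>" "x \<in> carrier R" "y \<in> carrier R" for x y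
  proof -
    have "x = x \<oplus> (y \<oplus> y)" using that char2[of y] by simp
    also have "\<dots> = (x \<oplus> y) \<oplus> y" by (rule a_assoc[symmetric]) (use that in auto)
    finally show ?thesis using that by simp
  qed
  have "card {\<zero>, \<one>} < card (carrier R)" using card by (simp add: card_insert_if)
  then have "\<not> carrier R \<subseteq> {\<zero>, \<one>}" by (meson card_mono finite.intros linorder_not_le)
  then obtain a where a: "a \<in> carrier R" "a \<noteq> \<zero>" "a \<noteq> \<one>" by blast
  interpret U: group "units_of R" by (rule units_group)
  have "a \<in> Units R" using a by (simp add: field_Units)
  moreover have "finite (carrier R)" by (rule card_ge_0_finite) (simp add: card)
  then have "Coset.order (units_of R) = 7"
    using card by (simp add: Coset.order_def units_of_carrier field_Units)
  ultimately have "a [^]\<^bsub>units_of R\<^esub> (7 :: nat) = \<one>"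
    using U.pow_order_eq_1[of a] by (simp add: units_of_carrier units_of_one)
  then have a7: "a [^] (7 :: nat) = \<one>"
    using units_of_pow[OF \<open>a \<in> Units R\<close>] by simp
  have sq_add: "(x \<oplus> y) \<otimes> (x \<oplus> y) = x \<otimes> x \<oplus> y \<otimes> y" if "x \<in> carrier R" "y \<in> carrier R" for x y
  proof -
    have "(x \<oplus> y) \<otimes> (x \<oplus> y) = x \<otimes> x \<oplus> y \<otimes> y \<oplus> (x \<otimes> y \<oplus> x \<otimes> y)"
      using that by Ring.algebra
    then show ?thesis using that char2[of "x \<otimes> y"] by simp
  qed
  have root: "t \<otimes> t \<otimes> t = t \<oplus> \<one>"
    if t: "t \<in> carrier R" "t \<noteq> \<zero>" "t \<oplus> t \<otimes> t \<oplus> (t \<otimes> t) \<otimes> (t \<otimes> t) = \<zero>" for t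
  proof -
    have "t \<otimes> (t \<otimes> t \<otimes> t \<oplus> (t \<oplus> \<one>)) = t \<oplus> t \<otimes> t \<oplus> (t \<otimes> t) \<otimes> (t \<otimes> t)"
      using t(1) by Ring.algebra
    also note t(3)
    finally have "t = \<zero> \<or> t \<otimes> t \<otimes> t \<oplus> (t \<oplus> \<one>) = \<zero>"
      by (rule integral) (use t(1) in simp_all)
    then have "t \<otimes> t \<otimes> t \<oplus> (t \<oplus> \<one>) = \<zero>" using t(2) by blast
    then show ?thesis by (rule add0) (use t(1) in simp_all)
  qed
  define a2 where "a2 = a \<otimes> a"
  define a4 where "a4 = a2 \<otimes> a2"
  define s where "s = a \<oplus> a2 \<oplus> a4"
  have c: "a2 \<in> carrier R" "a4 \<in> carrier R" "s \<in> carrier R" using a by (simp_all add: a2_def a4_def s_def)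
  have "a4 \<otimes> a4 = a \<otimes> (a [^] (7 :: nat))"
    unfolding a4_def a2_def using a(1) by (simp add: numeral_eq_Suc m_assoc)
  then have a8: "a4 \<otimes> a4 = a" using a7 a by simp
  have "s \<otimes> s = a2 \<oplus> a4 \<oplus> a"
    using sq_add[of "a \<oplus> a2" a4] sq_add[of a a2] a(1) c a8 by (simp add: s_def flip: a2_def a4_def)
  then have "s \<otimes> s = s" using a(1) c by (simp add: s_def a_ac)
  then have "s \<otimes> (s \<oplus> \<one>) = \<zero>" using c char2[of s] by (simp add: r_distr)
  then consider "s = \<zero>" | "s = \<one>"
    using integral[of s "s \<oplus> \<one>"] add0[of s \<one>] c by auto
  then show ?thesis
  proof cases
    case 1
    then have "a \<otimes> a \<otimes> a = a \<oplus> \<one>" using a by (intro root) (simp_all add: s_def a4_def a2_def)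
    then show ?thesis using that a by blast
  next
    case 2
    let ?b = "a \<oplus> \<one>"
    have "?b \<otimes> ?b = a2 \<oplus> \<one>" using sq_add[of a \<one>] a by (simp add: a2_def)
    moreover have "(a2 \<oplus> \<one>) \<otimes> (a2 \<oplus> \<one>) = a4 \<oplus> \<one>" using sq_add[of a2 \<one>] c by (simp add: a4_def)
    moreover have "(a \<oplus> \<one>) \<oplus> (a2 \<oplus> \<one>) \<oplus> (a4 \<oplus> \<one>) = s \<oplus> \<one> \<oplus> (\<one> \<oplus> \<one>)"
      unfolding s_def using a(1) c by Ring.algebra
    ultimately have "?b \<oplus> ?b \<otimes> ?b \<oplus> (?b \<otimes> ?b) \<otimes> (?b \<otimes> ?b) = \<zero>"
      using 2 char2[of \<one>] by simp
    moreover have "?b \<noteq> \<zero>" using add0[of a \<one>] a by auto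
    ultimately have "?b \<otimes> ?b \<otimes> ?b = ?b \<oplus> \<one>" using a by (intro root) auto
    then show ?thesis using that[of ?b] a by simp
  qed
qed

text \<open>The map sends \<tau> to a root of the same cubic. Multiplicativity is verified only for
  constants and for \<tau>; it spreads to all elements because the factors \<open>q\<close> that
  satisfy \<open>?M\<close> are closed under sums and products.\<close>

lemma exists_f8_iso:
  assumes card: "card (carrier R) = 8"
  shows "\<exists>\<iota>. f8_iso R \<iota>"
proof -
  note char2 = add_self_0[OF card]
  obtain b where b: "b \<in> carrier R" "b \<otimes> b \<otimes> b = b \<oplus> \<one>" using exists_primitive_root[OF card] .
  define \<beta> where "\<beta> x = (if x = (1 :: bit) then \<one> else \<zero>)" for x
  define \<iota> where "\<iota> a = (case a of F8 x y z \<Rightarrow> \<beta> x \<oplus> (\<beta> y \<otimes> b \<oplus> \<beta> z \<otimes> (b \<otimes> b)))" for a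
  have \<beta>c: "\<beta> x \<in> carrier R" for x by (simp add: \<beta>_def)
  have \<iota>c: "\<iota> a \<in> carrier R" for a using b \<beta>c by (cases a) (simp add: \<iota>_def)
  have \<beta>_add: "\<beta> (x + y) = \<beta> x \<oplus> \<beta> y" for x y
    using char2[OF one_closed] by (cases x; cases y) (simp_all add: \<beta>_def)
  have add: "\<iota> (p + q) = \<iota> p \<oplus> \<iota> q" for p q
  proof (cases p; cases q)
    fix x y z x' y' z' assume pq: "p = F8 x y z" "q = F8 x' y' z'"
    show ?thesis
      unfolding pq plus_f8.simps \<iota>_def f8.case \<beta>_add
      using b \<beta>c[of x] \<beta>c[of y] \<beta>c[of z] \<beta>c[of x'] \<beta>c[of y'] \<beta>c[of z'] by Ring.algebra
  qed
  have \<iota>0: "\<iota> 0 = \<zero>" and \<iota>1: "\<iota> 1 = \<one>" using b by (simp_all add: \<iota>_def \<beta>_def zero_f8_def one_f8_def)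
  let ?M = "\<lambda>q. \<forall>p. \<iota> (p * q) = \<iota> p \<otimes> \<iota> q"
  have M_add: "?M (q + r)" if "?M q" "?M r" for q r
    using that \<iota>c by (simp add: distrib_left add r_distr)
  have M_mult: "?M (q * r)" if "?M q" "?M r" for q r
    using that \<iota>c by (simp add: mult.assoc[symmetric] m_assoc)
  have M_const: "?M (F8 x 0 0)" for x
    using \<iota>c \<iota>0 \<iota>1 by (cases x) (simp_all flip: zero_f8_def one_f8_def)
  let ?\<tau> = "F8 0 1 0"
  have M_gen: "?M ?\<tau>"
  proof
    fix p
    obtain x y z where p: "p = F8 x y z" by (cases p)
    have "p * ?\<tau> = F8 z (x + z) y" unfolding p by (cases x; cases y; cases z) simp_all
    then have "\<iota> (p * ?\<tau>) = \<beta> z \<oplus> ((\<beta> x \<oplus> \<beta> z) \<otimes> b \<oplus> \<beta> y \<otimes> (b \<otimes> b))"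
      by (simp only: \<iota>_def f8.case \<beta>_add)
    also have "\<dots> = \<beta> x \<otimes> b \<oplus> (\<beta> y \<otimes> (b \<otimes> b) \<oplus> \<beta> z \<otimes> (b \<oplus> \<one>))"
      using b(1) \<beta>c[of x] \<beta>c[of y] \<beta>c[of z] by Ring.algebra
    also have "\<dots> = \<iota> p \<otimes> b"
      unfolding p \<iota>_def f8.case b(2)[symmetric] using b(1) \<beta>c[of x] \<beta>c[of y] \<beta>c[of z] by Ring.algebra
    also have "b = \<iota> ?\<tau>" using b(1) by (simp add: \<iota>_def \<beta>_def)
    finally show "\<iota> (p * ?\<tau>) = \<iota> p \<otimes> \<iota> ?\<tau>" .
  qed
  have mult: "\<iota> (p * q) = \<iota> p \<otimes> \<iota> q" for p q
  proof -
    obtain x y z where q: "q = F8 x y z" by (cases q)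
    have q': "q = F8 x 0 0 + (F8 y 0 0 * ?\<tau> + F8 z 0 0 * (?\<tau> * ?\<tau>))"
      unfolding q by (cases x; cases y; cases z) simp_all
    have "?M q"
      unfolding q' by (intro M_add M_mult M_const M_gen)
    then show ?thesis by blast
  qed
  \<comment> \<open>A nonzero \<open>r\<close> has the inverse \<open>r ^ 6\<close> in the model, so
    its image cannot be zero. Surjectivity then follows by counting.\<close>
  have ker: "r = 0" if "\<iota> r = \<zero>" for r
  proof (rule ccontr)
    assume "r \<noteq> 0"
    then have "r * r ^ 6 = 1" using f8_power7[of r] by (simp flip: power_Suc)
    then show False using mult[of r "r ^ 6"] that \<iota>1 \<iota>c by simp
  qed
  have "p = q" if "\<iota> p = \<iota> q" for p q
  proof -
    have "\<iota> (p + q) = \<zero>" using char2[OF \<iota>c[of q]] by (simp only: add that)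
    then show ?thesis using ker f8_add_eq_0_iff by blast
  qed
  then have inj: "inj \<iota>" by (auto simp: inj_def)
  have "finite (carrier R)" by (rule card_ge_0_finite) (simp add: card)
  then have "\<iota> ` UNIV = carrier R"
    using \<iota>c card card_image[OF inj] card_f8 by (intro card_subset_eq) auto
  then have "bij_betw \<iota> UNIV (carrier R)" using inj by (simp add: bij_betw_def)
  then have "f8_iso R \<iota>"
    using add mult \<iota>1 by (simp add: f8_iso_def f8_iso_axioms_def field_axioms)
  then show ?thesis by blast
qed

end


section \<open>The truncated skew polynomial ring over \<open>\<bbbF>\<^sub>8\<close>\<close>

definition fin_supp :: "(nat \<Rightarrow> 'b::zero) \<Rightarrow> bool" where
  "fin_supp p \<longleftrightarrow> (\<exists>n. \<forall>m>n. p m = 0)"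

definition skew_mult :: "(nat \<Rightarrow> f8) \<Rightarrow> (nat \<Rightarrow> f8) \<Rightarrow> nat \<Rightarrow> f8" where
  "skew_mult p q n = (\<Sum>i\<le>n. p i * q (n - i) ^ (2 ^ i))"

text \<open>The coefficient sequence of the monomial X^k.\<close>

definition delta :: "nat \<Rightarrow> nat \<Rightarrow> f8" where
  "delta k n = (if n = k then 1 else 0)"

lemma f8_add_power_2_power: "(a + b) ^ (2 ^ i) = a ^ (2 ^ i) + (b :: f8) ^ (2 ^ i)"
proof (induction i)
  case (Suc i)
  have "(a + b) ^ (2 ^ Suc i) = ((a + b) ^ (2 ^ i)) ^ 2" by (simp only: power_Suc2 power_mult)
  also have "\<dots> = (a ^ (2 ^ i)) ^ 2 + (b ^ (2 ^ i)) ^ 2" unfolding Suc.IH by (rule f8_add_power2)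
  finally show ?case by (simp only: power_Suc2 power_mult)
qed simp

lemma f8_sum_power_2_power: "finite A \<Longrightarrow> (\<Sum>x\<in>A. f x :: f8) ^ (2 ^ i) = (\<Sum>x\<in>A. f x ^ (2 ^ i))"
  by (induction A rule: finite_induct) (simp_all add: f8_add_power_2_power)

lemma delta_power: "delta k n ^ (2 ^ i) = delta k n"
  by (simp add: delta_def)

lemma fin_supp_skew_mult:
  assumes "fin_supp p" "fin_supp q"
  shows "fin_supp (skew_mult p q)"
proof -
  obtain k l where k: "\<And>m. m > k \<Longrightarrow> p m = 0" and l: "\<And>m. m > l \<Longrightarrow> q m = 0"
    using assms by (auto simp: fin_supp_def)
  have "skew_mult p q m = 0" if "m > k + l" for m
    unfolding skew_mult_def
  proof (rule sum.neutral, intro ballI)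
    fix i assume "i \<in> {..m}"
    then have "i > k \<or> m - i > l" using that by auto
    then show "p i * q (m - i) ^ (2 ^ i) = 0" using k l by auto
  qed
  then show ?thesis by (auto simp: fin_supp_def)
qed

lemma fin_supp_add: "fin_supp p \<Longrightarrow> fin_supp q \<Longrightarrow> fin_supp (\<lambda>n. p n + q n :: f8)"
  by (auto simp: fin_supp_def) (metis add_0_right max_less_iff_conj)

lemma fin_supp_delta: "fin_supp (delta k)"
  by (auto simp: fin_supp_def delta_def)

text \<open>Both sides are the sum of \<open>?f j k l\<close> over \<open>j + k + l = n\<close>: the
  outer twist passes through the inner sum, and its exponent adds to that of the inner
  twist.\<close>

lemma skew_mult_assoc: "skew_mult (skew_mult p q) r = skew_mult p (skew_mult q r)"
proof
  fix n
  let ?f = "\<lambda>j k l. p j * q k ^ (2 ^ j) * r l ^ (2 ^ (j + k))"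
  have "skew_mult (skew_mult p q) r n = (\<Sum>i=0..n. \<Sum>j=0..i. ?f j (i - j) (n - i))"
    by (simp add: skew_mult_def sum_distrib_right atLeast0AtMost)
  \<comment> \<open>This reindexing of a triangle of pairs, known from formal power series, holds
    for any summand.\<close>
  also have "\<dots> = (\<Sum>j=0..n. \<Sum>k=0..n - j. ?f j k (n - j - k))"
    by (rule fps_mult_assoc_lemma)
  also have "\<dots> = skew_mult p (skew_mult q r) n"
    unfolding skew_mult_def atLeast0AtMost
  proof (rule sum.cong[OF refl])
    fix j
    show "(\<Sum>k\<le>n - j. ?f j k (n - j - k)) = p j * (\<Sum>k\<le>n - j. q k * r (n - j - k) ^ (2 ^ k)) ^ (2 ^ j)"
      by (simp add: f8_sum_power_2_power sum_distrib_left power_mult_distrib power_add mult.assoc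
          mult.commute[of "2 ^ j"] flip: power_mult)
  qed
  finally show "skew_mult (skew_mult p q) r n = skew_mult p (skew_mult q r) n" .
qed

lemma skew_mult_delta_right: "skew_mult p (delta k) n = (if k \<le> n then p (n - k) else 0)"
proof -
  have "skew_mult p (delta k) n = (\<Sum>i\<le>n. if i = n - k \<and> k \<le> n then p i else 0)"
    unfolding skew_mult_def delta_power by (intro sum.cong) (auto simp: delta_def)
  then show ?thesis by (cases "k \<le> n") simp_all
qed

lemma skew_mult_one_left: "skew_mult (delta 0) p = p"
proof
  fix n
  have "skew_mult (delta 0) p n = (\<Sum>i\<le>n. if i = 0 then p n else 0)"
    unfolding skew_mult_def by (intro sum.cong) (auto simp: delta_def)
  then show "skew_mult (delta 0) p n = p n" by simp
qed

lemma skew_mult_one_right: "skew_mult p (delta 0) = p"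
  by (rule ext) (simp add: skew_mult_delta_right)

lemma skew_mult_delta: "skew_mult (delta k) (delta l) = delta (k + l)"
  by (rule ext) (auto simp: skew_mult_delta_right delta_def)

text \<open>This is why multiplication descends modulo X^5, and why cosets may be represented by
  sequences of infinite support.\<close>

lemma skew_mult_cong:
  assumes "\<And>n. n < N \<Longrightarrow> p n = p' n" "\<And>n. n < N \<Longrightarrow> q n = q' n" "n < N"
  shows "skew_mult p q n = skew_mult p' q' n"
  unfolding skew_mult_def using assms by (intro sum.cong) auto

context f8_iso
begin

section \<open>Coefficient sequences for the skew polynomial ring and its quotient\<close>

abbreviation "S \<equiv> skew_poly_ring F"
abbreviation "I5 \<equiv> X_pow5_ideal F"
abbreviation "R5 \<equiv> R_ring F"

definition pol :: "(nat \<Rightarrow> f8) \<Rightarrow> nat \<Rightarrow> 'a" where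
  "pol p = (\<lambda>n. \<iota> (p n))"

lemma pol_eq_iff [simp]: "pol p = pol q \<longleftrightarrow> p = q"
  by (auto simp: pol_def fun_eq_iff)

lemma pol_in_up: "fin_supp p \<Longrightarrow> pol p \<in> up F"
proof -
  assume "fin_supp p"
  then obtain n where "\<forall>m>n. p m = 0" by (auto simp: fin_supp_def)
  then have "bound \<zero> n (pol p)" by (auto simp: bound_def pol_def iota_0)
  then show ?thesis by (auto simp: up_def pol_def)
qed

lemma up_cases:
  assumes "f \<in> up F" obtains p where "f = pol p" "fin_supp p"
proof -
  have f: "f n \<in> carrier F" for n using assms by (auto simp: up_def)
  obtain N where N: "bound \<zero> N f" using assms by (auto simp: up_def)
  define p where "p n = inv_into UNIV \<iota> (f n)" for n
  have p: "\<iota> (p n) = f n" for n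
    unfolding p_def using f[of n] carrier_eq_range by (simp add: f_inv_into_f)
  then have "f = pol p" by (auto simp: pol_def)
  moreover have "p m = 0" if "m > N" for m
    using N that p[of m] iota_eq_iff[of "p m" 0] iota_0 by (auto simp: bound_def)
  then have "fin_supp p" by (auto simp: fin_supp_def)
  ultimately show ?thesis by (rule that)
qed

lemma S_carrier: "carrier S = {pol p | p. fin_supp p}"
  by (auto simp: skew_poly_ring_def skew_UP_def UP_def intro: pol_in_up elim: up_cases)

lemma iota_frobenius_pow: "((\<lambda>\<alpha>. \<alpha> [^] (2 :: nat)) ^^ i) (\<iota> a) = \<iota> (a ^ (2 ^ i))"
  by (induction i) (simp_all add: iota_pow[symmetric] power_mult[symmetric] mult.commute)

lemma S_mult: "fin_supp p \<Longrightarrow> fin_supp q \<Longrightarrow> pol p \<otimes>\<^bsub>S\<^esub> pol q = pol (skew_mult p q)"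
  by (auto simp: skew_poly_ring_def skew_UP_def pol_in_up fun_eq_iff)
    (auto simp: pol_def skew_mult_def iota_sum iota_mult iota_frobenius_pow)

lemma S_add: "fin_supp p \<Longrightarrow> fin_supp q \<Longrightarrow> pol p \<oplus>\<^bsub>S\<^esub> pol q = pol (\<lambda>n. p n + q n)"
  by (simp add: skew_poly_ring_def skew_UP_def UP_def pol_in_up) (simp add: pol_def iota_add)

lemma S_one: "\<one>\<^bsub>S\<^esub> = pol (delta 0)"
  by (auto simp: skew_poly_ring_def skew_UP_def UP_def pol_def delta_def iota_0 iota_1)

lemma S_zero: "\<zero>\<^bsub>S\<^esub> = pol (\<lambda>n. 0)"
  by (auto simp: skew_poly_ring_def skew_UP_def UP_def pol_def iota_0)

lemma S_monom: "up_ring.monom S (\<iota> a) k = pol (\<lambda>n. if n = k then a else 0)"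
  by (auto simp: skew_poly_ring_def skew_UP_def UP_def pol_def iota_0)

lemma fin_supp_zero: "fin_supp (\<lambda>n. 0)"
  by (simp add: fin_supp_def)

lemma fin_supp_monom: "fin_supp (\<lambda>n. if n = k then a else 0)"
  by (auto simp: fin_supp_def)

lemma S_cases: "x \<in> carrier S \<Longrightarrow> (\<And>p. x = pol p \<Longrightarrow> fin_supp p \<Longrightarrow> thesis) \<Longrightarrow> thesis"
  by (auto simp: S_carrier)

lemma pol_closed: "fin_supp p \<Longrightarrow> pol p \<in> carrier S"
  by (auto simp: S_carrier)

lemma ring_S: "ring S"
proof (rule ringI)
  show "abelian_group S"
  proof (rule abelian_groupI)
    fix x y assume "x \<in> carrier S" "y \<in> carrier S"
    then show "x \<oplus>\<^bsub>S\<^esub> y \<in> carrier S" "x \<oplus>\<^bsub>S\<^esub> y = y \<oplus>\<^bsub>S\<^esub> x"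
      by (auto elim!: S_cases simp: S_add fin_supp_add add.commute intro!: pol_closed)
  next
    fix x y z assume "x \<in> carrier S" "y \<in> carrier S" "z \<in> carrier S"
    then show "x \<oplus>\<^bsub>S\<^esub> y \<oplus>\<^bsub>S\<^esub> z = x \<oplus>\<^bsub>S\<^esub> (y \<oplus>\<^bsub>S\<^esub> z)"
      by (auto elim!: S_cases simp: S_add fin_supp_add add.assoc)
  next
    fix x assume "x \<in> carrier S"
    then show "\<zero>\<^bsub>S\<^esub> \<oplus>\<^bsub>S\<^esub> x = x" "\<exists>y\<in>carrier S. y \<oplus>\<^bsub>S\<^esub> x = \<zero>\<^bsub>S\<^esub>"
      by (auto elim!: S_cases simp: S_add S_zero fin_supp_zero intro!: bexI[of _ x] pol_closed)
  qed (simp add: S_zero fin_supp_zero pol_closed)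
  show "Group.monoid S"
  proof (rule monoidI)
    fix x y assume "x \<in> carrier S" "y \<in> carrier S"
    then show "x \<otimes>\<^bsub>S\<^esub> y \<in> carrier S"
      by (auto elim!: S_cases simp: S_mult fin_supp_skew_mult intro!: pol_closed)
  next
    fix x y z assume "x \<in> carrier S" "y \<in> carrier S" "z \<in> carrier S"
    then show "x \<otimes>\<^bsub>S\<^esub> y \<otimes>\<^bsub>S\<^esub> z = x \<otimes>\<^bsub>S\<^esub> (y \<otimes>\<^bsub>S\<^esub> z)"
      by (auto elim!: S_cases simp: S_mult fin_supp_skew_mult skew_mult_assoc)
  next
    fix x assume "x \<in> carrier S"
    then show "\<one>\<^bsub>S\<^esub> \<otimes>\<^bsub>S\<^esub> x = x" "x \<otimes>\<^bsub>S\<^esub> \<one>\<^bsub>S\<^esub> = x"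
      by (auto elim!: S_cases simp: S_mult S_one fin_supp_delta skew_mult_one_left skew_mult_one_right)
  qed (simp add: S_one fin_supp_delta pol_closed)
  fix x y z assume "x \<in> carrier S" "y \<in> carrier S" "z \<in> carrier S"
  then show "(x \<oplus>\<^bsub>S\<^esub> y) \<otimes>\<^bsub>S\<^esub> z = x \<otimes>\<^bsub>S\<^esub> z \<oplus>\<^bsub>S\<^esub> y \<otimes>\<^bsub>S\<^esub> z"
    "z \<otimes>\<^bsub>S\<^esub> (x \<oplus>\<^bsub>S\<^esub> y) = z \<otimes>\<^bsub>S\<^esub> x \<oplus>\<^bsub>S\<^esub> z \<otimes>\<^bsub>S\<^esub> y"
    by (auto elim!: S_cases simp: S_mult S_add fin_supp_add fin_supp_skew_mult)
      (auto simp: skew_mult_def distrib_left distrib_right sum.distrib f8_add_power_2_power)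
qed

sublocale S: ring S by (rule ring_S)

lemma X_pow: "up_ring.monom S \<one> 1 [^]\<^bsub>S\<^esub> k = pol (delta k)"
proof (induction k)
  case (Suc k)
  have "up_ring.monom S \<one> 1 = pol (delta 1)"
    unfolding iota_1[symmetric] S_monom by (simp add: delta_def[abs_def])
  then show ?case using Suc by (simp add: S_mult fin_supp_delta skew_mult_delta)
qed (simp add: S_one)

text \<open>Twisting coefficients does not lower degrees, so the polynomials without terms of degree
  below 5 form a two-sided ideal; conversely each of them is a left multiple of X^5.\<close>

lemma X_pow5_ideal_eq: "I5 = {pol p | p. fin_supp p \<and> (\<forall>n<5. p n = 0)}" (is "_ = ?K")
proof
  have K: "?K \<subseteq> carrier S" by (auto simp: S_carrier)
  have "ideal ?K S"
  proof (rule idealI[OF ring_S])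
    show "subgroup ?K (add_monoid S)"
    proof (rule S.add.subgroupI)
      show "?K \<noteq> {}" using fin_supp_zero by blast
      show "\<ominus>\<^bsub>S\<^esub> x \<in> ?K" if "x \<in> ?K" for x
      proof -
        from that obtain p where p: "x = pol p" "fin_supp p" "\<forall>n<5. p n = 0" by blast
        then have "x \<oplus>\<^bsub>S\<^esub> x = \<zero>\<^bsub>S\<^esub>" by (simp add: S_add S_zero)
        then have "\<ominus>\<^bsub>S\<^esub> x = x" using that K by (intro S.minus_equality) auto
        then show ?thesis using that by simp
      qed
      show "x \<oplus>\<^bsub>S\<^esub> y \<in> ?K" if "x \<in> ?K" "y \<in> ?K" for x y
        using that by (auto simp: S_add intro!: fin_supp_add)
    qed (use K in auto)
    fix x y assume "x \<in> ?K" "y \<in> carrier S"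
    then obtain p q where pq: "x = pol p" "fin_supp p" "\<forall>n<5. p n = 0" "y = pol q" "fin_supp q"
      by (auto simp: S_carrier)
    have "skew_mult p q n = 0" "skew_mult q p n = 0" if "n < 5" for n
      using pq(3) that by (simp_all add: skew_mult_def)
    then show "y \<otimes>\<^bsub>S\<^esub> x \<in> ?K" "x \<otimes>\<^bsub>S\<^esub> y \<in> ?K"
      using pq by (auto simp: S_mult fin_supp_skew_mult)
  qed
  then show "I5 \<subseteq> ?K"
    unfolding X_pow5_ideal_def X_pow
    by (rule S.genideal_minimal) (auto simp: fin_supp_delta delta_def)
  show "?K \<subseteq> I5"
  proof
    fix x assume "x \<in> ?K"
    then obtain p where p: "x = pol p" "fin_supp p" "\<forall>n<5. p n = 0" by blast
    \<comment> \<open>Placed on the right, X^5 shifts the coefficients of \<open>q\<close> without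
      applying the Frobenius map to them.\<close>
    define q where "q n = p (n + 5)" for n
    have q: "fin_supp q"
      using p(2) by (auto simp: fin_supp_def q_def) (meson trans_less_add1)
    have "skew_mult q (delta 5) = p"
      using p(3) by (auto simp: skew_mult_delta_right q_def)
    then have "x = pol q \<otimes>\<^bsub>S\<^esub> pol (delta 5)" using q p by (simp add: S_mult fin_supp_delta)
    moreover have "pol (delta 5) \<in> I5"
      unfolding X_pow5_ideal_def X_pow by (rule S.genideal_self') (simp add: pol_closed fin_supp_delta)
    moreover have "ideal I5 S"
      unfolding X_pow5_ideal_def X_pow by (rule S.genideal_ideal) (simp add: pol_closed fin_supp_delta)
    ultimately show "x \<in> I5" using ideal.I_l_closed pol_closed[OF q] by metis
  qed
qed

lemma ideal_I5: "ideal I5 S"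
  unfolding X_pow5_ideal_def X_pow by (rule S.genideal_ideal) (simp add: pol_closed fin_supp_delta)

sublocale I5: ideal I5 S by (rule ideal_I5)

sublocale R5: ring R5 unfolding R_ring_def by (rule I5.quotient_is_ring)

text \<open>Only the first five coefficients of \<open>p\<close> enter, so \<open>p\<close> may be
  any sequence; \<open>trunc5\<close> supplies the polynomial whose coset this is.\<close>

definition cs :: "(nat \<Rightarrow> f8) \<Rightarrow> (nat \<Rightarrow> 'a) set" where
  "cs p = {pol q | q. fin_supp q \<and> (\<forall>n<5. q n = p n)}"

lemma coset_eq: "fin_supp p \<Longrightarrow> I5 +>\<^bsub>S\<^esub> pol p = cs p"
proof -
  assume p: "fin_supp p"
  have "pol q \<in> I5 +>\<^bsub>S\<^esub> pol p" if q: "fin_supp q" "\<forall>n<5. q n = p n" for q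
  proof -
    have s: "fin_supp (\<lambda>n. q n + p n)" using q(1) p by (rule fin_supp_add)
    have "pol q = pol (\<lambda>n. q n + p n) \<oplus>\<^bsub>S\<^esub> pol p" using s p by (simp add: S_add add.assoc)
    moreover have "pol (\<lambda>n. q n + p n) \<in> I5" using s q by (auto simp: X_pow5_ideal_eq)
    ultimately show ?thesis by (auto simp: a_r_coset_def r_coset_def)
  qed
  moreover have "x \<in> cs p" if "x \<in> I5 +>\<^bsub>S\<^esub> pol p" for x
    using that p by (auto simp: a_r_coset_def r_coset_def X_pow5_ideal_eq S_add cs_def fin_supp_add)
  ultimately show ?thesis by (auto simp: cs_def)
qed

definition trunc5 :: "(nat \<Rightarrow> f8) \<Rightarrow> nat \<Rightarrow> f8" where
  "trunc5 p n = (if n < 5 then p n else 0)"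

lemma fin_supp_trunc5: "fin_supp (trunc5 p)"
  by (auto simp: fin_supp_def trunc5_def intro: exI[of _ 5])

lemma cs_cong: "(\<And>n. n < 5 \<Longrightarrow> p n = q n) \<Longrightarrow> cs p = cs q"
  by (auto simp: cs_def)

lemma cs_trunc5: "cs (trunc5 p) = cs p"
  by (rule cs_cong) (simp add: trunc5_def)

lemma cs_eq_iff: "cs p = cs q \<longleftrightarrow> (\<forall>n<5. p n = q n)"
proof
  assume eq: "cs p = cs q"
  have "pol (trunc5 p) \<in> cs p" using fin_supp_trunc5 by (auto simp: cs_def trunc5_def)
  then have "pol (trunc5 p) \<in> cs q" using eq by simp
  then show "\<forall>n<5. p n = q n" by (auto simp: cs_def trunc5_def)
qed (rule cs_cong, simp)

lemma cs_eq_coset: "cs p = I5 +>\<^bsub>S\<^esub> pol (trunc5 p)"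
  by (simp add: coset_eq fin_supp_trunc5 cs_trunc5)

lemma R5_carrier: "carrier R5 = range cs"
proof -
  have "carrier R5 = {I5 +>\<^bsub>S\<^esub> x | x. x \<in> carrier S}"
    by (auto simp: R_ring_def FactRing_def A_RCOSETS_def RCOSETS_def a_r_coset_def)
  also have "\<dots> = range cs"
    by (auto simp: S_carrier coset_eq) (metis cs_eq_coset fin_supp_trunc5)
  finally show ?thesis .
qed

lemma R5_mult: "cs p \<otimes>\<^bsub>R5\<^esub> cs q = cs (skew_mult p q)"
proof -
  have "cs p \<otimes>\<^bsub>R5\<^esub> cs q = I5 +>\<^bsub>S\<^esub> (pol (trunc5 p) \<otimes>\<^bsub>S\<^esub> pol (trunc5 q))"
    unfolding cs_eq_coset R_ring_def FactRing_def
    by (simp add: I5.rcoset_mult_add pol_closed fin_supp_trunc5)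
  also have "\<dots> = cs (skew_mult (trunc5 p) (trunc5 q))"
    by (simp add: S_mult fin_supp_trunc5 fin_supp_skew_mult coset_eq)
  also have "\<dots> = cs (skew_mult p q)"
    by (rule cs_cong, rule skew_mult_cong[of 5]) (simp_all add: trunc5_def)
  finally show ?thesis .
qed

lemma R5_add: "cs p \<oplus>\<^bsub>R5\<^esub> cs q = cs (\<lambda>n. p n + q n)"
proof -
  have "cs p \<oplus>\<^bsub>R5\<^esub> cs q = I5 +>\<^bsub>S\<^esub> (pol (trunc5 p) \<oplus>\<^bsub>S\<^esub> pol (trunc5 q))"
    unfolding cs_eq_coset R_ring_def FactRing_def
    by (simp add: I5.a_rcos_sum pol_closed fin_supp_trunc5)
  also have "\<dots> = cs (\<lambda>n. trunc5 p n + trunc5 q n)"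
    by (simp add: S_add fin_supp_trunc5 fin_supp_add coset_eq)
  also have "\<dots> = cs (\<lambda>n. p n + q n)" by (rule cs_cong) (simp add: trunc5_def)
  finally show ?thesis .
qed

lemma R5_one: "\<one>\<^bsub>R5\<^esub> = cs (delta 0)"
  by (simp add: R_ring_def FactRing_def S_one coset_eq fin_supp_delta)

text \<open>The value \<open>e\<close> continues beyond degree 4, where \<open>cs\<close> ignores
  it.\<close>

definition el :: "f8 \<Rightarrow> f8 \<Rightarrow> f8 \<Rightarrow> f8 \<Rightarrow> f8 \<Rightarrow> (nat \<Rightarrow> 'a) set" where
  "el a b c d e = cs (\<lambda>n. if n = 0 then a else if n = 1 then b else if n = 2 then c else if n = 3 then d else e)"

lemma all_less_5: "(\<forall>n<5. P n) \<longleftrightarrow> P 0 \<and> P 1 \<and> P 2 \<and> P 3 \<and> P (4 :: nat)"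
  by (auto simp: numeral_eq_Suc All_less_Suc)

lemma cs_eq_el: "cs p = el (p 0) (p 1) (p 2) (p 3) (p 4)"
  unfolding el_def cs_eq_iff all_less_5 by simp

lemma el_eq_iff [simp]: "el a b c d e = el a' b' c' d' e' \<longleftrightarrow> a = a' \<and> b = b' \<and> c = c' \<and> d = d' \<and> e = e'"
  unfolding el_def cs_eq_iff all_less_5 by simp

lemma el_closed [simp, intro]: "el a b c d e \<in> carrier R5"
  by (simp add: R5_carrier el_def)

lemma R5_cases:
  assumes "x \<in> carrier R5" obtains a b c d e where "x = el a b c d e"
proof -
  obtain p where "x = cs p" using assms by (auto simp: R5_carrier)
  then show ?thesis using that by (simp only: cs_eq_el)
qed

lemma el_add: "el a b c d e \<oplus>\<^bsub>R5\<^esub> el a' b' c' d' e' = el (a + a') (b + b') (c + c') (d + d') (e + e')"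
  unfolding el_def[of a b c d e] el_def[of a' b' c' d' e'] R5_add by (simp add: cs_eq_el)

lemma atMost_less_5: "{..1::nat} = {0, 1}" "{..2::nat} = {0, 1, 2}" "{..3::nat} = {0, 1, 2, 3}"
  "{..4::nat} = {0, 1, 2, 3, 4}"
  by (simp_all add: numeral_eq_Suc atMost_Suc insert_commute)

lemma f8_power16 [simp]: "a ^ 16 = (a :: f8) ^ 2"
proof -
  have "a ^ 16 = (a ^ 8) ^ 2" by (simp only: power_mult[symmetric]) simp
  then show ?thesis by simp
qed

text \<open>The twists by 2^3 = 8 and 2^4 = 16 appear as the exponents 1 and 2 because
  \<open>a ^ 8 = a\<close>.\<close>

lemma skew_mult_low_degree:
  "skew_mult p q 0 = p 0 * q 0"
  "skew_mult p q 1 = p 0 * q 1 + p 1 * q 0 ^ 2"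
  "skew_mult p q 2 = p 0 * q 2 + p 1 * q 1 ^ 2 + p 2 * q 0 ^ 4"
  "skew_mult p q 3 = p 0 * q 3 + p 1 * q 2 ^ 2 + p 2 * q 1 ^ 4 + p 3 * q 0"
  "skew_mult p q 4 = p 0 * q 4 + p 1 * q 3 ^ 2 + p 2 * q 2 ^ 4 + p 3 * q 1 + p 4 * q 0 ^ 2"
  unfolding skew_mult_def atMost_less_5 atMost_0 by (simp_all add: add.assoc)

lemma el_mult: "el a b c d e \<otimes>\<^bsub>R5\<^esub> el a' b' c' d' e' =
  el (a * a') (a * b' + b * a' ^ 2) (a * c' + b * b' ^ 2 + c * a' ^ 4)
    (a * d' + b * c' ^ 2 + c * b' ^ 4 + d * a')
    (a * e' + b * d' ^ 2 + c * c' ^ 4 + d * b' + e * a' ^ 2)"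
  unfolding el_def[of a b c d e] el_def[of a' b' c' d' e'] R5_mult
  unfolding cs_eq_el skew_mult_low_degree el_eq_iff by simp

lemma el_one: "\<one>\<^bsub>R5\<^esub> = el 1 0 0 0 0"
  by (simp add: R5_one cs_eq_el delta_def)

lemma const_R_eq: "const_R F (\<iota> t) = el t 0 0 0 0"
  by (simp add: const_R_def S_monom coset_eq fin_supp_monom cs_eq_el)

lemma x_R_eq: "x_R F = el 0 1 0 0 0"
  unfolding x_R_def iota_1[symmetric] by (simp add: S_monom coset_eq fin_supp_monom cs_eq_el)

end


section \<open>The group \<open>Q\<close> and its subgroups\<close>

lemma (in group) finite_closed_subgroup:
  assumes "finite (carrier G)" "T \<subseteq> carrier G" "\<one> \<in> T"
    and closed: "\<And>x y. x \<in> T \<Longrightarrow> y \<in> T \<Longrightarrow> x \<otimes> y \<in> T"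
  shows "subgroup T G"
proof (rule subgroupI)
  fix x assume x: "x \<in> T"
  then have xc: "x \<in> carrier G" using assms(2) by blast
  have pow: "x [^] n \<in> T" for n :: nat by (induction n) (use x assms(3) closed in auto)
  obtain n where n: "Coset.order G = Suc n"
    using assms(1) order_gt_0_iff_finite by (cases "Coset.order G") simp_all
  have "x [^] n \<otimes> x = \<one>" using pow_order_eq_1[OF xc] n by simp
  then have "inv x = x [^] n" using xc by (intro inv_equality) auto
  then show "inv x \<in> T" using pow by simp
next
  show "T \<noteq> {}" using assms(3) by blast
qed (fact assms(2), rule closed)

text \<open>An ideal product consists of finite sums of products. Closure under addition bounds it
  from above; the reverse inclusion is easy here because every element of \<open>T\<close> is a
  single product.\<close>

lemma ideal_prod_eqI:
  assumes "\<And>i j. i \<in> I \<Longrightarrow> j \<in> J \<Longrightarrow> i \<otimes>\<^bsub>R\<^esub> j \<in> T" "\<And>x y. x \<in> T \<Longrightarrow> y \<in> T \<Longrightarrow> x \<oplus>\<^bsub>R\<^esub> y \<in> T"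
    and "\<And>x. x \<in> T \<Longrightarrow> \<exists>i\<in>I. \<exists>j\<in>J. x = i \<otimes>\<^bsub>R\<^esub> j"
  shows "ideal_prod R I J = T"
proof
  show "ideal_prod R I J \<subseteq> T"
  proof
    fix x assume "x \<in> ideal_prod R I J"
    then show "x \<in> T" by (induction rule: ideal_prod.induct) (simp_all add: assms(1,2))
  qed
  show "T \<subseteq> ideal_prod R I J"
  proof
    fix x assume "x \<in> T"
    from assms(3)[OF this] obtain i j where "i \<in> I" "j \<in> J" "x = i \<otimes>\<^bsub>R\<^esub> j" by (elim bexE)
    then show "x \<in> ideal_prod R I J" by (simp only: ideal_prod.prod)
  qed
qed

lemma action_commutator_incl:
  "h \<in> H \<Longrightarrow> a \<in> A \<Longrightarrow> inv\<^bsub>M\<^esub> h \<otimes>\<^bsub>M\<^esub> act a h \<in> action_commutator M act H A"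
  unfolding action_commutator_def by (rule generate.incl) blast

text \<open>The two arguments are conjugate under the Galois group. The identity matches the
  asymmetric cross terms in the proof of \<open>lam_mult\<close>.\<close>

lemma f8_trace_mult_swap: "f8_trace (b * a ^ 4) = f8_trace (a * b ^ 2)"
proof -
  have "(a * b ^ 2) ^ 4 = a ^ 4 * b ^ 8" by (simp add: power_mult_distrib flip: power_mult)
  then have "(a * b ^ 2) ^ 4 = b * a ^ 4" by (simp add: mult.commute)
  then show ?thesis using f8_trace_power4[of "a * b ^ 2"] by simp
qed

text \<open>The cocycle \<open>f8_trace ((a + a') * (a * a' ^ 2) ^ 2)\<close> is the coboundary of
  \<open>f8_trace (a ^ 7)\<close>, where \<open>a ^ 7\<close> is 1 for nonzero \<open>a\<close> and
  0 otherwise. This is checked on all 64 pairs.\<close>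

lemma f8_trace_power7_cocycle:
  "f8_trace ((a + a') * (a * a' ^ 2) ^ 2 + (a + a') ^ 7) = f8_trace (a ^ 7) + f8_trace (a' ^ 7)"
proof -
  have p7: "c ^ 7 = c ^ 4 * (c ^ 2 * c)" for c :: f8 by (simp flip: power_add power_Suc2)
  obtain x y z where a: "a = F8 x y z" by (cases a)
  obtain x' y' z' where a': "a' = F8 x' y' z'" by (cases a')
  show ?thesis
    unfolding a a' plus_f8.simps p7 power_mult_distrib f8_power2_eq f8_power4_eq
    by (cases x; cases y; cases z; cases x'; cases y'; cases z') (simp_all add: f8_trace_eq zero_f8_def)
qed

text \<open>\<open>lam\<close> defines the homomorphism from \<open>Q\<close> to the prime field whose kernel is \<open>P\<close>.\<close>

definition lam :: "f8 \<Rightarrow> f8 \<Rightarrow> f8 \<Rightarrow> f8" where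
  "lam a b c = f8_trace (c + a * b ^ 2 + a ^ 7)"

text \<open>The terms of \<open>lam\<close> are dictated by this identity. The trace of
  \<open>c\<close> alone fails to be additive by the traces of \<open>a * b' ^ 2\<close> and
  \<open>a' * b ^ 2\<close>; adding \<open>a * b ^ 2\<close> cancels both but leaves a cocycle in
  \<open>a\<close> and \<open>a'\<close>, and \<open>a ^ 7\<close> removes that.\<close>

lemma lam_mult:
  "lam (a + a') (b + b' + a * a' ^ 2) (c + c' + a * b' ^ 2 + b * a' ^ 4) = lam a b c + lam a' b' c'"
proof -
  have "f8_trace ((a + a') * (b + b' + a * a' ^ 2) ^ 2 + (a + a') ^ 7) =
      f8_trace (a * b ^ 2) + f8_trace (a * b' ^ 2) + f8_trace (a' * b ^ 2) + f8_trace (a' * b' ^ 2) +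
      f8_trace ((a + a') * (a * a' ^ 2) ^ 2 + (a + a') ^ 7)"
    by (simp only: f8_add_power2 distrib_left distrib_right f8_trace_add add_ac)
  then show ?thesis
    using f8_trace_power7_cocycle[of a a']
    by (simp add: lam_def f8_trace_add f8_trace_mult_swap add_ac)
qed

lemma f8_power_eq_self: "a ^ 9 = (a :: f8) ^ 2" "a ^ 10 = a ^ 3" "a ^ 15 = a"
proof -
  have "a ^ 9 = a ^ 8 * a" "a ^ 10 = a ^ 8 * a ^ 2" "a ^ 15 = a ^ 8 * a ^ 7" "a ^ 8 = a * a ^ 7"
    by (simp_all only: power_add[symmetric] power_Suc[symmetric] power_Suc2[symmetric]) simp_all
  then show "a ^ 9 = a ^ 2" "a ^ 10 = a ^ 3" "a ^ 15 = a"
    by (simp_all add: power2_eq_square power3_eq_cube)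
qed

lemma f8_add_1_eq_0: "a + 1 = 0 \<longleftrightarrow> a = (1 :: f8)"
  by (rule f8_add_eq_0_iff)

context f8_iso
begin

section \<open>Coordinates for Q and the powers of J\<close>

abbreviation "U \<equiv> units_of R5"

definition q :: "f8 \<Rightarrow> f8 \<Rightarrow> f8 \<Rightarrow> f8 \<Rightarrow> (nat \<Rightarrow> 'a) set" where
  "q a b c d = el 1 a b c d"

lemma q_eq_iff [simp]: "q a b c d = q a' b' c' d' \<longleftrightarrow> a = a' \<and> b = b' \<and> c = c' \<and> d = d'"
  by (simp add: q_def)

lemma R5_one_eq_q: "\<one>\<^bsub>R5\<^esub> = q 0 0 0 0"
  by (simp add: el_one q_def)

lemma R5_q_mult: "q a b c d \<otimes>\<^bsub>R5\<^esub> q a' b' c' d' =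
  q (a + a') (b + b' + a * a' ^ 2) (c + c' + a * b' ^ 2 + b * a' ^ 4)
    (d + d' + a * c' ^ 2 + b * b' ^ 4 + c * a')"
  by (simp add: q_def el_mult add_ac)

lemma q_right_inverse: "\<exists>b' c' d'. q a b c d \<otimes>\<^bsub>R5\<^esub> q a b' c' d' = \<one>\<^bsub>R5\<^esub>"
proof -
  define b' where "b' = b + a * a ^ 2"
  define c' where "c' = c + a * b' ^ 2 + b * a ^ 4"
  define d' where "d' = d + a * c' ^ 2 + b * b' ^ 4 + c * a"
  have "b + b' + a * a ^ 2 = 0" by (simp add: b'_def add_ac)
  moreover have "c + c' + a * b' ^ 2 + b * a ^ 4 = 0" by (simp add: c'_def add_ac)
  moreover have "d + d' + a * c' ^ 2 + b * b' ^ 4 + c * a = 0" by (simp add: d'_def add_ac)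
  ultimately have "q a b c d \<otimes>\<^bsub>R5\<^esub> q a b' c' d' = \<one>\<^bsub>R5\<^esub>" unfolding R5_q_mult R5_one_eq_q by simp
  then show ?thesis by blast
qed

text \<open>A right inverse has a right inverse of its own, which must be the original element; so
  right inverses are two-sided.\<close>

lemma q_Units [simp, intro]: "q a b c d \<in> Units R5"
proof -
  have c: "q a b c d \<in> carrier R5" for a b c d by (simp add: q_def)
  obtain b1 c1 d1 where 1: "q a b c d \<otimes>\<^bsub>R5\<^esub> q a b1 c1 d1 = \<one>\<^bsub>R5\<^esub>" using q_right_inverse by blast
  obtain b2 c2 d2 where 2: "q a b1 c1 d1 \<otimes>\<^bsub>R5\<^esub> q a b2 c2 d2 = \<one>\<^bsub>R5\<^esub>" using q_right_inverse by blast
  have "q a b c d = q a b2 c2 d2"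
    using R5.m_assoc[OF c[of a b c d] c[of a b1 c1 d1] c[of a b2 c2 d2]] 1 2 c by simp
  then show ?thesis using 1 2 c unfolding Units_def by auto
qed

sublocale U: group U by (rule R5.units_group)

lemma U_simps: "carrier U = Units R5" "\<one>\<^bsub>U\<^esub> = q 0 0 0 0"
  by (simp_all add: units_of_def R5_one_eq_q)

lemma q_mult: "q a b c d \<otimes>\<^bsub>U\<^esub> q a' b' c' d' =
  q (a + a') (b + b' + a * a' ^ 2) (c + c' + a * b' ^ 2 + b * a' ^ 4)
    (d + d' + a * c' ^ 2 + b * b' ^ 4 + c * a')"
  by (simp add: units_of_def R5_q_mult)

lemma q_closed [simp, intro]: "q a b c d \<in> carrier U"
  by (simp add: U_simps)

lemma finite_carrier_U: "finite (carrier U)"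
proof -
  have "carrier R5 \<subseteq> (\<lambda>(a, b, c, d, e). el a b c d e) ` UNIV"
  proof
    fix x assume "x \<in> carrier R5"
    then obtain a b c d e where "x = el a b c d e" by (rule R5_cases)
    then show "x \<in> (\<lambda>(a, b, c, d, e). el a b c d e) ` UNIV"
      by (intro image_eqI[of _ _ "(a, b, c, d, e)"]) simp_all
  qed
  then have "finite (carrier R5)" by (rule finite_subset) simp
  then show ?thesis by (rule rev_finite_subset) (auto simp: U_simps Units_def)
qed

text \<open>The coordinate forms of X, Y and P; \<open>PP\<close> is the kernel of
  \<open>lam\<close>, and its agreement with the group generated by commutators is the content of
  \<open>P_subgroup_eq\<close>.\<close>

definition XX where "XX = {q 0 0 c d | c d. f8_trace c = 0}"
definition YY where "YY = {q 0 b c d | b c d. f8_trace c = 0}"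
definition PP where "PP = {q a b c d | a b c d. lam a b c = 0}"

lemma subgroup_XX: "subgroup XX U"
  by (rule U.finite_closed_subgroup[OF finite_carrier_U])
    (auto simp: XX_def U_simps q_mult f8_trace_add)

lemma subgroup_YY: "subgroup YY U"
  by (rule U.finite_closed_subgroup[OF finite_carrier_U])
    (auto simp: YY_def U_simps q_mult f8_trace_add)

lemma subgroup_PP: "subgroup PP U"
proof (rule U.finite_closed_subgroup[OF finite_carrier_U])
  show "x \<otimes>\<^bsub>U\<^esub> y \<in> PP" if xy: "x \<in> PP" "y \<in> PP" for x y
  proof -
    obtain a b c d a' b' c' d' where xy: "x = q a b c d" "y = q a' b' c' d'" "lam a b c = 0" "lam a' b' c' = 0"
      using xy unfolding PP_def by blast
    have "lam (a + a') (b + b' + a * a' ^ 2) (c + c' + a * b' ^ 2 + b * a' ^ 4) = 0"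
      unfolding lam_mult xy by simp
    then show ?thesis unfolding xy q_mult PP_def by blast
  qed
qed (auto simp: PP_def U_simps lam_def)

lemma inv_U_q: obtains b' c' d' where "inv\<^bsub>U\<^esub> (q a b c d) = q a b' c' d'"
    "q a b c d \<otimes>\<^bsub>U\<^esub> q a b' c' d' = q 0 0 0 0"
proof -
  obtain b' c' d' where 1: "q a b c d \<otimes>\<^bsub>U\<^esub> q a b' c' d' = q 0 0 0 0"
    using q_right_inverse[of a b c d] by (auto simp: units_of_def R5_one_eq_q)
  then have "inv\<^bsub>U\<^esub> (q a b' c' d') = q a b c d"
    by (intro U.inv_equality) (simp_all add: U_simps(2))
  then have "inv\<^bsub>U\<^esub> (q a b c d) = q a b' c' d'" by (metis U.inv_inv q_closed)
  then show ?thesis using that 1 by blast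
qed

lemma inv_U_q_0: "inv\<^bsub>U\<^esub> (q 0 0 c d) = q 0 0 c d"
  by (rule U.inv_equality) (simp_all add: q_mult U_simps(2))

text \<open>The term \<open>b ^ 5\<close> compensates the contribution \<open>b * b ^ 4\<close> of
  the twisted product to the coefficient of x^4.\<close>

lemma inv_U_q_00: "inv\<^bsub>U\<^esub> (q 0 b c d) = q 0 b c (d + b ^ 5)"
  by (rule U.inv_equality) (simp_all add: q_mult U_simps(2) numeral_eq_Suc add_ac)

lemma J_ideal_eq: "J_ideal F = {el 0 a b c d | a b c d. True}"
proof -
  have pow: "el 0 1 0 0 0 [^]\<^bsub>R5\<^esub> (2 :: nat) = el 0 0 1 0 0" "el 0 1 0 0 0 [^]\<^bsub>R5\<^esub> (3 :: nat) = el 0 0 0 1 0"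
    "el 0 1 0 0 0 [^]\<^bsub>R5\<^esub> (4 :: nat) = el 0 0 0 0 1"
    by (simp_all add: numeral_eq_Suc el_one el_mult)
  have e: "const_R F (\<iota> a) \<otimes>\<^bsub>R5\<^esub> el 0 1 0 0 0 \<oplus>\<^bsub>R5\<^esub> const_R F (\<iota> b) \<otimes>\<^bsub>R5\<^esub> el 0 0 1 0 0
      \<oplus>\<^bsub>R5\<^esub> const_R F (\<iota> c) \<otimes>\<^bsub>R5\<^esub> el 0 0 0 1 0 \<oplus>\<^bsub>R5\<^esub> const_R F (\<iota> d) \<otimes>\<^bsub>R5\<^esub> el 0 0 0 0 1 = el 0 a b c d"
    for a b c d by (simp add: const_R_eq el_mult el_add)
  have "el 0 a b c d \<in> J_ideal F" for a b c d
    unfolding J_ideal_def x_R_eq pow using e[of a b c d, symmetric] iota_closed by blast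
  moreover have "x \<in> {el 0 a b c d | a b c d. True}" if "x \<in> J_ideal F" for x
    using that e unfolding J_ideal_def x_R_eq pow carrier_eq_range by auto
  ultimately show ?thesis by blast
qed

text \<open>Right multiplication by x shifts coefficients without twisting them, so each element of
  the next power is a single product with x.\<close>

lemma J_pow_eq:
  "J_pow F 1 = {el 0 a b c d | a b c d. True}"
  "J_pow F 2 = {el 0 0 b c d | b c d. True}"
  "J_pow F 3 = {el 0 0 0 c d | c d. True}"
  "J_pow F 4 = {el 0 0 0 0 d | d. True}"
proof -
  have 0: "J_pow F 0 = {el a b c d e | a b c d e. True}"
    by (auto elim!: R5_cases)
  have x: "el 0 1 0 0 0 \<in> J_ideal F" by (auto simp: J_ideal_eq)
  have shift: "el a b c d 0 \<otimes>\<^bsub>R5\<^esub> el 0 1 0 0 0 = el 0 a b c d" for a b c d by (simp add: el_mult)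
  show 1: "J_pow F 1 = {el 0 a b c d | a b c d. True}"
    unfolding One_nat_def J_pow.simps(2) 0
  proof (rule ideal_prod_eqI)
    fix x assume "x \<in> {el 0 a b c d | a b c d. True}"
    then obtain a b c d where "x = el 0 a b c d" by blast
    then have "x = el a b c d 0 \<otimes>\<^bsub>R5\<^esub> el 0 1 0 0 0" by (simp add: shift)
    then show "\<exists>i\<in>{el a b c d e | a b c d e. True}. \<exists>j\<in>J_ideal F. x = i \<otimes>\<^bsub>R5\<^esub> j" using x by blast
  qed (auto simp: J_ideal_eq el_mult el_add)
  show 2: "J_pow F 2 = {el 0 0 b c d | b c d. True}"
    unfolding Suc_1[symmetric] J_pow.simps(2) 1
  proof (rule ideal_prod_eqI)
    fix x assume "x \<in> {el 0 0 b c d | b c d. True}"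
    then obtain b c d where "x = el 0 0 b c d" by blast
    then have "x = el 0 b c d 0 \<otimes>\<^bsub>R5\<^esub> el 0 1 0 0 0" by (simp add: shift)
    then show "\<exists>i\<in>{el 0 a b c d | a b c d. True}. \<exists>j\<in>J_ideal F. x = i \<otimes>\<^bsub>R5\<^esub> j" using x by blast
  qed (auto simp: J_ideal_eq el_mult el_add)
  have three: "(3 :: nat) = Suc 2" and four: "(4 :: nat) = Suc 3" by simp_all
  show 3: "J_pow F 3 = {el 0 0 0 c d | c d. True}"
    unfolding three J_pow.simps(2) 2
  proof (rule ideal_prod_eqI)
    fix x assume "x \<in> {el 0 0 0 c d | c d. True}"
    then obtain c d where "x = el 0 0 0 c d" by blast
    then have "x = el 0 0 c d 0 \<otimes>\<^bsub>R5\<^esub> el 0 1 0 0 0" by (simp add: shift)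
    then show "\<exists>i\<in>{el 0 0 b c d | b c d. True}. \<exists>j\<in>J_ideal F. x = i \<otimes>\<^bsub>R5\<^esub> j" using x by blast
  qed (auto simp: J_ideal_eq el_mult el_add)
  show "J_pow F 4 = {el 0 0 0 0 d | d. True}"
    unfolding four J_pow.simps(2) 3
  proof (rule ideal_prod_eqI)
    fix x assume "x \<in> {el 0 0 0 0 d | d. True}"
    then obtain d where "x = el 0 0 0 0 d" by blast
    then have "x = el 0 0 0 d 0 \<otimes>\<^bsub>R5\<^esub> el 0 1 0 0 0" by (simp add: shift)
    then show "\<exists>i\<in>{el 0 0 0 c d | c d. True}. \<exists>j\<in>J_ideal F. x = i \<otimes>\<^bsub>R5\<^esub> j" using x by blast
  qed (auto simp: J_ideal_eq el_mult el_add)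
qed

lemma Q_pow_eq:
  "Q_pow F 1 = {q a b c d | a b c d. True}" "Q_pow F 2 = {q 0 b c d | b c d. True}"
  "Q_pow F 3 = {q 0 0 c d | c d. True}" "Q_pow F 4 = {q 0 0 0 d | d. True}"
proof -
  have add: "\<one>\<^bsub>R5\<^esub> \<oplus>\<^bsub>R5\<^esub> el 0 a b c d = q a b c d" for a b c d by (simp add: el_one el_add q_def)
  show "Q_pow F 1 = {q a b c d | a b c d. True}" "Q_pow F 2 = {q 0 b c d | b c d. True}"
    "Q_pow F 3 = {q 0 0 c d | c d. True}" "Q_pow F 4 = {q 0 0 0 d | d. True}"
    unfolding Q_pow_def J_pow_eq by (auto simp: add) (auto simp flip: add)
qed

definition fr :: "nat \<Rightarrow> 'a \<Rightarrow> 'a" where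
  "fr j = (\<lambda>\<alpha>\<in>carrier F. \<iota> (inv_into UNIV \<iota> \<alpha> ^ (2 ^ j)))"

lemma fr_iota [simp]: "fr j (\<iota> a) = \<iota> (a ^ (2 ^ j))"
  using bij_iota by (simp add: fr_def bij_betw_def inv_into_f_f)

lemma fr_eqI: "\<sigma> \<in> extensional (carrier F) \<Longrightarrow> (\<And>a. \<sigma> (\<iota> a) = \<iota> (a ^ (2 ^ j))) \<Longrightarrow> \<sigma> = fr j"
proof (rule extensionalityI[of _ "carrier F"])
  fix x
  assume "x \<in> carrier F" and *: "\<And>a. \<sigma> (\<iota> a) = \<iota> (a ^ (2 ^ j))"
  then obtain a where "x = \<iota> a" by (auto simp: carrier_eq_range)
  then show "\<sigma> x = fr j x" by (simp add: *)
qed (simp_all add: fr_def)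

lemma f8_power_8_power: "a ^ (8 ^ j) = (a :: f8)"
  by (induction j) (simp_all add: power_mult)

lemma fr_in_Gal: "fr j \<in> carrier (Gal_group F)"
proof -
  \<comment> \<open>Raising to the power \<open>4 ^ j\<close> undoes raising to the power
    \<open>2 ^ j\<close>, since the exponents multiply to \<open>8 ^ j\<close>.\<close>
  have inj: "a = b" if "a ^ (2 ^ j) = b ^ (2 ^ j)" for a b :: f8
  proof -
    have "(a ^ (2 ^ j)) ^ (4 ^ j) = (b ^ (2 ^ j)) ^ (4 ^ j)" using that by simp
    then show ?thesis
      by (simp add: power_mult[symmetric] power_mult_distrib[symmetric] f8_power_8_power)
  qed
  have "inj_on (fr j) (carrier F)"
    by (auto simp: inj_on_def carrier_eq_range dest: inj)
  moreover have "fr j ` carrier F = carrier F"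
    by (rule endo_inj_surj) (use calculation in \<open>auto simp: carrier_eq_range\<close>)
  ultimately have "bij_betw (fr j) (carrier F) (carrier F)" by (simp add: bij_betw_def)
  moreover have "fr j \<in> Ring.ring_hom F F"
    by (rule ring_hom_memI)
      (auto simp: carrier_eq_range simp flip: iota_mult iota_add iota_1
        simp: power_mult_distrib f8_add_power_2_power)
  moreover have "fr j \<in> extensional (carrier F)" by (simp add: fr_def)
  moreover have "fr j \<zero> = \<zero>" "fr j \<one> = \<one>"
    using fr_iota[of j 0] fr_iota[of j 1] by (simp_all add: iota_0 iota_1 zero_power)
  ultimately show ?thesis by (simp add: Gal_group_def ring_iso_def)
qed

text \<open>An automorphism is determined by the image of \<tau>, a root of t^3 + t + 1, and the
  three roots of this cubic are the conjugates of \<tau> under the Frobenius map.\<close>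

lemma Gal_carrier: "carrier (Gal_group F) = {fr 0, fr 1, fr 2}"
proof
  show "{fr 0, fr 1, fr 2} \<subseteq> carrier (Gal_group F)" using fr_in_Gal by blast
  show "carrier (Gal_group F) \<subseteq> {fr 0, fr 1, fr 2}"
  proof
    fix \<sigma> assume s: "\<sigma> \<in> carrier (Gal_group F)"
    then have hom: "\<sigma> \<in> Ring.ring_hom F F" and ext: "\<sigma> \<in> extensional (carrier F)"
      by (auto simp: Gal_group_def ring_iso_def)
    define f where "f a = inv_into UNIV \<iota> (\<sigma> (\<iota> a))" for a
    have f: "\<sigma> (\<iota> a) = \<iota> (f a)" for a
      using ring_hom_closed[OF hom iota_closed[of a]] unfolding f_def carrier_eq_range
      by (simp add: f_inv_into_f)
    have f_add: "f (a + b) = f a + f b" for a b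
      using ring_hom_add[OF hom iota_closed[of a] iota_closed[of b]] by (simp add: f flip: iota_add)
    have f_mult: "f (a * b) = f a * f b" for a b
      using ring_hom_mult[OF hom iota_closed[of a] iota_closed[of b]] by (simp add: f flip: iota_mult)
    have f_1: "f 1 = 1" using ring_hom_one[OF hom] by (simp add: f flip: iota_1)
    have f_0: "f 0 = 0" using f_add[of 0 0] by simp
    let ?t = "F8 0 1 0"
    have "?t * (?t * ?t) + ?t + 1 = 0" by (simp add: one_f8_def zero_f8_def)
    then have root: "f ?t * (f ?t * f ?t) + f ?t + 1 = 0"
      using f_add f_mult f_1 f_0 by metis
    have roots: "b = ?t \<or> b = ?t ^ 2 \<or> b = ?t ^ 4" if "b * (b * b) + b + 1 = 0" for b
      using that unfolding f8_power2_eq f8_power4_eq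
    proof (cases b)
      case (F8 x y z)
      then show "b = ?t \<or> b = F8 0 0 (1 + 0) \<or> b = F8 0 (1 + 0) 1"
        using that by (cases x; cases y; cases z) (simp_all add: one_f8_def zero_f8_def)
    qed
    note roots[OF root]
    moreover have "?t = ?t ^ (2 ^ 0)" "?t ^ 2 = ?t ^ (2 ^ 1)" "?t ^ 4 = ?t ^ (2 ^ 2)"
      by (simp_all only: power_0 power_one_right) simp
    ultimately have "\<exists>j\<in>{0, 1, 2}. f ?t = ?t ^ (2 ^ j)" by (metis insertCI)
    then obtain j where j: "j \<in> {0, 1, 2}" "f ?t = ?t ^ (2 ^ j)" by (elim bexE)
    have const: "f (F8 x 0 0) = F8 x 0 0 ^ (2 ^ j)" for x
      using f_0 f_1 by (cases x) (simp_all flip: zero_f8_def one_f8_def)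
    have "f a = a ^ (2 ^ j)" for a
    proof (cases a)
      case (F8 x y z)
      then have a: "a = F8 x 0 0 + (F8 y 0 0 * ?t + F8 z 0 0 * (?t * ?t))"
        by (cases x; cases y; cases z) simp_all
      show ?thesis unfolding a f_add f_mult const j(2) f8_add_power_2_power power_mult_distrib ..
    qed
    then have "\<sigma> = fr j" using ext f by (intro fr_eqI) auto
    then show "\<sigma> \<in> {fr 0, fr 1, fr 2}" using j(1) by blast
  qed
qed

text \<open>Since the action on a coset is an image of a set, every polynomial in the target coset
  needs a preimage; taking coefficients to the power \<open>4 ^ j\<close> provides it.\<close>

lemma Gal_act_el: "Gal_act (fr j) (el a b c d e) =
  el (a ^ (2 ^ j)) (b ^ (2 ^ j)) (c ^ (2 ^ j)) (d ^ (2 ^ j)) (e ^ (2 ^ j))"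
proof -
  have inv: "(x ^ (4 ^ j)) ^ (2 ^ j) = x" "(x ^ (2 ^ j)) ^ (4 ^ j) = x" for x :: f8
    by (simp_all add: power_mult[symmetric] power_mult_distrib[symmetric] f8_power_8_power)
  have fin: "fin_supp r \<Longrightarrow> fin_supp (\<lambda>n. r n ^ k)" if "k > 0" for r :: "nat \<Rightarrow> f8" and k
    using that by (auto simp: fin_supp_def)
  have act: "Gal_act (fr j) (cs p) = cs (\<lambda>n. p n ^ (2 ^ j))" for p
  proof
    show "Gal_act (fr j) (cs p) \<subseteq> cs (\<lambda>n. p n ^ (2 ^ j))"
      by (auto simp: Gal_act_def cs_def pol_def intro!: fin)
    show "cs (\<lambda>n. p n ^ (2 ^ j)) \<subseteq> Gal_act (fr j) (cs p)"
    proof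
      fix x assume "x \<in> cs (\<lambda>n. p n ^ (2 ^ j))"
      then obtain r where r: "x = pol r" "fin_supp r" "\<forall>n<5. r n = p n ^ (2 ^ j)" by (auto simp: cs_def)
      have "pol (\<lambda>n. r n ^ (4 ^ j)) \<in> cs p"
        using r fin[of "4 ^ j" r] inv by (auto simp: cs_def)
      moreover have "x = (\<lambda>p n. fr j (p n)) (pol (\<lambda>n. r n ^ (4 ^ j)))"
        unfolding r(1) pol_def using inv by simp
      ultimately show "x \<in> Gal_act (fr j) (cs p)" unfolding Gal_act_def by blast
    qed
  qed
  show ?thesis unfolding el_def[of a] act by (simp add: cs_eq_el)
qed

lemma Gal_act_q: "Gal_act (fr j) (q a b c d) = q (a ^ (2 ^ j)) (b ^ (2 ^ j)) (c ^ (2 ^ j)) (d ^ (2 ^ j))"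
  by (simp add: q_def Gal_act_el)

text \<open>Moving \<open>t\<close> from the right of x^i to its left turns it into t^(2^i), so the
  coefficient of x^i is multiplied by t^(2^i - 1). The exponents 1, 3, 7, 15 reduce to 1, 3, 0, 1,
  and \<open>t ^ 6\<close> is the inverse of \<open>t\<close>.\<close>

lemma C_act_q:
  assumes t: "t \<noteq> 0"
  shows "C_act F (\<iota> t) (q a b c d) = q (a * t) (b * t ^ 3) c (d * t)"
proof -
  have t7: "t ^ 6 * t = 1" "t * t ^ 6 = 1" using f8_power7[OF t] by (simp_all flip: power_Suc power_Suc2)
  have "el t 0 0 0 0 \<otimes>\<^bsub>R5\<^esub> el (t ^ 6) 0 0 0 0 = \<one>\<^bsub>R5\<^esub>"
    "el (t ^ 6) 0 0 0 0 \<otimes>\<^bsub>R5\<^esub> el t 0 0 0 0 = \<one>\<^bsub>R5\<^esub>"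
    using t7 by (simp_all add: el_mult el_one)
  then have "inv\<^bsub>R5\<^esub> (el t 0 0 0 0) = el (t ^ 6) 0 0 0 0" by (intro R5.inv_char) auto
  moreover have "t ^ 6 * t ^ 2 = t" "t ^ 6 * t ^ 4 = t ^ 3"
    by (simp_all add: f8_power_eq_self flip: power_add)
  ultimately show ?thesis
    using t7 unfolding C_act_def const_R_eq q_def
    by (simp add: el_mult)
qed

lemma f8_trace_power_2_power [simp]: "f8_trace (a ^ (2 ^ j)) = f8_trace a"
proof (induction j)
  case (Suc j)
  have "a ^ (2 ^ Suc j) = (a ^ (2 ^ j)) ^ 2" by (simp only: power_Suc2 power_mult)
  then show ?case using Suc by simp
qed simp

lemma C_carrier: "carrier (C_group F) = {\<iota> t | t. t \<noteq> 0}"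
  by (auto simp: C_group_def units_of_carrier field_Units carrier_eq_range iota_0[symmetric])

lemma iota_in_C: "t \<noteq> 0 \<Longrightarrow> \<iota> t \<in> carrier (C_group F)"
  unfolding C_carrier by blast

section \<open>The commutator constructions of X, Y and P in coordinates\<close>

lemma X_subgroup_eq: "X_subgroup F = XX"
proof -
  let ?A = "action_commutator U Gal_act (Q_pow F 3) (carrier (Gal_group F))"
  have "?A \<subseteq> XX"
    unfolding action_commutator_def
  proof (rule U.generate_subgroup_incl[OF _ subgroup_XX], safe)
    fix h \<sigma> assume "h \<in> Q_pow F 3" "\<sigma> \<in> carrier (Gal_group F)"
    then obtain c d j where "h = q 0 0 c d" "\<sigma> = fr j" by (auto simp: Q_pow_eq Gal_carrier)
    then show "inv\<^bsub>U\<^esub> h \<otimes>\<^bsub>U\<^esub> Gal_act \<sigma> h \<in> XX"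
      by (auto simp: inv_U_q_0 Gal_act_q q_mult XX_def f8_trace_add)
  qed
  moreover have "Q_pow F 4 \<subseteq> XX" by (auto simp: Q_pow_eq XX_def)
  ultimately have "X_subgroup F \<subseteq> XX"
    unfolding X_subgroup_def set_mult_def using subgroup.m_closed[OF subgroup_XX] by blast
  moreover have "XX \<subseteq> X_subgroup F"
  proof
    fix x assume "x \<in> XX"
    then obtain c d where x: "x = q 0 0 c d" "f8_trace c = 0" by (auto simp: XX_def)
    \<comment> \<open>This choice makes \<open>q 0 0 c 0\<close> the commutator of
      \<open>q 0 0 e 0\<close> with the Frobenius map.\<close>
    define e where "e = c + c ^ 4"
    have e: "e + e ^ 2 = c" using f8_half_trace[OF x(2)] by (simp add: e_def)
    have "inv\<^bsub>U\<^esub> (q 0 0 e 0) \<otimes>\<^bsub>U\<^esub> Gal_act (fr 1) (q 0 0 e 0) \<in> ?A"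
      by (rule action_commutator_incl) (auto simp: Q_pow_eq Gal_carrier)
    also have "inv\<^bsub>U\<^esub> (q 0 0 e 0) \<otimes>\<^bsub>U\<^esub> Gal_act (fr 1) (q 0 0 e 0) = q 0 0 c 0"
      unfolding inv_U_q_0 using e by (simp add: Gal_act_q q_mult)
    finally have "q 0 0 c 0 \<in> ?A" .
    moreover have "q 0 0 0 d \<in> Q_pow F 4" by (auto simp: Q_pow_eq)
    moreover have "x = q 0 0 c 0 \<otimes>\<^bsub>U\<^esub> q 0 0 0 d" by (simp add: x q_mult)
    ultimately show "x \<in> X_subgroup F" unfolding X_subgroup_def set_mult_def by blast
  qed
  ultimately show ?thesis by blast
qed

text \<open>Commutators with \<open>t\<close> multiply leading coefficients by \<open>1 + t\<close>
  or \<open>1 + t ^ 3\<close>. For \<tau>, which has order 7, both factors are nonzero, so every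
  leading coefficient is attained.\<close>

lemma exists_f8_scalar: "\<exists>t :: f8. t \<noteq> 0 \<and> (\<forall>a. \<exists>b. b + b * t = a) \<and> (\<forall>a. \<exists>b. b + b * t ^ 3 = a)"
proof -
  have solve: "\<exists>b. b + b * s = a" if "s \<noteq> 1" for a s :: f8
  proof -
    have "(s + 1) * (s + 1) ^ 6 = 1"
      using f8_power7[of "s + 1"] that by (simp add: f8_add_1_eq_0 flip: power_Suc)
    then have "a * (s + 1) ^ 6 * (s + 1) = a" by (simp add: mult.assoc mult.commute[of _ "s + 1"])
    then show ?thesis by (intro exI[of _ "a * (s + 1) ^ 6"]) (simp add: distrib_left add.commute)
  qed
  let ?t = "F8 0 1 0"
  have "?t \<noteq> 0" "?t \<noteq> 1" "?t ^ 3 \<noteq> 1" by (simp_all add: zero_f8_def one_f8_def power3_eq_cube)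
  then show ?thesis using solve by blast
qed

lemma Y_subgroup_eq: "Y_subgroup F = YY"
proof -
  let ?A = "action_commutator U (C_act F) (Q_pow F 2) (carrier (C_group F))"
  have "?A \<subseteq> YY"
    unfolding action_commutator_def
  proof (rule U.generate_subgroup_incl[OF _ subgroup_YY], safe)
    fix h s assume "h \<in> Q_pow F 2" "s \<in> carrier (C_group F)"
    then obtain b c d t where "h = q 0 b c d" "s = \<iota> t" "t \<noteq> 0" by (auto simp: Q_pow_eq C_carrier)
    then show "inv\<^bsub>U\<^esub> h \<otimes>\<^bsub>U\<^esub> C_act F s h \<in> YY"
      by (auto simp: inv_U_q_00 C_act_q q_mult YY_def)
  qed
  moreover have "XX \<subseteq> YY" by (auto simp: XX_def YY_def)
  ultimately have "Y_subgroup F \<subseteq> YY"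
    unfolding Y_subgroup_def X_subgroup_eq set_mult_def using subgroup.m_closed[OF subgroup_YY] by blast
  moreover have "YY \<subseteq> Y_subgroup F"
  proof
    fix x assume "x \<in> YY"
    then obtain b c d where x: "x = q 0 b c d" "f8_trace c = 0" by (auto simp: YY_def)
    obtain t b0 where t: "t \<noteq> 0" "b0 + b0 * t ^ 3 = b" using exists_f8_scalar by blast
    have "inv\<^bsub>U\<^esub> (q 0 b0 0 0) \<otimes>\<^bsub>U\<^esub> C_act F (\<iota> t) (q 0 b0 0 0) \<in> ?A"
      by (rule action_commutator_incl) (use t(1) in \<open>auto simp: Q_pow_eq C_carrier\<close>)
    \<comment> \<open>The coefficient \<open>d1\<close> of x^4 is a by-product of the inversion, and
      a factor from X corrects it.\<close>
    moreover obtain d1 where "inv\<^bsub>U\<^esub> (q 0 b0 0 0) \<otimes>\<^bsub>U\<^esub> C_act F (\<iota> t) (q 0 b0 0 0) = q 0 b 0 d1"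
      using t by (simp add: inv_U_q_00 C_act_q q_mult)
    ultimately have "q 0 b 0 d1 \<in> ?A" by simp
    moreover have "q 0 0 c (d + d1) \<in> XX" using x by (auto simp: XX_def)
    moreover have "x = q 0 b 0 d1 \<otimes>\<^bsub>U\<^esub> q 0 0 c (d + d1)" by (simp add: x q_mult add_ac)
    ultimately show "x \<in> Y_subgroup F" unfolding Y_subgroup_def X_subgroup_eq set_mult_def by blast
  qed
  ultimately show ?thesis by blast
qed

text \<open>Under \<open>C\<close> the terms of \<open>lam\<close> have the weights 0,
  \<open>1 + 2 * 3 = 7\<close> and 7, all trivial in a group of order 7, and the trace ignores the
  Galois action. This yields the invariance of P.\<close>

lemma lam_act:
  assumes "t \<noteq> 0"
  shows "lam (a ^ (2 ^ j) * t) (b ^ (2 ^ j) * t ^ 3) (c ^ (2 ^ j)) = lam a b c"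
proof -
  have t7: "t * (t ^ 3) ^ 2 = 1" "t ^ 7 = 1"
    using f8_power7[OF assms] by (simp_all flip: power_mult power_Suc)
  have "c ^ (2 ^ j) + a ^ (2 ^ j) * t * (b ^ (2 ^ j) * t ^ 3) ^ 2 + (a ^ (2 ^ j) * t) ^ 7 =
      c ^ (2 ^ j) + a ^ (2 ^ j) * (b ^ (2 ^ j)) ^ 2 * (t * (t ^ 3) ^ 2) + (a ^ (2 ^ j)) ^ 7 * t ^ 7"
    by (simp add: power_mult_distrib mult_ac)
  also have "\<dots> = (c + a * b ^ 2 + a ^ 7) ^ (2 ^ j)"
    unfolding t7 by (simp add: f8_add_power_2_power power_mult_distrib power_mult[symmetric] mult.commute)
  finally show ?thesis unfolding lam_def by simp
qed

text \<open>Being additive and invariant under \<open>C\<close>, \<open>lam\<close> vanishes on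
  commutators with \<open>C\<close>. Conversely, a commutator with the same coefficient of x can be
  split off from an element of the kernel; the remainder has no term in x, and there
  \<open>lam\<close> is the trace that defines Y.\<close>

lemma P_subgroup_eq: "P_subgroup F = PP"
proof -
  let ?A = "action_commutator U (C_act F) (Q_pow F 1) (carrier (C_group F))"
  have comm: "\<exists>b' c' d'. inv\<^bsub>U\<^esub> (q a b c d) \<otimes>\<^bsub>U\<^esub> C_act F (\<iota> t) (q a b c d) = q (a + a * t) b' c' d' \<and>
      lam (a + a * t) b' c' = 0" if t: "t \<noteq> 0" for a b c d t
  proof -
    obtain b1 c1 d1 where i: "inv\<^bsub>U\<^esub> (q a b c d) = q a b1 c1 d1"
      "q a b c d \<otimes>\<^bsub>U\<^esub> q a b1 c1 d1 = q 0 0 0 0" by (rule inv_U_q)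
    have "lam 0 0 0 = lam a b c + lam a b1 c1"
      using i(2) lam_mult[of a a b b1 c c1] by (simp add: q_mult)
    then have "lam a b1 c1 = lam a b c" by (simp add: lam_def f8_add_eq_0_iff)
    then show ?thesis
      using lam_mult[of a "a * t" b1 "b * t ^ 3" c1 c] lam_act[OF t, of a 0 b c]
      by (simp add: i(1) C_act_q t q_mult)
  qed
  have "?A \<subseteq> PP"
    unfolding action_commutator_def
  proof (rule U.generate_subgroup_incl[OF _ subgroup_PP], safe)
    fix h s assume "h \<in> Q_pow F 1" "s \<in> carrier (C_group F)"
    then obtain a b c d t where h: "h = q a b c d" "s = \<iota> t" "t \<noteq> 0"
      unfolding Q_pow_eq C_carrier by blast
    show "inv\<^bsub>U\<^esub> h \<otimes>\<^bsub>U\<^esub> C_act F s h \<in> PP"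
      unfolding h(1,2) using comm[OF h(3), of a b c d] unfolding PP_def by blast
  qed
  moreover have "YY \<subseteq> PP" by (auto simp: YY_def PP_def lam_def)
  ultimately have "P_subgroup F \<subseteq> PP"
    unfolding P_subgroup_def Y_subgroup_eq set_mult_def using subgroup.m_closed[OF subgroup_PP] by blast
  moreover have "PP \<subseteq> P_subgroup F"
  proof
    fix x assume x: "x \<in> PP"
    then obtain a b c d where xq: "x = q a b c d" "lam a b c = 0" unfolding PP_def by blast
    obtain t :: f8 where t1: "t \<noteq> 0 \<and> (\<forall>a. \<exists>b. b + b * t = a) \<and> (\<forall>a. \<exists>b. b + b * t ^ 3 = a)"
      by (rule exE[OF exists_f8_scalar])
    note t0 = conjunct1[OF t1] conjunct1[OF conjunct2[OF t1]]
    obtain a0 where "a0 + a0 * t = a" by (rule exE[OF spec[OF t0(2)]])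
    with t0(1) have t: "t \<noteq> 0" "a0 + a0 * t = a" by simp_all
    let ?z = "inv\<^bsub>U\<^esub> (q a0 0 0 0) \<otimes>\<^bsub>U\<^esub> C_act F (\<iota> t) (q a0 0 0 0)"
    have zA: "?z \<in> ?A"
    proof (rule action_commutator_incl)
      show "q a0 0 0 0 \<in> Q_pow F 1" unfolding Q_pow_eq by blast
      show "\<iota> t \<in> carrier (C_group F)" using t(1) by (rule iota_in_C)
    qed
    have "\<exists>b' c' d'. ?z = q a b' c' d' \<and> lam a b' c' = 0"
      by (rule comm[OF t(1), of a0 0 0 0, unfolded t(2)])
    then obtain b1 c1 d1 where z: "?z = q a b1 c1 d1" "lam a b1 c1 = 0" by (elim exE conjE)
    have zP: "?z \<in> PP" unfolding z(1) PP_def using z(2) by blast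
    have w: "inv\<^bsub>U\<^esub> ?z \<otimes>\<^bsub>U\<^esub> x \<in> PP"
      by (rule subgroup.m_closed[OF subgroup_PP subgroup.m_inv_closed[OF subgroup_PP zP] x])
    obtain b2 c2 d2 where "inv\<^bsub>U\<^esub> ?z = q a b2 c2 d2" unfolding z(1) by (rule inv_U_q)
    then obtain b3 c3 d3 where w3: "inv\<^bsub>U\<^esub> ?z \<otimes>\<^bsub>U\<^esub> x = q 0 b3 c3 d3" by (simp add: xq q_mult)
    with w have "f8_trace c3 = 0" by (auto simp: PP_def lam_def)
    then have "inv\<^bsub>U\<^esub> ?z \<otimes>\<^bsub>U\<^esub> x \<in> YY" unfolding w3 YY_def by blast
    moreover have "x = ?z \<otimes>\<^bsub>U\<^esub> (inv\<^bsub>U\<^esub> ?z \<otimes>\<^bsub>U\<^esub> x)"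
    proof -
      have c: "?z \<in> carrier U" "x \<in> carrier U" unfolding z(1) xq(1) by (rule q_closed)+
      have "?z \<otimes>\<^bsub>U\<^esub> (inv\<^bsub>U\<^esub> ?z \<otimes>\<^bsub>U\<^esub> x) = (?z \<otimes>\<^bsub>U\<^esub> inv\<^bsub>U\<^esub> ?z) \<otimes>\<^bsub>U\<^esub> x"
        by (rule U.m_assoc[symmetric, OF c(1) U.inv_closed[OF c(1)] c(2)])
      also have "\<dots> = x" unfolding U.r_inv[OF c(1)] by (rule U.l_one[OF c(2)])
      finally show ?thesis by (rule sym)
    qed
    ultimately show "x \<in> P_subgroup F" using zA unfolding P_subgroup_def Y_subgroup_eq set_mult_def by blast
  qed
  ultimately show ?thesis by blast
qed

end


section \<open>The group \<open>G\<close> and its real classes\<close>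

lemma semidirect_group:
  assumes "Group.group H" "Group.group K"
    and hom: "\<And>k h h'. k \<in> carrier K \<Longrightarrow> h \<in> carrier H \<Longrightarrow> h' \<in> carrier H \<Longrightarrow>
      act k (h \<otimes>\<^bsub>H\<^esub> h') = act k h \<otimes>\<^bsub>H\<^esub> act k h'"
    and closed: "\<And>k h. k \<in> carrier K \<Longrightarrow> h \<in> carrier H \<Longrightarrow> act k h \<in> carrier H"
    and one: "\<And>h. h \<in> carrier H \<Longrightarrow> act \<one>\<^bsub>K\<^esub> h = h"
    and comp: "\<And>k l h. k \<in> carrier K \<Longrightarrow> l \<in> carrier K \<Longrightarrow> h \<in> carrier H \<Longrightarrow>
      act (k \<otimes>\<^bsub>K\<^esub> l) h = act l (act k h)"
  shows "Group.group (semidirect H K act)"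
proof -
  interpret H: Group.group H by fact
  interpret K: Group.group K by fact
  have act_one: "act k \<one>\<^bsub>H\<^esub> = \<one>\<^bsub>H\<^esub>" if k: "k \<in> carrier K" for k
  proof -
    have c: "act k \<one>\<^bsub>H\<^esub> \<in> carrier H" by (rule closed[OF k H.one_closed])
    have "act k \<one>\<^bsub>H\<^esub> \<otimes>\<^bsub>H\<^esub> act k \<one>\<^bsub>H\<^esub> = act k \<one>\<^bsub>H\<^esub>"
      using hom[OF k H.one_closed H.one_closed] by simp
    then show ?thesis using c by simp
  qed
  show ?thesis
  proof (rule groupI)
    fix x y assume "x \<in> carrier (semidirect H K act)" "y \<in> carrier (semidirect H K act)"
    then show "x \<otimes>\<^bsub>semidirect H K act\<^esub> y \<in> carrier (semidirect H K act)"
      by (cases x; cases y) (simp add: semidirect_def closed)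
  next
    fix x y z
    assume "x \<in> carrier (semidirect H K act)" "y \<in> carrier (semidirect H K act)" "z \<in> carrier (semidirect H K act)"
    then show "x \<otimes>\<^bsub>semidirect H K act\<^esub> y \<otimes>\<^bsub>semidirect H K act\<^esub> z =
        x \<otimes>\<^bsub>semidirect H K act\<^esub> (y \<otimes>\<^bsub>semidirect H K act\<^esub> z)"
      by (cases x; cases y; cases z) (simp add: semidirect_def closed hom comp H.m_assoc K.m_assoc)
  next
    fix x assume "x \<in> carrier (semidirect H K act)"
    then obtain h k where x: "x = (h, k)" "h \<in> carrier H" "k \<in> carrier K"
      by (cases x) (simp add: semidirect_def)
    have "act k (act (inv\<^bsub>K\<^esub> k) (inv\<^bsub>H\<^esub> h)) = inv\<^bsub>H\<^esub> h"
      using comp[of "inv\<^bsub>K\<^esub> k" k "inv\<^bsub>H\<^esub> h"] x one by simp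
    then show "\<exists>y\<in>carrier (semidirect H K act). y \<otimes>\<^bsub>semidirect H K act\<^esub> x = \<one>\<^bsub>semidirect H K act\<^esub>"
      using x by (intro bexI[of _ "(act (inv\<^bsub>K\<^esub> k) (inv\<^bsub>H\<^esub> h), inv\<^bsub>K\<^esub> k)"])
        (simp_all add: semidirect_def closed)
  qed (auto simp: semidirect_def act_one)
qed

context group
begin

text \<open>Conjugation by \<open>y\<close> exchanges \<open>g\<close> and its inverse. The claim is
  made for both at once because each induction step passes from one to the other.\<close>

lemma pow_inverts:
  assumes y: "y \<in> carrier G" and g: "g \<in> carrier G" and yg: "y \<otimes> g = inv g \<otimes> y"
  shows "\<forall>h\<in>{g, inv g}. y [^] (n :: nat) \<otimes> h = (if even n then h else inv h) \<otimes> y [^] n"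
proof (induction n)
  case (Suc n)
  have "y = inv g \<otimes> y \<otimes> inv g"
    using yg y g by (metis inv_closed m_closed r_inv r_one m_assoc)
  then have "y \<otimes> inv g = g \<otimes> y"
    using y g by (metis inv_closed m_closed l_one m_assoc r_inv)
  with yg g have step: "\<forall>h\<in>{g, inv g}. y \<otimes> h = inv h \<otimes> y" by simp
  show ?case
  proof
    fix h assume h: "h \<in> {g, inv g}"
    then have hc: "h \<in> carrier G" "inv h \<in> {g, inv g}" using g by auto
    have yn: "y [^] n \<in> carrier G" using y by simp
    have "y [^] Suc n \<otimes> h = y [^] n \<otimes> (y \<otimes> h)" using y hc(1) yn by (simp add: m_assoc)
    also have "y \<otimes> h = inv h \<otimes> y" using step h by (rule bspec)
    also have "y [^] n \<otimes> (inv h \<otimes> y) = y [^] n \<otimes> inv h \<otimes> y" using y hc(1) yn by (simp add: m_assoc)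
    also have "y [^] n \<otimes> inv h = (if even n then inv h else inv (inv h)) \<otimes> y [^] n"
      using Suc.IH hc(2) by (rule bspec)
    also have "\<dots> \<otimes> y = (if even (Suc n) then h else inv h) \<otimes> y [^] Suc n"
      using y hc(1) yn by (simp add: m_assoc)
    finally show "y [^] Suc n \<otimes> h = (if even (Suc n) then h else inv h) \<otimes> y [^] Suc n" .
  qed
qed (use g in auto)

text \<open>The power of \<open>y\<close> to the order of the group is the identity and, being an
  odd power, still inverts \<open>g\<close>. So \<open>g\<close> is its own inverse, and odd order
  makes it trivial.\<close>

lemma odd_order_inverts:
  assumes "finite (carrier G)" "odd (Coset.order G)"
    and y: "y \<in> carrier G" and g: "g \<in> carrier G" and yg: "y \<otimes> g = inv g \<otimes> y"
  shows "g = \<one>"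
proof -
  have "\<one> \<otimes> g = inv g \<otimes> \<one>"
    using pow_inverts[OF y g yg, of "Coset.order G"] assms(2) pow_order_eq_1[OF y] by simp
  then have "g = inv g" using g by simp
  then have gg: "g [^] (2 :: nat) = \<one>" using g by (metis numeral_2_eq_2 nat_pow_Suc nat_pow_0 l_one r_inv)
  obtain k where k: "Coset.order G = 2 * k + 1" using assms(2) by (rule oddE)
  have "\<one> = g [^] (2 * k + 1)" using pow_order_eq_1[OF g] k by simp
  also have "\<dots> = (g [^] (2 :: nat)) [^] k \<otimes> g" using g by (simp add: nat_pow_pow)
  also have "\<dots> = g" using g gg by simp
  finally show ?thesis by (rule sym)
qed

end

text \<open>The hypotheses are the coefficients of x^3 and x^4 in the relation of
  \<open>q_inverted\<close> once \<open>a = 0\<close>. For nonzero \<open>b\<close>, the first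
  leaves \<open>e = 0\<close> or \<open>b = e ^ 3\<close>; multiplying the second by
  \<open>b ^ 2\<close> or \<open>e ^ 6\<close> then gives a sum of trace 1, with
  \<open>f * b ^ 6\<close> or \<open>f * e ^ 4\<close> in the role of z.\<close>

lemma f8_inverted_eqs:
  fixes b :: f8
  assumes h1: "b * e ^ 4 + e * b ^ 2 = 0" and h2: "b * f ^ 4 + c * e + e * c ^ 2 + (b + f) * b ^ 4 = 0"
  shows "b = 0"
proof (rule ccontr)
  assume b: "b \<noteq> 0"
  show False
  proof (cases "e = 0")
    case True
    have "b ^ 24 = (b ^ 8) ^ 3" by (simp only: power_mult[symmetric]) simp
    then have "(f * b ^ 6) ^ 4 = f ^ 4 * b ^ 3" by (simp add: power_mult_distrib flip: power_mult)
    moreover have "(b * f ^ 4 + (b + f) * b ^ 4) * b ^ 2 = f ^ 4 * b ^ 3 + b ^ 7 + f * b ^ 6"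
      by (simp add: algebra_simps eval_nat_numeral)
    ultimately have "(f * b ^ 6) ^ 4 + 1 + f * b ^ 6 = 0" using h2 True f8_power7[OF b] by simp
    then have "f8_trace ((f * b ^ 6) ^ 4 + 1 + f * b ^ 6) = 0" by simp
    then show False by (simp only: f8_trace_add f8_trace_power4 f8_trace_1) (simp add: add_ac)
  next
    case False
    note e7 = f8_power7[OF False]
    have "b * e * (e ^ 3 + b) = 0" using h1 by (simp add: algebra_simps eval_nat_numeral)
    then have be: "b = e ^ 3" using b False f8_add_eq_0_iff[of "e ^ 3" b] by simp
    \<comment> \<open>Stated over an arbitrary commutative ring, so that the factors
      \<open>e ^ 7\<close> stay visible until they are replaced by 1.\<close>
    have ring: "(e ^ 3 * f ^ 4 + c * e + e * c ^ 2 + (e ^ 3 + f) * (e ^ 3) ^ 4) * e ^ 6 =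
        f ^ 4 * (e ^ 7 * e ^ 2) + (c + c ^ 2) * e ^ 7 + e ^ 7 * e ^ 7 * e ^ 7 + f * (e ^ 7 * e ^ 7 * e ^ 4)"
      for e c f :: "'z :: comm_ring_1" by (simp add: algebra_simps eval_nat_numeral)
    have "e ^ 16 = (e ^ 8) ^ 2" by (simp only: power_mult[symmetric]) simp
    then have fe: "(f * e ^ 4) ^ 4 = f ^ 4 * e ^ 2" by (simp add: power_mult_distrib flip: power_mult)
    have "(f * e ^ 4) ^ 4 + (c + c ^ 2) + 1 + f * e ^ 4 = 0"
      using ring[of e f c] h2[unfolded be] unfolding e7 fe by simp
    then have "f8_trace ((f * e ^ 4) ^ 4 + (c + c ^ 2) + 1 + f * e ^ 4) = 0" by simp
    then show False
      by (simp only: f8_trace_add f8_trace_power4 f8_trace_power2 f8_trace_1) (simp add: add_ac)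
  qed
qed

context f8_iso
begin

text \<open>The coefficient of x is no constraint, since \<open>a + e + a = e\<close>. That of x^2
  gives \<open>a = 0\<close>; those of x^3 and x^4 have to be used together to give
  \<open>b = 0\<close>.\<close>

lemma q_inverted:
  assumes "q a b c d \<otimes>\<^bsub>U\<^esub> q e f g h \<otimes>\<^bsub>U\<^esub> q a b c d = q e f g h"
  shows "a = 0" "b = 0"
proof -
  have "b + f + a * e ^ 2 + b + (a + e) * a ^ 2 = f" using assms by (simp add: q_mult)
  then have "f + a * (e ^ 2 + e * a + a ^ 2) = f + 0" by (simp add: algebra_simps power2_eq_square)
  then have "a * (e ^ 2 + e * a + a ^ 2) = 0" by (simp only: add_left_cancel)
  then show a: "a = 0" using f8_no_cube_root_of_unity[of e a] by auto
  have "c + g + b * e ^ 4 + c + e * b ^ 2 = g" and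
    "d + h + b * f ^ 4 + c * e + d + e * c ^ 2 + (b + f) * b ^ 4 = h"
    using assms by (simp_all add: q_mult a add_ac)
  then have "g + (b * e ^ 4 + e * b ^ 2) = g + 0"
    and "h + (b * f ^ 4 + c * e + e * c ^ 2 + (b + f) * b ^ 4) = h + 0"
    by (simp_all add: add_ac)
  then have "b * e ^ 4 + e * b ^ 2 = 0" "b * f ^ 4 + c * e + e * c ^ 2 + (b + f) * b ^ 4 = 0"
    by (simp_all only: add_left_cancel)
  then show "b = 0" by (rule f8_inverted_eqs)
qed

section \<open>The groups \<open>CGal_group F\<close> and \<open>G_group F\<close> in
  coordinates\<close>

lemma Gal_mult: "fr i \<otimes>\<^bsub>Gal_group F\<^esub> fr j = fr (i + j)"
  unfolding Gal_group_def
  by (simp, rule fr_eqI) (simp_all add: compose_eq power_add power_mult)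

lemma Gal_one: "\<one>\<^bsub>Gal_group F\<^esub> = fr 0"
  unfolding Gal_group_def by (simp, rule fr_eqI) simp_all

lemma fr_mult_3: "fr (3 * j) = fr 0"
proof (rule fr_eqI)
  show "fr (3 * j) (\<iota> a) = \<iota> (a ^ 2 ^ 0)" for a
    using f8_power_8_power[of a j] by (simp add: power_mult)
qed (simp add: fr_def)

lemma Gal_cases: "\<sigma> \<in> carrier (Gal_group F) \<Longrightarrow> (\<And>j. \<sigma> = fr j \<Longrightarrow> thesis) \<Longrightarrow> thesis"
  unfolding Gal_carrier by blast

lemma group_Gal: "Group.group (Gal_group F)"
proof (rule groupI)
  fix x assume "x \<in> carrier (Gal_group F)"
  then obtain j where x: "x = fr j" by (rule Gal_cases)
  have "fr (2 * j) \<otimes>\<^bsub>Gal_group F\<^esub> x = \<one>\<^bsub>Gal_group F\<^esub>"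
    using fr_mult_3[of j] by (simp add: x Gal_mult Gal_one)
  then show "\<exists>y\<in>carrier (Gal_group F). y \<otimes>\<^bsub>Gal_group F\<^esub> x = \<one>\<^bsub>Gal_group F\<^esub>"
    using fr_in_Gal by (rule bexI)
qed (auto elim!: Gal_cases simp: Gal_mult Gal_one fr_in_Gal add.assoc)

lemma group_C: "Group.group (C_group F)"
  unfolding C_group_def by (rule units_group)

lemma C_mult: "\<iota> s \<otimes>\<^bsub>C_group F\<^esub> \<iota> t = \<iota> (s * t)"
  by (simp add: C_group_def units_of_def iota_mult)

lemma C_one: "\<one>\<^bsub>C_group F\<^esub> = \<iota> 1"
  by (simp add: C_group_def units_of_def iota_1)

lemma C_cases: "c \<in> carrier (C_group F) \<Longrightarrow> (\<And>t. c = \<iota> t \<Longrightarrow> t \<noteq> 0 \<Longrightarrow> thesis) \<Longrightarrow> thesis"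
  unfolding C_carrier by blast

lemma group_CGal: "Group.group (CGal_group F)"
  unfolding CGal_group_def
proof (rule semidirect_group[OF group_C group_Gal])
  show "k (h \<otimes>\<^bsub>C_group F\<^esub> h') = k h \<otimes>\<^bsub>C_group F\<^esub> k h'"
    if "k \<in> carrier (Gal_group F)" "h \<in> carrier (C_group F)" "h' \<in> carrier (C_group F)" for k h h'
    by (rule Gal_cases[OF that(1)], rule C_cases[OF that(2)], rule C_cases[OF that(3)])
      (simp add: C_mult power_mult_distrib)
  show "k h \<in> carrier (C_group F)" if "k \<in> carrier (Gal_group F)" "h \<in> carrier (C_group F)" for k h
    by (rule Gal_cases[OF that(1)], rule C_cases[OF that(2)]) (simp add: iota_in_C)
  show "\<one>\<^bsub>Gal_group F\<^esub> h = h" if "h \<in> carrier (C_group F)" for h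
    by (rule C_cases[OF that]) (simp add: Gal_one)
  show "(k \<otimes>\<^bsub>Gal_group F\<^esub> l) h = l (k h)"
    if "k \<in> carrier (Gal_group F)" "l \<in> carrier (Gal_group F)" "h \<in> carrier (C_group F)" for k l h
    by (rule Gal_cases[OF that(1)], rule Gal_cases[OF that(2)], rule C_cases[OF that(3)])
      (simp add: Gal_mult power_add power_mult)
qed

lemma CGal_carrier: "carrier (CGal_group F) = carrier (C_group F) \<times> carrier (Gal_group F)"
  by (simp add: CGal_group_def semidirect_def)

lemma CGal_cases:
  assumes "k \<in> carrier (CGal_group F)"
  obtains t j where "k = (\<iota> t, fr j)" "t \<noteq> 0"
  using assms unfolding CGal_carrier by (auto elim!: C_cases Gal_cases)

lemma CGal_in: "t \<noteq> 0 \<Longrightarrow> (\<iota> t, fr j) \<in> carrier (CGal_group F)"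
  by (simp add: CGal_carrier iota_in_C fr_in_Gal)

lemma CGal_mult: "(\<iota> t, fr j) \<otimes>\<^bsub>CGal_group F\<^esub> (\<iota> s, fr i) = (\<iota> (t ^ (2 ^ i) * s), fr (j + i))"
  by (simp add: CGal_group_def semidirect_def C_mult Gal_mult)

lemma CGal_one: "\<one>\<^bsub>CGal_group F\<^esub> = (\<iota> 1, fr 0)"
  by (simp add: CGal_group_def semidirect_def C_one Gal_one)

lemma order_CGal: "finite (carrier (CGal_group F))" "odd (Coset.order (CGal_group F))"
proof -
  have C: "carrier (C_group F) = \<iota> ` (UNIV - {0})" by (auto simp: C_carrier)
  have "card (carrier (C_group F)) = 7"
    unfolding C by (subst card_image) (simp_all add: inj_on_def card_f8)
  moreover have "fr 0 (\<iota> (F8 0 1 0)) \<noteq> fr 1 (\<iota> (F8 0 1 0))" "fr 0 (\<iota> (F8 0 1 0)) \<noteq> fr 2 (\<iota> (F8 0 1 0))"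
    "fr 1 (\<iota> (F8 0 1 0)) \<noteq> fr 2 (\<iota> (F8 0 1 0))"
    by (simp_all add: f8_power2_eq f8_power4_eq)
  then have "fr 0 \<noteq> fr 1" "fr 0 \<noteq> fr 2" "fr 1 \<noteq> fr 2" by metis+
  then have "card (carrier (Gal_group F)) = 3" by (simp add: Gal_carrier)
  ultimately show "odd (Coset.order (CGal_group F))"
    by (simp add: Coset.order_def CGal_carrier card_cartesian_product)
  show "finite (carrier (CGal_group F))" by (simp add: CGal_carrier C Gal_carrier)
qed

lemma CGal_act_q:
  assumes "t \<noteq> 0"
  shows "CGal_act F (\<iota> t, fr j) (q a b c d) =
    q (a ^ (2 ^ j) * t) (b ^ (2 ^ j) * t ^ 3) (c ^ (2 ^ j)) (d ^ (2 ^ j) * t)"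
  by (simp add: CGal_act_def Gal_act_q C_act_q[OF assms])

text \<open>The weights 2^i - 1 of the coefficients are compatible with the twisted product because
  (2^i - 1) + 2^i (2^k - 1) = 2^(i+k) - 1; the facts \<open>t7\<close> are its instances, reduced
  modulo 7.\<close>

lemma CGal_act_mult:
  assumes t: "t \<noteq> 0"
  shows "CGal_act F (\<iota> t, fr j) (q a b c d \<otimes>\<^bsub>U\<^esub> q a' b' c' d') =
    CGal_act F (\<iota> t, fr j) (q a b c d) \<otimes>\<^bsub>U\<^esub> CGal_act F (\<iota> t, fr j) (q a' b' c' d')"
proof -
  have pow: "(x ^ k) ^ (2 ^ j) = (x ^ (2 ^ j)) ^ k" for x :: f8 and k
    by (simp only: power_mult[symmetric] mult.commute)
  have t7: "t * t ^ 2 = t ^ 3" "t * (t ^ 3) ^ 2 = 1" "t ^ 3 * t ^ 4 = 1" "t ^ 3 * (t ^ 3) ^ 4 = t"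
    using f8_power7[OF t]
    by (simp_all add: f8_power_eq_self flip: power_mult power_Suc power_add)
  have m: "x * t * (y * t) ^ 2 = x * y ^ 2 * (t * t ^ 2)"
    "x * t * (y * t ^ 3) ^ 2 = x * y ^ 2 * (t * (t ^ 3) ^ 2)"
    "x * t ^ 3 * (y * t) ^ 4 = x * y ^ 4 * (t ^ 3 * t ^ 4)"
    "x * t ^ 3 * (y * t ^ 3) ^ 4 = x * y ^ 4 * (t ^ 3 * (t ^ 3) ^ 4)" for x y :: f8
    by (simp_all only: power_mult_distrib mult_ac)
  show ?thesis
    unfolding q_mult CGal_act_q[OF t] f8_add_power_2_power power_mult_distrib[of _ _ "2 ^ j"] pow m t7
    by (simp add: distrib_right distrib_left mult_ac)
qed

lemma P_group_simps: "carrier (P_group F) = PP" "x \<otimes>\<^bsub>P_group F\<^esub> y = x \<otimes>\<^bsub>U\<^esub> y"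
  "\<one>\<^bsub>P_group F\<^esub> = q 0 0 0 0"
  by (simp_all add: P_group_def P_subgroup_eq U_simps)

lemma group_P: "Group.group (P_group F)"
  unfolding P_group_def P_subgroup_eq by (rule subgroup.subgroup_is_group[OF subgroup_PP U.is_group])

lemma PP_cases:
  assumes "x \<in> PP"
  obtains a b c d where "x = q a b c d" "lam a b c = 0"
  using assms unfolding PP_def by blast

lemma q_in_PP: "lam a b c = 0 \<Longrightarrow> q a b c d \<in> PP"
  unfolding PP_def by blast

lemma group_G: "Group.group (G_group F)"
  unfolding G_group_def
proof (rule semidirect_group[OF group_P group_CGal], unfold P_group_simps)
  show "CGal_act F k (h \<otimes>\<^bsub>U\<^esub> h') = CGal_act F k h \<otimes>\<^bsub>U\<^esub> CGal_act F k h'"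
    if "k \<in> carrier (CGal_group F)" "h \<in> PP" "h' \<in> PP" for k h h'
    by (rule CGal_cases[OF that(1)], rule PP_cases[OF that(2)], rule PP_cases[OF that(3)])
      (simp only: CGal_act_mult simp_thms)
  show "CGal_act F k h \<in> PP" if "k \<in> carrier (CGal_group F)" "h \<in> PP" for k h
    by (rule CGal_cases[OF that(1)], rule PP_cases[OF that(2)])
      (simp only: CGal_act_q q_in_PP lam_act simp_thms)
  show "CGal_act F \<one>\<^bsub>CGal_group F\<^esub> h = h" if "h \<in> PP" for h
    by (rule PP_cases[OF that]) (simp add: CGal_one CGal_act_q)
  show "CGal_act F (k \<otimes>\<^bsub>CGal_group F\<^esub> l) h = CGal_act F l (CGal_act F k h)"
    if kl: "k \<in> carrier (CGal_group F)" "l \<in> carrier (CGal_group F)" and h: "h \<in> PP" for k l h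
  proof -
    obtain t j where k: "k = (\<iota> t, fr j)" "t \<noteq> 0" using kl(1) by (rule CGal_cases)
    obtain s i where l: "l = (\<iota> s, fr i)" "s \<noteq> 0" using kl(2) by (rule CGal_cases)
    obtain a b c d where hq: "h = q a b c d" using h by (rule PP_cases)
    have ts: "t ^ (2 ^ i) * s \<noteq> 0" using k(2) l(2) by simp
    have "(t ^ 3) ^ (2 ^ i) = (t ^ (2 ^ i)) ^ 3" by (simp only: power_mult[symmetric] mult.commute)
    then show ?thesis
      unfolding k(1) l(1) hq CGal_mult CGal_act_q[OF k(2)] CGal_act_q[OF l(2)] CGal_act_q[OF ts]
      by (simp add: power_add power_mult power_mult_distrib mult.assoc)
  qed
qed

lemma G_carrier: "carrier (G_group F) = PP \<times> carrier (CGal_group F)"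
  by (simp add: G_group_def semidirect_def P_group_simps)

lemma G_mult:
  "(p, k) \<otimes>\<^bsub>G_group F\<^esub> (p', k') = (CGal_act F k' p \<otimes>\<^bsub>U\<^esub> p', k \<otimes>\<^bsub>CGal_group F\<^esub> k')"
  by (simp add: G_group_def semidirect_def P_group_simps)

lemma G_one: "\<one>\<^bsub>G_group F\<^esub> = (q 0 0 0 0, \<one>\<^bsub>CGal_group F\<^esub>)"
  by (simp add: G_group_def semidirect_def P_group_simps)

sublocale G: finite_group "G_group F"
proof (intro finite_group.intro finite_group_axioms.intro group_G)
  have "PP \<subseteq> carrier U" unfolding PP_def by auto
  then show "finite (carrier (G_group F))"
    unfolding G_carrier using finite_carrier_U order_CGal(1) by (simp add: finite_subset)
qed

sublocale CG: group "CGal_group F" by (rule group_CGal)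

section \<open>Real elements of G and their classes\<close>

definition z :: "f8 \<Rightarrow> f8 \<Rightarrow> (nat \<Rightarrow> 'a) set \<times> 'a \<times> ('a \<Rightarrow> 'a)" where
  "z c d = (q 0 0 c d, \<one>\<^bsub>CGal_group F\<^esub>)"

lemma z_eq_iff [simp]: "z c d = z c' d' \<longleftrightarrow> c = c' \<and> d = d'"
  by (simp add: z_def)

lemma z_closed: "f8_trace c = 0 \<Longrightarrow> z c d \<in> carrier (G_group F)"
  by (simp add: z_def G_carrier q_in_PP lam_def)

text \<open>Conjugation appears as a commutation rule, free of inverses. The last two terms arise
  because x^3 commutes with constants (the twist by 8 is trivial), whereas x squares them: (c x^3)(e
  x) = e c x^4 but (e x)(c x^3) = e c^2 x^4.\<close>

lemma z_mult: "t \<noteq> 0 \<Longrightarrow> z c d \<otimes>\<^bsub>G_group F\<^esub> (q e f g h, \<iota> t, fr j) = (q e f g h, \<iota> t, fr j) \<otimes>\<^bsub>G_group F\<^esub>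
    z (c ^ (2 ^ j)) (d ^ (2 ^ j) * t + e * c ^ (2 ^ j) + e * (c ^ (2 ^ j)) ^ 2)"
  by (simp add: z_def G_mult CGal_one CGal_mult CGal_act_q q_mult power_0_left add_ac mult_ac)

text \<open>The coefficients of x^3 and x^4 add under multiplication, so in characteristic 2 the
  elements of X are involutions or trivial, and thus real.\<close>

lemma inv_z: "f8_trace c = 0 \<Longrightarrow> inv\<^bsub>G_group F\<^esub> z c d = z c d"
  by (rule G.inv_equality) (simp_all add: z_closed, simp add: z_def G_mult CGal_one CGal_mult CGal_act_q q_mult G_one)

lemma G_snd_pow: "y \<in> carrier (G_group F) \<Longrightarrow> snd (y [^]\<^bsub>G_group F\<^esub> (n :: nat)) = snd y [^]\<^bsub>CGal_group F\<^esub> n"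
proof (induction n)
  case (Suc n)
  then show ?case by (cases y; cases "y [^]\<^bsub>G_group F\<^esub> n") (simp add: G_mult)
qed (simp add: G_one)

lemma real_element_is_z:
  assumes g: "g \<in> carrier (G_group F)" and real: "inv\<^bsub>G_group F\<^esub> g \<in> G.conj_class g"
  obtains c d where "g = z c d" "f8_trace c = 0"
proof -
  obtain y where y: "y \<in> carrier (G_group F)"
    and inv: "inv\<^bsub>G_group F\<^esub> g = y \<otimes>\<^bsub>G_group F\<^esub> g \<otimes>\<^bsub>G_group F\<^esub> inv\<^bsub>G_group F\<^esub> y"
    using real unfolding G.conj_class_def by blast
  have yg: "y \<otimes>\<^bsub>G_group F\<^esub> g = inv\<^bsub>G_group F\<^esub> g \<otimes>\<^bsub>G_group F\<^esub> y"
    unfolding inv using y g by (simp add: G.m_assoc)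
  have absorb: "g \<otimes>\<^bsub>G_group F\<^esub> (w \<otimes>\<^bsub>G_group F\<^esub> g) = w"
    if w: "w \<in> carrier (G_group F)" "w \<otimes>\<^bsub>G_group F\<^esub> g = inv\<^bsub>G_group F\<^esub> g \<otimes>\<^bsub>G_group F\<^esub> w" for w
  proof -
    have "g \<otimes>\<^bsub>G_group F\<^esub> (inv\<^bsub>G_group F\<^esub> g \<otimes>\<^bsub>G_group F\<^esub> w) = g \<otimes>\<^bsub>G_group F\<^esub> inv\<^bsub>G_group F\<^esub> g \<otimes>\<^bsub>G_group F\<^esub> w"
      by (rule G.m_assoc[symmetric, OF g G.inv_closed[OF g] w(1)])
    then show ?thesis using w g by simp
  qed
  obtain p k where gpk: "g = (p, k)" by (cases g)
  obtain u l where yul: "y = (u, l)" by (cases y)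
  have pk: "p \<in> PP" "k \<in> carrier (CGal_group F)" and ul: "l \<in> carrier (CGal_group F)"
    using g y by (simp_all add: gpk yul G_carrier)
  \<comment> \<open>The second component of the relation shows that \<open>l\<close> inverts
    \<open>k\<close> in a group of odd order.\<close>
  have kl: "k \<otimes>\<^bsub>CGal_group F\<^esub> (l \<otimes>\<^bsub>CGal_group F\<^esub> k) = l"
    using absorb[OF y yg] by (simp add: gpk yul G_mult)
  have lk: "l \<otimes>\<^bsub>CGal_group F\<^esub> k = inv\<^bsub>CGal_group F\<^esub> k \<otimes>\<^bsub>CGal_group F\<^esub> l"
    using CG.inv_solve_left[of "l \<otimes>\<^bsub>CGal_group F\<^esub> k" k l] pk(2) ul kl by simp
  have k1: "k = \<one>\<^bsub>CGal_group F\<^esub>"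
    by (rule CG.odd_order_inverts[OF order_CGal ul pk(2) lk])
  \<comment> \<open>This exponent serves two purposes: as it is odd, the power of \<open>y\<close>
    still inverts \<open>g\<close>, and as it is the order of \<open>CGal_group F\<close>, the power
    lies in P.\<close>
  let ?n = "Coset.order (CGal_group F)"
  let ?w = "y [^]\<^bsub>G_group F\<^esub> ?n"
  have w: "?w \<in> carrier (G_group F)" using y by simp
  have wg: "?w \<otimes>\<^bsub>G_group F\<^esub> g = inv\<^bsub>G_group F\<^esub> g \<otimes>\<^bsub>G_group F\<^esub> ?w"
    using G.pow_inverts[OF y g yg, of ?n] order_CGal(2) by simp
  have "snd ?w = \<one>\<^bsub>CGal_group F\<^esub>"
    using G_snd_pow[OF y, of ?n] CG.pow_order_eq_1[OF ul] by (simp add: yul)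
  then obtain v where v: "?w = (v, \<one>\<^bsub>CGal_group F\<^esub>)" by (cases ?w) simp
  then have "v \<in> PP" using w by (simp add: G_carrier)
  then obtain e f g' h where vq: "v = q e f g' h" by (rule PP_cases)
  obtain a b c d where pq: "p = q a b c d" "lam a b c = 0" using pk(1) by (rule PP_cases)
  have "q a b c d \<otimes>\<^bsub>U\<^esub> (q e f g' h \<otimes>\<^bsub>U\<^esub> q a b c d) = q e f g' h"
    using absorb[OF w wg] unfolding v vq gpk k1 pq(1)
    by (simp add: G_mult CGal_one CGal_mult CGal_act_q q_mult)
  then have "a = 0" "b = 0"
    using q_inverted[of a b c d e f g' h] by (simp_all add: U.m_assoc)
  \<comment> \<open>With \<open>a = b = 0\<close> the condition \<open>lam a b c = 0\<close> says
    that \<open>c\<close> has trace 0.\<close>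
  then show ?thesis using that[of c d] pq by (simp add: gpk k1 z_def lam_def)
qed

lemma z_conj_iff:
  assumes c: "f8_trace c = 0" and c': "f8_trace c' = 0"
  shows "z c d \<in> G.conj_class (z c' d') \<longleftrightarrow>
    (\<exists>e t j. t \<noteq> 0 \<and> c' = c ^ (2 ^ j) \<and> d' = d ^ (2 ^ j) * t + e * c ^ (2 ^ j) + e * (c ^ (2 ^ j)) ^ 2)"
proof -
  have conj: "z c d \<in> G.conj_class (z c' d') \<longleftrightarrow>
      (\<exists>w\<in>carrier (G_group F). z c d \<otimes>\<^bsub>G_group F\<^esub> w = w \<otimes>\<^bsub>G_group F\<^esub> z c' d')"
    unfolding G.conj_class_def image_iff
    using G.inv_solve_right[OF z_closed[OF c]] z_closed[OF c']
    by (intro bex_cong refl) (metis G.m_closed)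
  have cancel: "z c d \<otimes>\<^bsub>G_group F\<^esub> (q e f g h, \<iota> t, fr j) = (q e f g h, \<iota> t, fr j) \<otimes>\<^bsub>G_group F\<^esub> z c' d' \<longleftrightarrow>
      c' = c ^ (2 ^ j) \<and> d' = d ^ (2 ^ j) * t + e * c ^ (2 ^ j) + e * (c ^ (2 ^ j)) ^ 2"
    if t: "t \<noteq> 0" and w: "(q e f g h, \<iota> t, fr j) \<in> carrier (G_group F)" for e f g h t j
  proof -
    let ?c = "c ^ (2 ^ j)" and ?d = "d ^ (2 ^ j) * t + e * c ^ (2 ^ j) + e * (c ^ (2 ^ j)) ^ 2"
    have "z ?c ?d \<in> carrier (G_group F)" using c by (intro z_closed) simp
    then have "(q e f g h, \<iota> t, fr j) \<otimes>\<^bsub>G_group F\<^esub> z ?c ?d = (q e f g h, \<iota> t, fr j) \<otimes>\<^bsub>G_group F\<^esub> z c' d' \<longleftrightarrow>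
        z ?c ?d = z c' d'"
      using w z_closed[OF c'] by (intro G.Units_l_cancel) (simp_all only: G.Units_eq)
    then show ?thesis unfolding z_mult[OF t] z_eq_iff by (simp only: eq_commute)
  qed
  show ?thesis
    unfolding conj
  proof
    assume "\<exists>w\<in>carrier (G_group F). z c d \<otimes>\<^bsub>G_group F\<^esub> w = w \<otimes>\<^bsub>G_group F\<^esub> z c' d'"
    then obtain p k where w: "(p, k) \<in> carrier (G_group F)"
      "z c d \<otimes>\<^bsub>G_group F\<^esub> (p, k) = (p, k) \<otimes>\<^bsub>G_group F\<^esub> z c' d'" by auto
    then have "p \<in> PP" "k \<in> carrier (CGal_group F)" by (simp_all add: G_carrier)
    obtain e f g h where p: "p = q e f g h" using \<open>p \<in> PP\<close> by (rule PP_cases)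
    obtain t j where k: "k = (\<iota> t, fr j)" "t \<noteq> 0" using \<open>k \<in> _\<close> by (rule CGal_cases)
    show "\<exists>e t j. t \<noteq> 0 \<and> c' = c ^ (2 ^ j) \<and> d' = d ^ (2 ^ j) * t + e * c ^ (2 ^ j) + e * (c ^ (2 ^ j)) ^ 2"
      using cancel[OF k(2), of e f g h j] w k(2) unfolding p k(1) by blast
  next
    assume "\<exists>e t j. t \<noteq> 0 \<and> c' = c ^ (2 ^ j) \<and> d' = d ^ (2 ^ j) * t + e * c ^ (2 ^ j) + e * (c ^ (2 ^ j)) ^ 2"
    then obtain e t j where t: "t \<noteq> 0"
      and *: "c' = c ^ (2 ^ j) \<and> d' = d ^ (2 ^ j) * t + e * c ^ (2 ^ j) + e * (c ^ (2 ^ j)) ^ 2" by blast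
    \<comment> \<open>The coefficient \<open>e ^ 7\<close> of x^3 makes \<open>lam\<close> vanish,
      so P has an element with any prescribed coefficient \<open>e\<close> of x.\<close>
    have w: "(q e 0 (e ^ 7) 0, \<iota> t, fr j) \<in> carrier (G_group F)"
      by (simp add: G_carrier CGal_in t q_in_PP lam_def)
    show "\<exists>w\<in>carrier (G_group F). z c d \<otimes>\<^bsub>G_group F\<^esub> w = w \<otimes>\<^bsub>G_group F\<^esub> z c' d'"
      using cancel[OF t w] * w by blast
  qed
qed

lemma z_conj_class_eq_iff:
  assumes "f8_trace c = 0" "f8_trace c' = 0"
  shows "G.conj_class (z c d) = G.conj_class (z c' d') \<longleftrightarrow>
    (\<exists>e t j. t \<noteq> 0 \<and> c' = c ^ (2 ^ j) \<and> d' = d ^ (2 ^ j) * t + e * c ^ (2 ^ j) + e * (c ^ (2 ^ j)) ^ 2)"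
  unfolding z_conj_iff[OF assms, symmetric]
  by (rule G.conj_class_eq_iff[OF z_closed[OF assms(2)] z_closed[OF assms(1)]])

lemma z_conj_class_eqI:
  assumes "f8_trace c = 0" "f8_trace c' = 0" "t \<noteq> 0" "c' = c ^ (2 ^ j)"
    "d' = d ^ (2 ^ j) * t + e * c ^ (2 ^ j) + e * (c ^ (2 ^ j)) ^ 2"
  shows "G.conj_class (z c d) = G.conj_class (z c' d')"
  unfolding z_conj_class_eq_iff[OF assms(1,2)] by (intro exI conjI) (fact assms(3-5))+

lemma z_conj_class_cases:
  assumes c: "f8_trace c = 0"
  shows "G.conj_class (z c d) \<in> {G.conj_class (z 0 0), G.conj_class (z 0 1), G.conj_class (z (F8 0 1 0) 0)}"
proof -
  let ?\<tau> = "F8 0 1 0"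
  have \<tau>: "f8_trace ?\<tau> = 0" "?\<tau> \<noteq> 0" "?\<tau> + ?\<tau> ^ 2 \<noteq> 0"
    by (simp_all add: f8_trace_eq zero_f8_def f8_power2_eq)
  consider "c = 0" "d = 0" | "c = 0" "d \<noteq> 0" | "c \<noteq> 0" by blast
  then show ?thesis
  proof cases
    case 1
    then show ?thesis by simp
  next
    case 2
    \<comment> \<open>The action of \<open>d ^ 6\<close>, the inverse of \<open>d\<close>, takes the
      coefficient \<open>d\<close> to 1.\<close>
    have "d * d ^ 6 = 1" using f8_power7[OF 2(2)] by (simp flip: power_Suc)
    then have "G.conj_class (z c d) = G.conj_class (z 0 1)"
      using 2 c by (intro z_conj_class_eqI[where t = "d ^ 6" and j = 0 and e = 0]) simp_all
    then show ?thesis by simp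
  next
    case 3
    have "?\<tau> = c \<or> ?\<tau> = c ^ 2 \<or> ?\<tau> = c ^ 4" by (rule f8_trace_0_orbit[OF c 3 \<tau>(1,2)])
    moreover have "c = c ^ (2 ^ 0)" "c ^ 2 = c ^ (2 ^ 1)" "c ^ 4 = c ^ (2 ^ 2)" by simp_all
    ultimately obtain j where j: "?\<tau> = c ^ (2 ^ j)" by metis
    define D where "D = d ^ (2 ^ j)"
    \<comment> \<open>Conjugation changes the coefficient of x^4 by
      \<open>e * (?\<tau> + ?\<tau> ^ 2)\<close>. As the second factor is nonzero, its sixth power
      is its inverse, and this \<open>e\<close> removes \<open>D\<close>.\<close>
    define e where "e = D * (?\<tau> + ?\<tau> ^ 2) ^ 6"
    have "e * (?\<tau> + ?\<tau> ^ 2) = D * (?\<tau> + ?\<tau> ^ 2) ^ 7"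
      unfolding e_def by (simp only: mult.assoc power_Suc2[symmetric]) simp
    then have "e * (?\<tau> + ?\<tau> ^ 2) = D" using f8_power7[OF \<tau>(3)] by simp
    then have D: "0 = D * 1 + e * ?\<tau> + e * ?\<tau> ^ 2"
      by (simp only: mult_1_right add.assoc distrib_left[symmetric] f8_add_self)
    have "G.conj_class (z c d) = G.conj_class (z ?\<tau> 0)"
      by (rule z_conj_class_eqI[OF c \<tau>(1) one_neq_zero j D[unfolded j D_def]])
    then show ?thesis by simp
  qed
qed

lemma card_real_classes:
  "card (G.conj_class ` {g \<in> carrier (G_group F). inv\<^bsub>G_group F\<^esub> g \<in> G.conj_class g}) = 3"
proof -
  let ?\<tau> = "F8 0 1 0"
  have \<tau>: "f8_trace ?\<tau> = 0" "?\<tau> \<noteq> 0" by (simp_all add: f8_trace_eq zero_f8_def)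
  have 0: "f8_trace 0 = 0" by simp
  have "G.conj_class ` {g \<in> carrier (G_group F). inv\<^bsub>G_group F\<^esub> g \<in> G.conj_class g} =
      {G.conj_class (z 0 0), G.conj_class (z 0 1), G.conj_class (z ?\<tau> 0)}" (is "?A = ?B")
  proof
    show "?A \<subseteq> ?B"
    proof (rule image_subsetI, elim CollectE conjE)
      fix g assume "g \<in> carrier (G_group F)" "inv\<^bsub>G_group F\<^esub> g \<in> G.conj_class g"
      then obtain c d where "g = z c d" "f8_trace c = 0" by (rule real_element_is_z)
      then show "G.conj_class g \<in> ?B" by (simp only: z_conj_class_cases)
    qed
    have "G.conj_class (z c d) \<in> ?A" if "f8_trace c = 0" for c d
    proof (rule imageI, rule CollectI, rule conjI)
      show "z c d \<in> carrier (G_group F)" by (rule z_closed[OF that])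
      then show "inv\<^bsub>G_group F\<^esub> z c d \<in> G.conj_class (z c d)"
        unfolding inv_z[OF that] by (rule G.conj_class_self)
    qed
    then show "?B \<subseteq> ?A" using \<tau>(1) 0 by blast
  qed
  \<comment> \<open>Conjugation preserves the vanishing of the coefficient of x^3 and, where that is
    0, the vanishing of the coefficient of x^4; this separates the three classes.\<close>
  moreover have "G.conj_class (z 0 1) \<noteq> G.conj_class (z 0 0)"
    unfolding z_conj_class_eq_iff[OF 0 0] by (simp add: power_0_left)
  moreover have "G.conj_class (z 0 1) \<noteq> G.conj_class (z ?\<tau> 0)"
    unfolding z_conj_class_eq_iff[OF 0 \<tau>(1)] using \<tau>(2) by (simp add: power_0_left)
  moreover have "G.conj_class (z ?\<tau> 0) \<noteq> G.conj_class (z 0 0)"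
    unfolding z_conj_class_eq_iff[OF \<tau>(1) 0]
  proof (intro notI, elim exE conjE)
    fix j :: nat assume "0 = ?\<tau> ^ (2 ^ j)"
    then have "?\<tau> ^ (2 ^ j) = 0" by (rule sym)
    then have "?\<tau> = 0" by (rule power_eq_0_iff[THEN iffD1, THEN conjunct1])
    then show False using \<tau>(2) by contradiction
  qed
  ultimately show ?thesis by simp
qed

end

theorem theorem1:
  fixes F :: "('a, 'm) ring_scheme"
  assumes "field F" and "card (carrier F) = 8"
  shows "card (real_irreducible_characters (G_group F)) = 3"
proof -
  interpret field F by fact
  obtain \<iota> where "f8_iso F \<iota>" using exists_f8_iso[OF assms(2)] by blast
  then interpret f8_iso F \<iota> .
  show ?thesis using G.card_real_irreducible_characters card_real_classes by simp
qed

end
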